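(* Let $A$ be a finite dimensional commutative $\mathbb{Q}$-algebra with unit element $1_A$, and let $A=F\oplus R$ be its canonical decomposition, with $R$ the radical, $F$ the separable subalgebra, and $\mathrm{pr}_F:A\to F$ the induced projection. (a) For each order $\Lambda$ in $A$ the set $\{[L]_\varepsilon\mid L\in\mathcal{L}(A),\ \mathcal{O}(L)=\Lambda\}\subset\mathcal{E}(A)$ is finite. (b) For each order $\Lambda$ in $A$ the set $\{[L]_\varepsilon\mid L\in\mathcal{L}(A),\ \mathcal{O}(L)=\Lambda\}$ splits into finitely many $w$-classes (of the semigroup $\mathcal{E}(A)$), which all have the same (by part (a) finite) size. One of them is the group $G([\Lambda]_\varepsilon)$. (c) Let $\Lambda_1$ and $\Lambda_2$ be orders in $A$ with $\Lambda_2\subset\Lambda_1$. There are natural surjective group homomorphisms $$G(\Lambda_2)\to G(\Lambda_1),\ L\mapsto \Lambda_1L,\qquad\text{and}\qquad G([\Lambda_2]_\varepsilon)\to G([\Lambda_1]_\varepsilon),\ [L]_\varepsilon\mapsto[\Lambda_1L]_\varepsilon .$$ (d) The projection $\mathrm{pr}_F:A\to F$ induces surjective homomorphisms of semigroups $\mathcal{L}(A)\to\mathcal{L}(F)$, $L\mapsto \mathrm{pr}_F L$, and $\mathcal{E}(A)\to\mathcal{E}(F)$, $[L]_\varepsilon\mapsto[\mathrm{pr}_FL]_\varepsilon$. For each order $\Lambda$ in $A$ they restrict to a surjective group homomorphism $G(\Lambda)\to G(\mathrm{pr}_F\Lambda)$ and to an isomorphism $G([\Lambda]_\varepsilon)\to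 G([\mathrm{pr}_F\Lambda]_\varepsilon)$ of finite groups. (e) Suppose $\dim_{\mathbb{Q}} A\geq 2$. For each full lattice $L$ in $A$, each power $L^k$ with $k\geq \dim_{\mathbb{Q}} A-1$ is invertible (in the semigroup $\mathcal{L}(A)$).
   Context: Structure of $A$: there is a unique decomposition $A=\bigoplus_{j=1}^kA^{(j)}$ into local $\mathbb{Q}$-algebras with $A^{(i)}A^{(j)}=0$ for $i\ne j$, and uniquely $A^{(j)}=F^{(j)}\oplus N^{(j)}$ with $F^{(j)}$ a $\mathbb{Q}$-subalgebra which is an algebraic number field and $N^{(j)}$ the maximal ideal of $A^{(j)}$, consisting of nilpotent elements. Put $F=\bigoplus_jF^{(j)}$ (a separable subalgebra) and $R=\bigoplus_jN^{(j)}$ (the radical, i.e. the ideal of all nilpotent elements). Then $A=F\oplus R$, and $\mathrm{pr}_F:A\to F$ is the projection along $R$, a ring homomorphism. Lattices: a full lattice in $A$ is a finitely generated $\mathbb{Z}$-submodule $L\subset A$ which generates $A$ over $\mathbb{Q}$; $\mathcal{L}(A)$ is the set of full lattices in $A$. For $L_1,L_2\in\mathcal{L}(A)$, $L_1L_2$ is the set of finite sums $\sum_i a_ib_i$ with $a_i\in L_1,b_i\in L_2$, and $L_1:L_2:=\{a\in A\mid aL_2\subset L_1\}$; both are full lattices. With this multiplication $\mathcal{L}(A)$ is a commutative semigroup. An order in $A$ is a full lattice $\Lambda$ with $1_A\in\Lambda$ and $\Lambda\Lambda\subset\Lambda$. The order of $L\in\mathcal{L}(A)$ is $\mathcal{O}(L):=L:L$.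 $\varepsilon$-equivalence: $L_1\sim_\varepsilon L_2$ iff $aL_1=L_2$ for some unit $a\in A^{unit}$ of $A$; $[L]_\varepsilon$ is the class of $L$, and $\mathcal{E}(A):=\mathcal{L}(A)/\sim_\varepsilon$ is a commutative semigroup with the induced multiplication. The same notions are used for $F$ instead of $A$. Commutative semigroups $S$: $c\in S$ is idempotent if $cc=c$. An element $a\in S$ is invertible if there are an idempotent $c$ and an element $b\in S$ with $ac=a$, $ab=c$; then $c$ is unique and is denoted $e_a$. For an idempotent $c$, $G(c):=\{a\in S\mid a\text{ invertible},\ e_a=c\}$, which is a group with unit element $c$. The idempotents of $\mathcal{L}(A)$ are the orders, and the idempotents of $\mathcal{E}(A)$ are the $\varepsilon$-classes of orders; so $G(\Lambda)$ (formed in $\mathcal{L}(A)$) and $G([\Lambda]_\varepsilon)$ (formed in $\mathcal{E}(A)$) are defined for each order $\Lambda$. The $w$-equivalence on $S$ is: $a\sim_w b$ iff $a=b$ or there exist $x_1,x_2\in S$ with $ax_1=b$ and $bx_2=a$; its classes are called $w$-classes. *)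

theory Defs
  imports Complex_Main "HOL-Algebra.Ideal"
begin

locale fin_dim_rat_algebra = vector_space scale
  for scale :: "rat \<Rightarrow> 'a::comm_ring_1 \<Rightarrow> 'a" +
  assumes scale_mult_left: "scale q x * y = scale q (x * y)"
    and finite_dimensional: "\<exists>B. finite B \<and> span B = UNIV"

text \<open>
  A subset \<open>B\<close> of the algebra, viewed as a ring with its own unit element \<open>e\<close>, which
  need not be \<open>1\<close>. This is used for the local summands, whose units are idempotents of the
  algebra.
\<close>

definition ring_on :: "'a::comm_ring_1 set \<Rightarrow> 'a \<Rightarrow> 'a ring" where
  "ring_on B e = \<lparr>carrier = B, mult = (*), one = e, zero = 0, add = (+)\<rparr>"

definition local_subalgebra :: "(rat \<Rightarrow> 'a::comm_ring_1 \<Rightarrow> 'a) \<Rightarrow> 'a set \<Rightarrow> 'a \<Rightarrow> bool" where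
  "local_subalgebra scale B e \<longleftrightarrow>
     module.subspace scale B \<and> cring (ring_on B e) \<and> (\<exists>!N. maximalideal N (ring_on B e))"

text \<open>
  \<open>canonical_decomposition scale k As Fs Ns\<close>: the algebra is the direct sum of the
  local algebras \<open>As j\<close> for \<open>1 \<le> j \<le> k\<close>, which annihilate each other, and each \<open>As j\<close> is the
  direct sum of the number field \<open>Fs j\<close>, a subalgebra with the same unit as \<open>As j\<close>, and the
  maximal ideal \<open>Ns j\<close>. Finiteness of the degree of \<open>Fs j\<close> over the rationals is automatic.
\<close>

definition canonical_decomposition ::
  "(rat \<Rightarrow> 'a::comm_ring_1 \<Rightarrow> 'a) \<Rightarrow> nat \<Rightarrow> (nat \<Rightarrow> 'a set) \<Rightarrow> (nat \<Rightarrow> 'a set) \<Rightarrow> (nat \<Rightarrow> 'a set) \<Rightarrow> bool"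
  where
  "canonical_decomposition scale k As Fs Ns \<longleftrightarrow>
     (\<forall>x. \<exists>!c. c \<in> (\<Pi>\<^sub>E j\<in>{1..k}. As j) \<and> x = (\<Sum>j=1..k. c j)) \<and>
     (\<forall>i\<in>{1..k}. \<forall>j\<in>{1..k}. i \<noteq> j \<longrightarrow> (\<forall>x\<in>As i. \<forall>y\<in>As j. x * y = 0)) \<and>
     (\<forall>j\<in>{1..k}. \<exists>e.
        local_subalgebra scale (As j) e \<and>
        Fs j \<subseteq> As j \<and> module.subspace scale (Fs j) \<and> field (ring_on (Fs j) e) \<and>
        maximalideal (Ns j) (ring_on (As j) e) \<and>
        (\<forall>x\<in>As j. \<exists>!p. p \<in> Fs j \<times> Ns j \<and> x = fst p + snd p))"

definition separable_part :: "(rat \<Rightarrow> 'a::comm_ring_1 \<Rightarrow> 'a) \<Rightarrow> 'a set \<Rightarrow> bool" where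
  "separable_part scale F \<longleftrightarrow>
     (\<exists>k As Fs Ns. canonical_decomposition scale k As Fs Ns \<and>
        F = {\<Sum>j=1..k. c j | c. \<forall>j\<in>{1..k}. c j \<in> Fs j})"

definition radical :: "'a::comm_ring_1 set" where
  "radical = {x. \<exists>n. x ^ n = 0}"

definition pr :: "'a::comm_ring_1 set \<Rightarrow> 'a \<Rightarrow> 'a" where
  "pr F x = (THE y. y \<in> F \<and> x - y \<in> radical)"

text \<open>
  In what follows \<open>B\<close> is a subalgebra with unit \<open>1\<close>; it is instantiated with the whole algebra
  (\<open>UNIV\<close>) and with its separable part (whose unit is the sum of the units of the
  summands, hence again \<open>1\<close>).
\<close>

definition int_span :: "'a::comm_ring_1 set \<Rightarrow> 'a set" where
  "int_span X = module.span (\<lambda>(k::int) x. of_int k * x) X"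

definition full_lattices :: "(rat \<Rightarrow> 'a::comm_ring_1 \<Rightarrow> 'a) \<Rightarrow> 'a set \<Rightarrow> 'a set set" where
  "full_lattices scale B =
     {L. L \<subseteq> B \<and> (\<exists>X. finite X \<and> L = int_span X) \<and> module.span scale L = B}"

definition lat_mult :: "'a::comm_ring_1 set \<Rightarrow> 'a set \<Rightarrow> 'a set" where
  "lat_mult L M = {\<Sum>i<n. a i * b i | (n::nat) a b. \<forall>i<n. a i \<in> L \<and> b i \<in> M}"

definition lat_colon :: "'a::comm_ring_1 set \<Rightarrow> 'a set \<Rightarrow> 'a set \<Rightarrow> 'a set" where
  "lat_colon B L M = {a \<in> B. (*) a ` M \<subseteq> L}"

definition order_of :: "'a::comm_ring_1 set \<Rightarrow> 'a set \<Rightarrow> 'a set" where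
  "order_of B L = lat_colon B L L"

definition orders :: "(rat \<Rightarrow> 'a::comm_ring_1 \<Rightarrow> 'a) \<Rightarrow> 'a set \<Rightarrow> 'a set set" where
  "orders scale B = {\<Lambda> \<in> full_lattices scale B. 1 \<in> \<Lambda> \<and> lat_mult \<Lambda> \<Lambda> \<subseteq> \<Lambda>}"

definition eps_rel :: "(rat \<Rightarrow> 'a::comm_ring_1 \<Rightarrow> 'a) \<Rightarrow> 'a set \<Rightarrow> 'a set rel" where
  "eps_rel scale B =
     {(L, M). L \<in> full_lattices scale B \<and> M \<in> full_lattices scale B \<and>
        (\<exists>a \<in> Units (ring_on B 1). (*) a ` L = M)}"

definition eps_class :: "(rat \<Rightarrow> 'a::comm_ring_1 \<Rightarrow> 'a) \<Rightarrow> 'a set \<Rightarrow> 'a set \<Rightarrow> 'a set set" where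
  "eps_class scale B L = eps_rel scale B `` {L}"

definition eps_mult ::
  "(rat \<Rightarrow> 'a::comm_ring_1 \<Rightarrow> 'a) \<Rightarrow> 'a set \<Rightarrow> 'a set set \<Rightarrow> 'a set set \<Rightarrow> 'a set set" where
  "eps_mult scale B X Y = (\<Union>L\<in>X. \<Union>M\<in>Y. eps_class scale B (lat_mult L M))"

record 'a semigrp =
  sg_carrier :: "'a set"
  sg_mult :: "'a \<Rightarrow> 'a \<Rightarrow> 'a"

definition comm_semigrp :: "'a semigrp \<Rightarrow> bool" where
  "comm_semigrp S \<longleftrightarrow>
     (\<forall>a\<in>sg_carrier S. \<forall>b\<in>sg_carrier S. sg_mult S a b \<in> sg_carrier S) \<and>
     (\<forall>a\<in>sg_carrier S. \<forall>b\<in>sg_carrier S. \<forall>c\<in>sg_carrier S.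
        sg_mult S (sg_mult S a b) c = sg_mult S a (sg_mult S b c)) \<and>
     (\<forall>a\<in>sg_carrier S. \<forall>b\<in>sg_carrier S. sg_mult S a b = sg_mult S b a)"

definition semigrp_epi :: "'a semigrp \<Rightarrow> 'b semigrp \<Rightarrow> ('a \<Rightarrow> 'b) \<Rightarrow> bool" where
  "semigrp_epi S T f \<longleftrightarrow>
     comm_semigrp S \<and> comm_semigrp T \<and>
     (\<forall>a\<in>sg_carrier S. \<forall>b\<in>sg_carrier S. f (sg_mult S a b) = sg_mult T (f a) (f b)) \<and>
     f ` sg_carrier S = sg_carrier T"

definition sg_idempotent :: "'a semigrp \<Rightarrow> 'a \<Rightarrow> bool" where
  "sg_idempotent S c \<longleftrightarrow> c \<in> sg_carrier S \<and> sg_mult S c c = c"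

definition sg_invertible_wrt :: "'a semigrp \<Rightarrow> 'a \<Rightarrow> 'a \<Rightarrow> bool" where
  "sg_invertible_wrt S a c \<longleftrightarrow>
     a \<in> sg_carrier S \<and> sg_idempotent S c \<and> sg_mult S a c = a \<and>
     (\<exists>b\<in>sg_carrier S. sg_mult S a b = c)"

definition sg_invertible :: "'a semigrp \<Rightarrow> 'a \<Rightarrow> bool" where
  "sg_invertible S a \<longleftrightarrow> (\<exists>c. sg_invertible_wrt S a c)"

definition sg_unit :: "'a semigrp \<Rightarrow> 'a \<Rightarrow> 'a" where
  "sg_unit S a = (THE c. sg_invertible_wrt S a c)"

definition sg_group :: "'a semigrp \<Rightarrow> 'a \<Rightarrow> 'a monoid" where
  "sg_group S c =
     \<lparr>carrier = {a. sg_invertible S a \<and> sg_unit S a = c}, mult = sg_mult S, one = c\<rparr>"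

definition w_rel :: "'a semigrp \<Rightarrow> 'a rel" where
  "w_rel S = {(a, b). a \<in> sg_carrier S \<and> b \<in> sg_carrier S \<and>
     (a = b \<or> (\<exists>x\<in>sg_carrier S. \<exists>y\<in>sg_carrier S. sg_mult S a x = b \<and> sg_mult S b y = a))}"

text \<open>The power \<open>a\<^sup>k\<close> in a semigroup, for \<open>k \<ge> 1\<close>; the value at \<open>k = 0\<close> is irrelevant.\<close>

definition sg_power :: "'a semigrp \<Rightarrow> 'a \<Rightarrow> nat \<Rightarrow> 'a" where
  "sg_power S a k = ((\<lambda>x. sg_mult S x a) ^^ (k - 1)) a"

definition lattice_sg :: "(rat \<Rightarrow> 'a::comm_ring_1 \<Rightarrow> 'a) \<Rightarrow> 'a set \<Rightarrow> 'a set semigrp" where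
  "lattice_sg scale B = \<lparr>sg_carrier = full_lattices scale B, sg_mult = lat_mult\<rparr>"

definition eps_sg :: "(rat \<Rightarrow> 'a::comm_ring_1 \<Rightarrow> 'a) \<Rightarrow> 'a set \<Rightarrow> 'a set set semigrp" where
  "eps_sg scale B =
     \<lparr>sg_carrier = full_lattices scale B // eps_rel scale B, sg_mult = eps_mult scale B\<rparr>"

definition eps_classes_with_order ::
  "(rat \<Rightarrow> 'a::comm_ring_1 \<Rightarrow> 'a) \<Rightarrow> 'a set \<Rightarrow> 'a set \<Rightarrow> 'a set set set" where
  "eps_classes_with_order scale B \<Lambda> =
     {eps_class scale B L | L. L \<in> full_lattices scale B \<and> order_of B L = \<Lambda>}"

text \<open>Surjective group homomorphism; \<open>group_hom\<close> includes that both sides are groups.\<close>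

definition group_epi :: "'a monoid \<Rightarrow> 'b monoid \<Rightarrow> ('a \<Rightarrow> 'b) \<Rightarrow> bool" where
  "group_epi G H f \<longleftrightarrow> group_hom G H f \<and> f ` carrier G = carrier H"

end

theory Submission
  imports Defs "HOL-Computational_Algebra.Polynomial" "HOL-Library.Multiset"
begin

text \<open>
  Finitely many residues modulo a positive integer \<open>N\<close> take the place of localisation
  throughout, and the additive subgroups of the algebra, which form a commutative semiring
  \<open>zmod\<close> under sum and product, carry all calculations with lattices.

  (a) Let \<open>\<Lambda>\<close> be the order of \<open>L\<close>. A counting argument of Minkowski type in each number
  field factor of \<open>F\<close> gives an \<open>x\<close> in the projection of \<open>L\<close> that generates it up to an index
  bounded in terms of \<open>\<Lambda>\<close> (\<open>lattice_generator\<close>). A preimage of \<open>x\<close> in \<open>L\<close> is a unit, so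
  up to \<open>\<epsilon>\<close>-equivalence \<open>1 \<in> L\<close> and \<open>N \<cdot> pr L \<subseteq> \<Lambda>\<close>. If \<open>a \<in> L\<close> is annihilated by the
  radical, then \<open>a L = a \<cdot> pr L\<close>, hence \<open>N a L \<subseteq> L\<close>, that is, \<open>N a \<in> \<Lambda>\<close>. Since the radical is
  nilpotent, this propagates to all of \<open>L\<close> after enlarging \<open>N\<close>
  (\<open>lattice_bounded_by_order\<close>). So \<open>\<Lambda> \<subseteq> L \<subseteq> (1/N) \<Lambda>\<close>, which leaves finitely many \<open>L\<close>.

  (b) By Nakayama's lemma an ideal of \<open>\<Lambda>\<close> that fixes \<open>L\<close> is \<open>\<Lambda>\<close> itself, if \<open>\<Lambda>\<close> is the
  order of \<open>L\<close>. Consequently the group \<open>G([\<Lambda>])\<close> acts freely on the classes with order \<open>\<Lambda>\<close>,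
  and its orbits are the \<open>w\<close>-classes (\<open>w_class_bij\<close>).

  (c) A lattice \<open>L\<^sub>1\<close> that is invertible over \<open>\<Lambda>\<^sub>1\<close> has a generator \<open>x\<close> modulo \<open>N\<close>, because
  \<open>\<Lambda>\<^sub>1 / N \<Lambda>\<^sub>1\<close> is a finite ring (\<open>invertible_principal_mod\<close>). If \<open>N \<Lambda>\<^sub>1 \<subseteq> \<Lambda>\<^sub>2\<close>, then
  \<open>x \<Lambda>\<^sub>2 + N L\<^sub>1\<close> is invertible over \<open>\<Lambda>\<^sub>2\<close> and generates \<open>L\<^sub>1\<close> over \<open>\<Lambda>\<^sub>1\<close> (\<open>invl_lift\<close>).

  (d) A lattice \<open>P\<close> that is invertible over \<open>pr \<Lambda>\<close> gives \<open>\<Lambda> P\<close>, which is invertible over the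
  order \<open>\<Lambda> \<cdot> pr \<Lambda>\<close>, and (c) lifts it to \<open>\<Lambda>\<close>. An invertible \<open>L\<close> with principal projection is
  principal, since an element of projection \<open>1\<close> is a unit
  (\<open>principal_if_prl_principal\<close>); this makes the map on classes injective.

  (e) This is the theorem of Dade, Taussky and Zassenhaus. Let \<open>f\<close> be a polynomial whose
  coefficients generate \<open>L\<close> and whose leading coefficient is a positive integer. It divides a
  nonzero integer polynomial \<open>f g\<close>. The content formula of Dedekind and Mertens, in the form
  that uses the rank of the content of \<open>g\<close> instead of its degree
  (\<open>dedekind_mertens_rank\<close>), gives \<open>L\<^sup>n C = L\<^sup>n\<^sup>-\<^sup>1\<close>, where \<open>n\<close> is the dimension and \<open>C\<close> is a
  rational multiple of the content of \<open>g\<close>. So \<open>L C\<close> fixes \<open>L\<^sup>n\<^sup>-\<^sup>1\<close>, and \<open>L\<^sup>n\<^sup>-\<^sup>1\<close> is invertible.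
\<close>

section \<open>The semiring of additive subgroups\<close>

global_interpretation zmodule: module "\<lambda>(k::int) (x::'a::comm_ring_1). of_int k * x"
  rewrites "zmodule.span = int_span"
proof -
  show "module (\<lambda>(k::int) (x::'a::comm_ring_1). of_int k * x)"
    by unfold_locales (auto simp: algebra_simps)
  show "module.span (\<lambda>(k::int) (x::'a::comm_ring_1). of_int k * x) = int_span"
    by (simp add: int_span_def fun_eq_iff)
qed

text \<open>
  A type of its own turns the products of lattices into the multiplication of a commutative
  semiring, so that associativity, distributivity and powers are available to the simplifier
  without side conditions.
\<close>

typedef (overloaded) 'a::comm_ring_1 zmod = "{M :: 'a set. zmodule.subspace M}"
  morphisms elts Abs_zmod
  using zmodule.subspace_UNIV by blast

definition gen :: "'a::comm_ring_1 set \<Rightarrow> 'a zmod" where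
  "gen X = Abs_zmod (int_span X)"

lemma subspace_elts: "zmodule.subspace (elts M)"
  using elts[of M] by simp

lemma elts_gen: "elts (gen X) = int_span X"
  unfolding gen_def by (simp add: Abs_zmod_inverse zmodule.subspace_span)

lemma gen_elts [simp]: "gen (elts M) = M"
  by (metis elts_gen elts_inject subspace_elts zmodule.span_eq_iff)

lemma elts_zero [simp]: "0 \<in> elts M"
  and elts_add: "x \<in> elts M \<Longrightarrow> y \<in> elts M \<Longrightarrow> x + y \<in> elts M"
  and elts_of_int_mult: "x \<in> elts M \<Longrightarrow> of_int k * x \<in> elts M"
  and elts_diff: "x \<in> elts M \<Longrightarrow> y \<in> elts M \<Longrightarrow> x - y \<in> elts M"
  and elts_uminus: "x \<in> elts M \<Longrightarrow> - x \<in> elts M"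
  by (simp_all add: zmodule.subspace_0 zmodule.subspace_add zmodule.subspace_scale
      zmodule.subspace_diff zmodule.subspace_neg subspace_elts)

lemma elts_of_nat_mult: "x \<in> elts M \<Longrightarrow> of_nat k * x \<in> elts M"
  using elts_of_int_mult[of x M "int k"] by simp

lemma elts_sum: "(\<And>i. i \<in> I \<Longrightarrow> f i \<in> elts M) \<Longrightarrow> sum f I \<in> elts M"
  by (induction I rule: infinite_finite_induct) (auto intro: elts_add)

lemma ex_elts: "zmodule.subspace S \<Longrightarrow> \<exists>M. elts M = S"
  by (metis Abs_zmod_inverse mem_Collect_eq)

lemma gen_base: "x \<in> X \<Longrightarrow> x \<in> elts (gen X)"
  by (simp add: elts_gen zmodule.span_base)

instantiation zmod :: (comm_ring_1) order
begin
definition less_eq_zmod :: "'a zmod \<Rightarrow> 'a zmod \<Rightarrow> bool" where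
  "less_eq_zmod M K \<longleftrightarrow> elts M \<subseteq> elts K"
definition less_zmod :: "'a zmod \<Rightarrow> 'a zmod \<Rightarrow> bool" where
  "less_zmod M K \<longleftrightarrow> elts M \<subset> elts K"
instance
  by standard (auto simp: less_eq_zmod_def less_zmod_def elts_inject)
end

lemma gen_le_iff: "gen X \<le> M \<longleftrightarrow> X \<subseteq> elts M"
  unfolding less_eq_zmod_def elts_gen
  by (meson subset_trans subspace_elts zmodule.span_minimal zmodule.span_superset)

lemma zmod_leI: "(\<And>x. x \<in> elts M \<Longrightarrow> x \<in> elts K) \<Longrightarrow> M \<le> K"
  by (auto simp: less_eq_zmod_def)

lemma zmod_leD: "M \<le> K \<Longrightarrow> x \<in> elts M \<Longrightarrow> x \<in> elts K"
  by (auto simp: less_eq_zmod_def)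

lemma gen_mono: "X \<subseteq> Y \<Longrightarrow> gen X \<le> gen Y"
  using gen_le_iff[of X "gen Y"] gen_base by blast

instantiation zmod :: (comm_ring_1) comm_semiring_1
begin
definition zero_zmod :: "'a zmod" where "zero_zmod = gen {}"
definition one_zmod :: "'a zmod" where "one_zmod = gen {1}"
definition plus_zmod :: "'a zmod \<Rightarrow> 'a zmod \<Rightarrow> 'a zmod" where
  "plus_zmod M K = gen (elts M \<union> elts K)"
definition times_zmod :: "'a zmod \<Rightarrow> 'a zmod \<Rightarrow> 'a zmod" where
  "times_zmod M K = gen {x * y | x y. x \<in> elts M \<and> y \<in> elts K}"

lemma zmod_le_addI1: "M \<le> M + (K :: 'a zmod)"
  and zmod_le_addI2: "K \<le> M + (K :: 'a zmod)"
  unfolding plus_zmod_def using gen_mono[of _ "elts M \<union> elts K"] gen_elts by fastforce+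

lemma zmod_add_le_iff: "M + K \<le> L \<longleftrightarrow> M \<le> L \<and> K \<le> (L :: 'a zmod)"
  unfolding plus_zmod_def gen_le_iff by (simp add: less_eq_zmod_def)

lemma gen_plus: "gen X + gen Y = gen (X \<union> Y)"
proof (rule antisym)
  show "gen X + gen Y \<le> gen (X \<union> Y)"
    by (simp add: zmod_add_le_iff gen_mono)
  show "gen (X \<union> Y) \<le> gen X + gen Y"
    using zmod_le_addI1 zmod_le_addI2 gen_le_iff by (metis Un_subset_iff)
qed

lemma zmod_mult_mem: "x \<in> elts M \<Longrightarrow> y \<in> elts K \<Longrightarrow> x * y \<in> elts (M * (K :: 'a zmod))"
  unfolding times_zmod_def by (rule gen_base) blast

lemma zmod_mult_le_iff: "M * K \<le> L \<longleftrightarrow> (\<forall>x\<in>elts M. \<forall>y\<in>elts K. x * y \<in> elts (L :: 'a zmod))"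
  unfolding times_zmod_def gen_le_iff by blast

lemma gen_mult: "gen X * gen Y = gen {x * y | x y. x \<in> X \<and> y \<in> (Y::'a set)}"
proof (rule antisym)
  let ?P = "gen {x * y | x y. x \<in> X \<and> y \<in> Y}"
  have 1: "x * b \<in> elts ?P" if x: "x \<in> X" and b: "b \<in> int_span Y" for x b
    using b
  proof (induction rule: zmodule.span_induct_alt)
    case (step c z y)
    have "of_int c * (x * z) \<in> elts ?P"
      using x step by (intro elts_of_int_mult gen_base) blast
    then show ?case using step by (simp add: distrib_left elts_add mult.left_commute)
  qed simp
  have "a * b \<in> elts ?P" if a: "a \<in> int_span X" and b: "b \<in> int_span Y" for a b
    using a
  proof (induction rule: zmodule.span_induct_alt)
    case (step c z y)
    have "of_int c * (z * b) \<in> elts ?P"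
      using 1[OF \<open>z \<in> X\<close> b] by (rule elts_of_int_mult)
    then show ?case using step by (simp add: distrib_right elts_add mult.assoc)
  qed simp
  then show "gen X * gen Y \<le> ?P"
    unfolding zmod_mult_le_iff elts_gen by blast
  show "?P \<le> gen X * gen Y"
    unfolding gen_le_iff using zmod_mult_mem gen_base by blast
qed

instance
proof
  fix M K L :: "'a zmod"
  show "M + K + L = M + (K + L)"
    using gen_plus[of "elts M \<union> elts K" "elts L"] gen_plus[of "elts M" "elts K \<union> elts L"]
    by (simp add: plus_zmod_def[of M K] plus_zmod_def[of K L] Un_assoc)
  show "M + K = K + M"
    by (simp add: plus_zmod_def Un_commute)
  show "0 + M = M"
    using gen_plus[of "{}" "elts M"] by (simp add: zero_zmod_def)
  have 0: "gen {x * y |x y. x \<in> {x * y |x y. x \<in> elts M \<and> y \<in> elts K} \<and> y \<in> elts L} =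
        gen {x * y |x y. x \<in> elts M \<and> y \<in> {x * y |x y. x \<in> elts K \<and> y \<in> elts L}}"
    (is "gen ?X = gen ?Y")
  proof (rule arg_cong[of _ _ gen], rule antisym)
    show "?X \<subseteq> ?Y"
    proof clarify
      fix m k l assume "m \<in> elts M" "k \<in> elts K" "l \<in> elts L"
      moreover have "m * k * l = m * (k * l)" by (rule mult.assoc)
      ultimately show "\<exists>x y. m * k * l = x * y \<and> x \<in> elts M \<and>
          y \<in> {x * y |x y. x \<in> elts K \<and> y \<in> elts L}" by blast
    qed
    show "?Y \<subseteq> ?X"
    proof clarify
      fix m k l assume "m \<in> elts M" "k \<in> elts K" "l \<in> elts L"
      moreover have "m * (k * l) = m * k * l" by (rule mult.assoc[symmetric])
      ultimately show "\<exists>x y. m * (k * l) = x * y \<and>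
          x \<in> {x * y |x y. x \<in> elts M \<and> y \<in> elts K} \<and> y \<in> elts L" by blast
    qed
  qed
  moreover have "M * K * L = gen ?X"
    using gen_mult[of "{x * y |x y. x \<in> elts M \<and> y \<in> elts K}" "elts L"]
    unfolding gen_elts times_zmod_def[of M K] .
  moreover have "M * (K * L) = gen ?Y"
    using gen_mult[of "elts M" "{x * y |x y. x \<in> elts K \<and> y \<in> elts L}"]
    unfolding gen_elts times_zmod_def[of K L] .
  ultimately show "M * K * L = M * (K * L)" by (simp only:)
  show "M * K = K * M"
    unfolding times_zmod_def by (rule arg_cong[of _ _ gen]) (metis mult.commute)
  have "{x * y |x y. x \<in> {1::'a} \<and> y \<in> elts M} = elts M" by auto
  then show "1 * M = M"
    using gen_mult[of "{1}" "elts M"] by (simp add: one_zmod_def)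
  have "{x * y |x y. x \<in> elts M \<union> elts K \<and> y \<in> elts L} =
        {x * y |x y. x \<in> elts M \<and> y \<in> elts L} \<union> {x * y |x y. x \<in> elts K \<and> y \<in> elts L}" by blast
  then have "gen (elts M \<union> elts K) * gen (elts L) =
      gen {x * y |x y. x \<in> elts M \<and> y \<in> elts L} + gen {x * y |x y. x \<in> elts K \<and> y \<in> elts L}"
    by (simp only: gen_mult gen_plus)
  then show "(M + K) * L = M * L + K * L"
    by (simp add: times_zmod_def[of _ L] plus_zmod_def[of M])
  show "0 * M = 0" "M * 0 = 0"
    using gen_mult[of "{}" "elts M"] gen_mult[of "elts M" "{}"] by (simp_all add: zero_zmod_def)
  have "(1::'a) \<in> elts 1" "(1::'a) \<notin> elts 0"
    using gen_base[of "1::'a" "{1}"] by (auto simp: zero_zmod_def one_zmod_def elts_gen)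
  then show "(0::'a zmod) \<noteq> 1" by auto
qed
end

lemma elts_0 [simp]: "elts (0 :: 'a::comm_ring_1 zmod) = {0}"
  by (simp add: zero_zmod_def elts_gen)

lemma zmod_add_idem [simp]: "M + M = (M :: 'a::comm_ring_1 zmod)"
  by (simp add: plus_zmod_def)

instance zmod :: (comm_ring_1) ordered_comm_semiring
proof
  fix M K L :: "'a zmod"
  assume "M \<le> K"
  then show "L + M \<le> L + K"
    by (meson order_trans zmod_add_le_iff zmod_le_addI1 zmod_le_addI2)
  show "L * M \<le> L * K"
    by (simp add: zmod_mult_le_iff zmod_mult_mem zmod_leD[OF \<open>M \<le> K\<close>])
qed

lemma zmod_zero_le [simp]: "0 \<le> (M :: 'a::comm_ring_1 zmod)"
  by (simp add: less_eq_zmod_def)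

lemma zmod_mult_mono: "M \<le> K \<Longrightarrow> P \<le> Q \<Longrightarrow> M * P \<le> K * (Q :: 'a::comm_ring_1 zmod)"
  by (rule mult_mono) auto

lemma zmod_le_add_trans1: "M \<le> K \<Longrightarrow> M \<le> K + (L :: 'a::comm_ring_1 zmod)"
  and zmod_le_add_trans2: "M \<le> L \<Longrightarrow> M \<le> K + (L :: 'a::comm_ring_1 zmod)"
  by (meson order_trans zmod_le_addI1 zmod_le_addI2)+

lemma zmod_power_mono: "M \<le> K \<Longrightarrow> M ^ n \<le> (K :: 'a::comm_ring_1 zmod) ^ n"
  by (induction n) (auto intro: zmod_mult_mono)

lemma elts_plus_iff: "x \<in> elts (M + K) \<longleftrightarrow> (\<exists>a\<in>elts M. \<exists>b\<in>elts K. x = a + b)"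
  using zmodule.span_Un[of "elts M" "elts K"]
  by (auto simp: plus_zmod_def elts_gen[symmetric])

lemma lat_mult_elts: "lat_mult (elts M) (elts K) = elts (M * K)"
proof
  show "lat_mult (elts M) (elts K) \<subseteq> elts (M * K)"
    unfolding lat_mult_def by (auto intro!: elts_sum zmod_mult_mem)
  have "x \<in> lat_mult (elts M) (elts K)"
    if "x \<in> int_span {x * y |x y. x \<in> elts M \<and> y \<in> elts K}" for x
    using that
  proof (induction rule: zmodule.span_induct_alt)
    case base
    show ?case unfolding lat_mult_def by (rule CollectI) (intro exI[of _ "0::nat"], simp)
  next
    case (step c z y)
    then obtain u v where z: "z = u * v" "u \<in> elts M" "v \<in> elts K" by blast
    from step obtain n a b where y: "y = (\<Sum>i<n. a i * b i)" "\<forall>i<(n::nat). a i \<in> elts M \<and> b i \<in> elts K"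
      unfolding lat_mult_def by blast
    define a' where "a' = a(n := of_int c * u)"
    define b' where "b' = b(n := v)"
    have "(\<Sum>i<n. a' i * b' i) = (\<Sum>i<n. a i * b i)"
      by (rule sum.cong) (auto simp: a'_def b'_def)
    then have "of_int c * z + y = (\<Sum>i<Suc n. a' i * b' i)"
      using z y by (simp add: a'_def b'_def algebra_simps)
    moreover have "\<forall>i<Suc n. a' i \<in> elts M \<and> b' i \<in> elts K"
      using z y by (auto simp: a'_def b'_def less_Suc_eq intro: elts_of_int_mult)
    ultimately show ?case unfolding lat_mult_def mem_Collect_eq by blast
  qed
  then show "elts (M * K) \<subseteq> lat_mult (elts M) (elts K)"
    unfolding times_zmod_def elts_gen by blast
qed

text \<open>
  Scaling a subgroup by an element is multiplication by a cyclic subgroup. This includes scaling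
  by integers: the sum of the semiring is idempotent, so \<open>of_nat N * M\<close> is just \<open>M\<close> for
  \<open>N > 0\<close>, and the subgroup of the multiples by \<open>N\<close> is \<open>cyc (of_nat N) * M\<close>.
\<close>

abbreviation cyc :: "'a::comm_ring_1 \<Rightarrow> 'a zmod" where
  "cyc x \<equiv> gen {x}"

lemma cyc_1 [simp]: "cyc 1 = 1"
  by (simp add: one_zmod_def)

lemma cyc_mult: "cyc x * cyc y = cyc (x * y)"
  by (simp add: gen_mult)

lemma elts_cyc_mult: "elts (cyc x * M) = (*) x ` elts M"
proof -
  have eq: "{u * v |u v. u \<in> {x} \<and> v \<in> elts M} = (*) x ` elts M" by auto
  have "cyc x * M = gen ((*) x ` elts M)"
    using gen_mult[of "{x}" "elts M"] unfolding eq by simp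
  moreover have "zmodule.subspace ((*) x ` elts M)"
    unfolding zmodule.subspace_def
  proof (safe)
    show "0 \<in> (*) x ` elts M" by (metis elts_zero image_eqI mult_zero_right)
    show "x * a + x * b \<in> (*) x ` elts M" if "a \<in> elts M" "b \<in> elts M" for a b
      using that by (metis distrib_left elts_add image_eqI)
    show "of_int c * (x * a) \<in> (*) x ` elts M" if "a \<in> elts M" for a c
      using that by (metis elts_of_int_mult image_eqI mult.left_commute)
  qed
  ultimately show ?thesis
    using zmodule.span_eq_iff by (simp add: elts_gen)
qed

lemma cyc_le_iff: "cyc x \<le> M \<longleftrightarrow> x \<in> elts M"
  by (simp add: gen_le_iff)

lemma cyc_mult_le_iff: "cyc x * M \<le> K \<longleftrightarrow> (\<forall>m\<in>elts M. x * m \<in> elts K)"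
  unfolding less_eq_zmod_def elts_cyc_mult by auto

lemma cyc_cancel: "x * y = 1 \<Longrightarrow> cyc x * M = K \<longleftrightarrow> M = cyc y * K"
  by (auto simp: mult.assoc[symmetric] cyc_mult mult.commute[of y x])

lemma cyc_of_nat_le: "cyc (of_nat N) * M \<le> M"
  by (simp add: cyc_mult_le_iff elts_of_nat_mult)

lemma one_le_iff: "1 \<le> M \<longleftrightarrow> 1 \<in> elts M"
  using cyc_le_iff[of 1 M] by simp

definition fg :: "'a::comm_ring_1 zmod \<Rightarrow> bool" where
  "fg M \<longleftrightarrow> (\<exists>X. finite X \<and> M = gen X)"

lemma fg_gen: "finite X \<Longrightarrow> fg (gen X)"
  by (auto simp: fg_def)

lemma fg_plus: "fg M \<Longrightarrow> fg K \<Longrightarrow> fg (M + K)"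
  unfolding fg_def by (metis finite_UnI gen_plus)

lemma fg_times: "fg M \<Longrightarrow> fg K \<Longrightarrow> fg (M * K)"
proof -
  assume "fg M" "fg K"
  then obtain X Y where XY: "finite X" "M = gen X" "finite Y" "K = gen Y"
    unfolding fg_def by blast
  have "finite {x * y | x y. x \<in> X \<and> y \<in> Y}"
    using XY by (intro finite_image_set2) auto
  then show ?thesis
    unfolding XY(2,4) gen_mult by (rule fg_gen)
qed

lemma fg_one: "fg 1"
  using fg_gen[of "{1}"] by simp

lemma fg_power: "fg M \<Longrightarrow> fg (M ^ n)"
  by (induction n) (auto intro: fg_times fg_one)

section \<open>Groups inside a commutative semigroup\<close>

text \<open>
  If \<open>a c = a\<close>, \<open>a d = a\<close> and \<open>a b = d\<close>, then \<open>d = a b = (a c) b = d c\<close>; by symmetry also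
  \<open>c = c d\<close>.
\<close>

lemma sg_invertible_wrt_unique:
  assumes S: "comm_semigrp S" and a: "sg_invertible_wrt S a c" "sg_invertible_wrt S a d"
  shows "c = d"
proof -
  have absorb: "e' = sg_mult S e' e"
    if inv: "sg_invertible_wrt S a e" "sg_invertible_wrt S a e'" for e e'
  proof -
    obtain b where b: "b \<in> sg_carrier S" "sg_mult S a b = e'"
      using inv unfolding sg_invertible_wrt_def by blast
    have car: "a \<in> sg_carrier S" "e \<in> sg_carrier S" "sg_mult S a e = a"
      using inv unfolding sg_invertible_wrt_def sg_idempotent_def by auto
    then have "sg_mult S e' e = sg_mult S (sg_mult S a e) b"
      using b S unfolding comm_semigrp_def by metis
    then show ?thesis using car b by simp
  qed
  show ?thesis
    using absorb[OF a] absorb[OF a(2) a(1)] S a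
    unfolding comm_semigrp_def sg_invertible_wrt_def sg_idempotent_def by metis
qed

lemma carrier_sg_group:
  assumes "comm_semigrp S"
  shows "carrier (sg_group S c) = {a. sg_invertible_wrt S a c}"
proof -
  have "sg_unit S a = d" if "sg_invertible_wrt S a d" for a d
    unfolding sg_unit_def using that sg_invertible_wrt_unique[OF assms] by blast
  then show ?thesis
    unfolding sg_group_def sg_invertible_def by auto
qed

lemma mem_sg_group_iff:
  assumes "comm_semigrp S" "sg_idempotent S c"
  shows "a \<in> carrier (sg_group S c) \<longleftrightarrow>
    a \<in> sg_carrier S \<and> sg_mult S a c = a \<and> (\<exists>b\<in>sg_carrier S. sg_mult S a b = c)"
  using assms by (auto simp: carrier_sg_group sg_invertible_wrt_def)

lemma sg_group_simps [simp]:
  "monoid.mult (sg_group S c) = sg_mult S" "monoid.one (sg_group S c) = c"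
  by (simp_all add: sg_group_def)

lemma group_sg_group:
  assumes S: "comm_semigrp S" and c: "sg_idempotent S c"
  shows "group (sg_group S c)"
proof -
  have closed: "sg_mult S a b \<in> sg_carrier S"
    if "a \<in> sg_carrier S" "b \<in> sg_carrier S" for a b
    using S that unfolding comm_semigrp_def by blast
  have assoc: "sg_mult S (sg_mult S a b) d = sg_mult S a (sg_mult S b d)"
    if "a \<in> sg_carrier S" "b \<in> sg_carrier S" "d \<in> sg_carrier S" for a b d
    using S that unfolding comm_semigrp_def by blast
  have comm: "sg_mult S a b = sg_mult S b a"
    if "a \<in> sg_carrier S" "b \<in> sg_carrier S" for a b
    using S that unfolding comm_semigrp_def by blast
  have cc: "c \<in> sg_carrier S" "sg_mult S c c = c"
    using c unfolding sg_idempotent_def by auto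
  show ?thesis
  proof (rule groupI; simp)
    fix a b assume a: "a \<in> carrier (sg_group S c)" and b: "b \<in> carrier (sg_group S c)"
    obtain a' b' where inv: "a' \<in> sg_carrier S" "sg_mult S a a' = c"
      "b' \<in> sg_carrier S" "sg_mult S b b' = c"
      using a b unfolding mem_sg_group_iff[OF S c] by blast
    have ab: "a \<in> sg_carrier S" "b \<in> sg_carrier S" "sg_mult S b c = b"
      using a b unfolding mem_sg_group_iff[OF S c] by auto
    have "sg_mult S (sg_mult S a b) (sg_mult S b' a') = sg_mult S a (sg_mult S (sg_mult S b b') a')"
      using inv(1,3) ab(1,2) assoc[of b b' a'] by (simp add: assoc closed)
    also have "\<dots> = sg_mult S (sg_mult S a a') c"
      using inv ab cc by (metis assoc comm)
    finally have "sg_mult S (sg_mult S a b) (sg_mult S b' a') = c"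
      using inv cc by simp
    then show "sg_mult S a b \<in> carrier (sg_group S c)"
      unfolding mem_sg_group_iff[OF S c] using inv ab cc by (metis assoc closed)
  next
    show "c \<in> carrier (sg_group S c)"
      unfolding mem_sg_group_iff[OF S c] using cc by blast
  next
    fix a b d
    assume "a \<in> carrier (sg_group S c)" "b \<in> carrier (sg_group S c)" "d \<in> carrier (sg_group S c)"
    then show "sg_mult S (sg_mult S a b) d = sg_mult S a (sg_mult S b d)"
      unfolding mem_sg_group_iff[OF S c] by (simp add: assoc)
  next
    fix a assume a: "a \<in> carrier (sg_group S c)"
    then show "sg_mult S c a = a"
      unfolding mem_sg_group_iff[OF S c] using cc comm by metis
    obtain b where b: "b \<in> sg_carrier S" "sg_mult S a b = c"
      using a unfolding mem_sg_group_iff[OF S c] by blast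
    have a': "a \<in> sg_carrier S" "sg_mult S a c = a"
      using a unfolding mem_sg_group_iff[OF S c] by auto
    \<comment> \<open>An inverse \<open>b\<close> of \<open>a\<close> need not absorb \<open>c\<close>, but \<open>b c\<close> does.\<close>
    have "sg_mult S (sg_mult S b c) a = c"
      using a' b cc by (metis assoc comm)
    moreover have "sg_mult S b c \<in> carrier (sg_group S c)"
      unfolding mem_sg_group_iff[OF S c] using a' b cc calculation by (metis assoc closed comm)
    ultimately show "\<exists>y\<in>carrier (sg_group S c). sg_mult S y a = c" by blast
  qed
qed

lemma group_epi_sg_groupI:
  assumes "comm_semigrp S" "sg_idempotent S c" "comm_semigrp T" "sg_idempotent T d"
    and "\<And>a b. a \<in> carrier (sg_group S c) \<Longrightarrow> b \<in> carrier (sg_group S c) \<Longrightarrow>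
      f (sg_mult S a b) = sg_mult T (f a) (f b)"
    and "f ` carrier (sg_group S c) = carrier (sg_group T d)"
  shows "group_epi (sg_group S c) (sg_group T d) f"
proof -
  have "f \<in> hom (sg_group S c) (sg_group T d)"
    using assms(5,6) by (auto simp: hom_def)
  then show ?thesis
    using assms(6) group_sg_group[OF assms(1,2)] group_sg_group[OF assms(3,4)]
    by (simp add: group_epi_def group_hom_def group_hom_axioms_def)
qed

section \<open>Full lattices in a subalgebra\<close>

lemma cyc_mult_cyc_mult: "(cyc a * M) * (cyc b * K) = cyc (a * b) * (M * K)"
proof -
  have "(cyc a * M) * (cyc b * K) = (cyc a * cyc b) * (M * K)"
    by (simp only: mult.assoc mult.left_commute)
  then show ?thesis by (simp only: cyc_mult)
qed

text \<open>
  The rational span is replaced by a condition on denominators, so that only the ring structure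
  is involved; for a subspace \<open>B\<close> these are the full lattices (\<open>full_lattices_iff\<close>).
\<close>

definition full :: "'a::comm_ring_1 set \<Rightarrow> 'a zmod \<Rightarrow> bool" where
  "full B M \<longleftrightarrow> fg M \<and> elts M \<subseteq> B \<and> (\<forall>b\<in>B. \<exists>N>0. of_nat N * b \<in> elts M)"

context fin_dim_rat_algebra
begin

lemma scale_eq_mult: "scale q x = scale q 1 * x"
  by (simp add: scale_mult_left)

lemma scale_mult_right: "x * scale q y = scale q (x * y)"
  by (metis mult.commute scale_mult_left)

lemma scale_of_nat: "scale (of_nat n) x = of_nat n * x"
  by (induction n) (simp_all add: scale_left_distrib distrib_right)

lemma scale_of_int: "scale (of_int k) x = of_int k * x"
proof (cases k)
  case (nonneg n)
  then show ?thesis using scale_of_nat[of n x] by simp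
next
  case (neg n)
  then show ?thesis using scale_of_nat[of "Suc n" x] scale_minus_left[of "of_nat (Suc n)" x]
    by (simp del: of_nat_Suc)
qed

lemma of_nat_scale_inverse: "N > 0 \<Longrightarrow> of_nat N * scale (1 / of_nat N) x = x"
  by (metis divide_eq_0_iff mult.commute nonzero_mult_div_cancel_left of_nat_eq_0_iff not_gr_zero
      scale_of_nat scale_one scale_scale times_divide_eq_right)

lemma torsion_free: "of_nat N * x = 0 \<Longrightarrow> N > 0 \<Longrightarrow> (x::'a) = 0"
  using scale_of_nat[of N x] by simp

lemma torsion_free_cancel: "of_nat N * x = of_nat N * y \<Longrightarrow> N > 0 \<Longrightarrow> (x::'a) = y"
  using torsion_free[of N "x - y"] by (simp add: right_diff_distrib)

lemma finite_basis_of_subspace: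
  assumes "subspace V"
  obtains X where "finite X" "independent X" "X \<subseteq> V" "span X = V"
proof -
  obtain T where T: "finite T" "span T = UNIV" using finite_dimensional by blast
  obtain X where X: "X \<subseteq> V" "independent X" "V \<subseteq> span X"
    using maximal_independent_subset[of V] by blast
  have "finite X" using independent_span_bound[OF T(1) X(2)] T(2) by auto
  moreover have "span X = V" using X assms by (meson span_minimal subset_antisym)
  ultimately show thesis using that X by blast
qed

lemma subspace_imp_zmod:
  assumes "subspace V"
  shows "\<exists>Z. elts Z = V"
proof (rule ex_elts)
  show "zmodule.subspace V"
    unfolding zmodule.subspace_def
    using assms subspace_scale[OF assms] by (auto simp: subspace_0 subspace_add simp flip: scale_of_int)
qed

lemma int_span_subset_span: "int_span X \<subseteq> span X"
  using subspace_imp_zmod[OF subspace_span, of X] span_superset[of X]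
  by (metis elts_gen gen_le_iff less_eq_zmod_def)

lemma span_imp_int_span:
  assumes "b \<in> span X"
  shows "\<exists>N>0. of_nat N * b \<in> int_span X"
  using assms
proof (induction rule: span_induct_alt)
  case base
  then show ?case by (intro exI[of _ 1]) (auto simp: zmodule.span_zero)
next
  case (step c x y)
  then obtain N where N: "N > 0" "of_nat N * y \<in> elts (gen X)" by (auto simp: elts_gen)
  obtain p q where c: "c = of_int p / of_int q" "q > 0"
    by (metis quotient_of_denom_pos quotient_of_div surj_pair)
  define m where "m = nat q"
  have m: "m > 0" "c * of_nat m = of_int p"
    using c by (auto simp: m_def)
  have "of_nat m * scale c x = of_int p * x"
    by (metis m(2) mult.commute scale_of_int scale_of_nat scale_scale)
  then have "of_nat (m * N) * (scale c x + y) =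
      of_nat N * (of_int p * x) + of_nat m * (of_nat N * y)"
    by (simp add: algebra_simps)
  moreover have "\<dots> \<in> elts (gen X)"
    using elts_add[OF elts_of_nat_mult[OF elts_of_int_mult[OF gen_base]] elts_of_nat_mult] step N
    by blast
  ultimately show ?case using m N by (intro exI[of _ "m * N"]) (auto simp: elts_gen)
qed

lemma full_lattices_iff:
  assumes B: "subspace B"
  shows "L \<in> full_lattices scale B \<longleftrightarrow> (\<exists>M. L = elts M \<and> full B M)"
proof
  assume "L \<in> full_lattices scale B"
  then obtain X where X: "finite X" "L = int_span X" "L \<subseteq> B" "span L = B"
    unfolding full_lattices_def by blast
  define M where "M = gen X"
  have L: "L = elts M" using X by (simp add: M_def elts_gen)
  have "span X = B"
    using X(2,4) span_mono[OF zmodule.span_superset[of X]] span_minimal[OF int_span_subset_span subspace_span]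
    by (metis subset_antisym)
  then have "\<exists>N>0. of_nat N * b \<in> elts M" if "b \<in> B" for b
    using span_imp_int_span[of b X] that L X(2) by simp
  then have "full B M"
    using X(3) L fg_gen[OF X(1)] unfolding full_def by (simp add: M_def)
  then show "\<exists>M. L = elts M \<and> full B M" using L by blast
next
  assume "\<exists>M. L = elts M \<and> full B M"
  then obtain M where M: "L = elts M" "full B M" by blast
  have "b \<in> span L" if b: "b \<in> B" for b
  proof -
    obtain N where N: "N > 0" "of_nat N * b \<in> L" using M b unfolding full_def by blast
    then have "scale (1 / of_nat N) (of_nat N * b) \<in> span L"
      by (intro span_scale span_base)
    then show ?thesis using of_nat_scale_inverse[OF N(1)] by (simp add: scale_mult_right)
  qed
  moreover have "span L \<subseteq> B"
    using M B by (auto simp: full_def intro: span_minimal[THEN subsetD])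
  moreover obtain X where "finite X" "L = int_span X"
    using M unfolding full_def fg_def by (auto simp: elts_gen)
  ultimately show "L \<in> full_lattices scale B"
    using M unfolding full_lattices_def full_def by blast
qed

end

lemma common_denominator:
  assumes M: "full B M" and X: "finite X" "X \<subseteq> B"
  shows "\<exists>N>0. \<forall>x\<in>X. of_nat N * x \<in> elts M"
  using X
proof (induction rule: finite_induct)
  case empty
  then show ?case by auto
next
  case (insert x X)
  obtain N where N: "N > 0" "\<forall>x\<in>X. of_nat N * x \<in> elts M" using insert by auto
  obtain K where K: "K > 0" "of_nat K * x \<in> elts M"
    using M insert unfolding full_def by auto
  have "of_nat (K * N) * y \<in> elts M" if "y \<in> insert x X" for y
  proof -
    have "of_nat (K * N) * y = of_nat K * (of_nat N * y)"
      "of_nat (K * N) * y = of_nat N * (of_nat K * y)" by (simp_all add: algebra_simps)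
    then show ?thesis using N K that elts_of_nat_mult by (metis insert_iff)
  qed
  then show ?case using N K by (intro exI[of _ "K * N"]) auto
qed

lemma common_denominator_lattice:
  assumes "full B M" "fg K" "elts K \<subseteq> B"
  shows "\<exists>N>0. cyc (of_nat N) * K \<le> M"
proof -
  obtain X where X: "finite X" "K = gen X" using assms by (auto simp: fg_def)
  then have "X \<subseteq> B" using assms(3) gen_base by blast
  then obtain N where N: "N > 0" "\<forall>x\<in>X. of_nat N * x \<in> elts M"
    using common_denominator[OF assms(1) X(1)] by blast
  then have "cyc (of_nat N) * K \<le> M"
    unfolding X(2) gen_mult gen_le_iff by auto
  then show ?thesis using N by blast
qed

locale subalgebra = fin_dim_rat_algebra scale
  for scale :: "rat \<Rightarrow> 'a::comm_ring_1 \<Rightarrow> 'a" +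
  fixes B :: "'a set"
  assumes subspace_B: "subspace B" and one_B: "1 \<in> B"
    and mult_B: "x \<in> B \<Longrightarrow> y \<in> B \<Longrightarrow> x * y \<in> B"
begin

lemma full_exists: "\<exists>M. full B M"
proof -
  obtain X where X: "finite X" "X \<subseteq> B" "span X = B"
    using finite_basis_of_subspace[OF subspace_B] by metis
  have sub: "int_span X \<subseteq> B" using int_span_subset_span[of X] X(3) by simp
  have "int_span X \<in> full_lattices scale B"
    unfolding full_lattices_def
    using X sub span_mono[OF zmodule.span_superset[of X]] span_minimal[OF sub subspace_B] by auto
  then show ?thesis using full_lattices_iff[OF subspace_B] by blast
qed

lemma mult_le_B: "elts M \<subseteq> B \<Longrightarrow> elts K \<subseteq> B \<Longrightarrow> elts (M * K) \<subseteq> B"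
  using subspace_imp_zmod[OF subspace_B] mult_B
  by (metis less_eq_zmod_def subsetD zmod_mult_le_iff)

lemma add_le_B: "elts M \<subseteq> B \<Longrightarrow> elts K \<subseteq> B \<Longrightarrow> elts (M + K) \<subseteq> B"
  using subspace_imp_zmod[OF subspace_B] by (metis less_eq_zmod_def zmod_add_le_iff)

lemma full_times:
  assumes "full B M" "full B K" shows "full B (M * K)"
proof -
  have "\<exists>N>0. of_nat N * b \<in> elts (M * K)" if b: "b \<in> B" for b
  proof -
    obtain N where N: "N > 0" "of_nat N * b \<in> elts M" using assms b by (auto simp: full_def)
    obtain N' where N': "N' > 0" "of_nat N' * 1 \<in> elts K"
      using assms one_B by (auto simp: full_def)
    have "of_nat (N * N') * b = (of_nat N * b) * (of_nat N' * 1)" by simp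
    then show ?thesis using N N' zmod_mult_mem by (metis nat_0_less_mult_iff)
  qed
  then show ?thesis using assms mult_le_B fg_times unfolding full_def by blast
qed

lemma full_between: "full B M \<Longrightarrow> M \<le> K \<Longrightarrow> fg K \<Longrightarrow> elts K \<subseteq> B \<Longrightarrow> full B K"
  unfolding full_def by (meson zmod_leD)

lemma full_plus: "full B M \<Longrightarrow> fg K \<Longrightarrow> elts K \<subseteq> B \<Longrightarrow> full B (M + K)"
  by (rule full_between[of M]) (auto simp: zmod_le_addI1 full_def fg_plus dest: add_le_B)

lemma full_power: "full B M \<Longrightarrow> full B (M ^ Suc n)"
  by (induction n) (auto simp: full_times)

definition unit :: "'a \<Rightarrow> bool" where
  "unit a \<longleftrightarrow> a \<in> B \<and> (\<exists>b\<in>B. a * b = 1)"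

lemma Units_ring_on: "Units (ring_on B 1) = {a. unit a}"
  by (auto simp: Units_def ring_on_def unit_def mult.commute)

lemma unit_one: "unit 1"
  using one_B by (auto simp: unit_def)

lemma unit_mult: "unit a \<Longrightarrow> unit b \<Longrightarrow> unit (a * b)"
proof -
  assume "unit a" "unit b"
  then obtain a' b' where *: "a \<in> B" "b \<in> B" "a' \<in> B" "b' \<in> B" "a * a' = 1" "b * b' = 1"
    by (auto simp: unit_def)
  then have "(a * b) * (a' * b') = 1" by (metis mult.commute mult.left_commute mult_1)
  then show ?thesis using * mult_B unfolding unit_def by blast
qed

lemma unit_inverse:
  assumes "unit a" obtains b where "unit b" "a * b = 1"
  using assms unfolding unit_def by (metis mult.commute)

lemma unit_of_nat: "N > 0 \<Longrightarrow> unit (of_nat N)"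
  using of_nat_scale_inverse[of N 1] subspace_scale[OF subspace_B one_B]
    scale_of_nat[of N 1] unfolding unit_def by (metis mult.right_neutral)

lemma full_unit_mult:
  assumes "unit a" "full B M" shows "full B (cyc a * M)"
proof -
  obtain c where c: "a * c = 1" "c \<in> B" "a \<in> B" using assms by (auto simp: unit_def)
  have "\<exists>N>0. of_nat N * b \<in> elts (cyc a * M)" if b: "b \<in> B" for b
  proof -
    obtain N where N: "N > 0" "of_nat N * (c * b) \<in> elts M"
      using assms(2) mult_B[OF c(2) b] unfolding full_def by blast
    have "a * (of_nat N * (c * b)) = of_nat N * ((a * c) * b)" by (simp add: mult_ac)
    then have "of_nat N * b = a * (of_nat N * (c * b))" using c(1) by simp
    then have "of_nat N * b \<in> elts (cyc a * M)"
      using N(2) unfolding elts_cyc_mult by (rule image_eqI)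
    then show ?thesis using N(1) by (intro exI[of _ N] conjI)
  qed
  moreover have "elts (cyc a * M) \<subseteq> B"
    using assms c mult_B by (auto simp: elts_cyc_mult full_def)
  moreover have "fg (cyc a * M)"
    using assms(2) fg_times[OF fg_gen[of "{a}"]] by (simp add: full_def)
  ultimately show ?thesis by (simp add: full_def)
qed

lemma lattice_sg_simps:
  "L \<in> sg_carrier (lattice_sg scale B) \<longleftrightarrow> (\<exists>M. L = elts M \<and> full B M)"
  "sg_mult (lattice_sg scale B) (elts M) (elts K) = elts (M * K)"
  by (simp_all add: lattice_sg_def full_lattices_iff[OF subspace_B] lat_mult_elts)

lemma comm_semigrp_lattice_sg: "comm_semigrp (lattice_sg scale B)"
  unfolding comm_semigrp_def Ball_def lattice_sg_simps(1)
  by (auto simp only: lattice_sg_simps(2) mult.assoc elts_inject ex_simps)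
    (auto intro: full_times simp: mult.commute)

subsection \<open>Classes of lattices up to units\<close>

definition ecl :: "'a zmod \<Rightarrow> 'a set set" where
  "ecl M = eps_class scale B (elts M)"

lemma eps_rel_iff:
  "(elts M, elts K) \<in> eps_rel scale B \<longleftrightarrow>
     full B M \<and> full B K \<and> (\<exists>a. unit a \<and> K = cyc a * M)"
  by (auto simp: eps_rel_def full_lattices_iff[OF subspace_B] Units_ring_on elts_inject
      simp flip: elts_cyc_mult)

lemma equiv_eps_rel: "equiv (full_lattices scale B) (eps_rel scale B)"
proof (rule equivI)
  show "eps_rel scale B \<subseteq> full_lattices scale B \<times> full_lattices scale B"
    by (auto simp: eps_rel_def)
  show "refl_on (full_lattices scale B) (eps_rel scale B)"
    unfolding refl_on_def using unit_one
    by (auto simp: full_lattices_iff[OF subspace_B] eps_rel_iff intro!: exI[of _ 1])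
  show "sym (eps_rel scale B)"
  proof (rule symI)
    fix L K assume LK: "(L, K) \<in> eps_rel scale B"
    then obtain M N where *: "L = elts M" "K = elts N"
      by (auto simp: eps_rel_def full_lattices_iff[OF subspace_B])
    then obtain a where a: "unit a" "N = cyc a * M" "full B M" "full B N"
      using LK by (auto simp: eps_rel_iff)
    then obtain b where "unit b" "a * b = 1" using unit_inverse by blast
    then show "(K, L) \<in> eps_rel scale B"
      using a cyc_cancel[of a b M N] unfolding * eps_rel_iff by blast
  qed
  show "trans (eps_rel scale B)"
  proof (rule transI)
    fix L K J assume LK: "(L, K) \<in> eps_rel scale B" and KJ: "(K, J) \<in> eps_rel scale B"
    then obtain M N P where *: "L = elts M" "K = elts N" "J = elts P"
      by (auto simp: eps_rel_def full_lattices_iff[OF subspace_B])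
    show "(L, J) \<in> eps_rel scale B"
      using LK KJ unit_mult unfolding * eps_rel_iff by (metis cyc_mult mult.assoc)
  qed
qed

lemma ecl_eq_iff:
  assumes "full B M" "full B K"
  shows "ecl M = ecl K \<longleftrightarrow> (\<exists>a. unit a \<and> K = cyc a * M)"
proof -
  have "elts M \<in> full_lattices scale B" "elts K \<in> full_lattices scale B"
    using assms by (auto simp: full_lattices_iff[OF subspace_B])
  then show ?thesis
    unfolding ecl_def eps_class_def
    using eq_equiv_class_iff[OF equiv_eps_rel] eps_rel_iff assms by blast
qed

lemma ecl_unit_mult: "unit a \<Longrightarrow> full B M \<Longrightarrow> ecl (cyc a * M) = ecl M"
  by (rule sym) (auto simp: ecl_eq_iff full_unit_mult)

lemma eps_sg_carrier: "sg_carrier (eps_sg scale B) = {ecl M | M. full B M}"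
proof -
  have "full_lattices scale B = elts ` {M. full B M}"
    using full_lattices_iff[OF subspace_B] by blast
  then show ?thesis
    unfolding eps_sg_def quotient_def ecl_def eps_class_def by auto
qed

lemma elts_in_ecl: "full B M \<Longrightarrow> elts M \<in> ecl M"
  unfolding ecl_def eps_class_def using unit_one by (auto simp: eps_rel_iff intro: exI[of _ 1])

lemma in_ecl_iff:
  assumes "full B M"
  shows "L \<in> ecl M \<longleftrightarrow> (\<exists>a. unit a \<and> L = elts (cyc a * M))"
proof -
  have "L \<in> ecl M \<longleftrightarrow> (elts M, L) \<in> eps_rel scale B"
    by (simp add: ecl_def eps_class_def)
  also have "\<dots> \<longleftrightarrow> (\<exists>a. unit a \<and> L = elts (cyc a * M))"
  proof
    assume *: "(elts M, L) \<in> eps_rel scale B"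
    then obtain K where "L = elts K" by (auto simp: eps_rel_def full_lattices_iff[OF subspace_B])
    then show "\<exists>a. unit a \<and> L = elts (cyc a * M)" using * by (auto simp: eps_rel_iff)
  qed (auto simp: eps_rel_iff assms full_unit_mult)
  finally show ?thesis .
qed

lemma eps_mult_ecl:
  assumes "full B M" "full B K"
  shows "eps_mult scale B (ecl M) (ecl K) = ecl (M * K)"
proof -
  have "eps_class scale B (lat_mult L N) = ecl (M * K)" if LN: "L \<in> ecl M" "N \<in> ecl K" for L N
  proof -
    obtain a b where "unit a" "unit b" "L = elts (cyc a * M)" "N = elts (cyc b * K)"
      using LN by (auto simp: in_ecl_iff assms)
    then have "unit (a * b)" "lat_mult L N = elts (cyc (a * b) * (M * K))"
      by (simp_all add: unit_mult lat_mult_elts cyc_mult_cyc_mult)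
    then show ?thesis
      using ecl_unit_mult[of "a * b" "M * K"] full_times assms by (simp add: ecl_def)
  qed
  then show ?thesis
    unfolding eps_mult_def using elts_in_ecl assms by blast
qed

lemma eps_sg_mult:
  "full B M \<Longrightarrow> full B K \<Longrightarrow> sg_mult (eps_sg scale B) (ecl M) (ecl K) = ecl (M * K)"
  by (simp add: eps_sg_def eps_mult_ecl)

lemma comm_semigrp_eps_sg: "comm_semigrp (eps_sg scale B)"
  unfolding comm_semigrp_def eps_sg_carrier
  by (auto simp: eps_sg_mult full_times mult.assoc) (auto simp: mult.commute)

subsection \<open>Orders and their groups\<close>

definition is_order :: "'a zmod \<Rightarrow> bool" where
  "is_order \<Lambda> \<longleftrightarrow> full B \<Lambda> \<and> 1 \<in> elts \<Lambda> \<and> \<Lambda> * \<Lambda> \<le> \<Lambda>"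

lemma orders_iff: "L \<in> orders scale B \<longleftrightarrow> (\<exists>\<Lambda>. L = elts \<Lambda> \<and> is_order \<Lambda>)"
  unfolding orders_def is_order_def
  by (auto simp: full_lattices_iff[OF subspace_B] lat_mult_elts less_eq_zmod_def)

lemma le_order_mult: "is_order \<Lambda> \<Longrightarrow> M \<le> M * \<Lambda>"
  unfolding is_order_def using one_le_iff zmod_mult_mono[of M M 1 \<Lambda>] by auto

lemma order_idem: "is_order \<Lambda> \<Longrightarrow> \<Lambda> * \<Lambda> = \<Lambda>"
  using le_order_mult[of \<Lambda> \<Lambda>] unfolding is_order_def by auto

text \<open>
  The elements of the group \<open>G(\<Lambda>)\<close> of the semigroup of lattices (\<open>carrier_lattice_group\<close>);
  their classes are the elements of \<open>G([\<Lambda>])\<close> (\<open>carrier_eps_group\<close>).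
\<close>

definition invl :: "'a zmod \<Rightarrow> 'a zmod \<Rightarrow> bool" where
  "invl \<Lambda> L \<longleftrightarrow> full B L \<and> L * \<Lambda> = L \<and> (\<exists>K. full B K \<and> L * K = \<Lambda>)"

lemma idempotent_lattice: "is_order \<Lambda> \<Longrightarrow> sg_idempotent (lattice_sg scale B) (elts \<Lambda>)"
  unfolding sg_idempotent_def by (auto simp: lattice_sg_simps order_idem is_order_def)

lemma idempotent_eps: "is_order \<Lambda> \<Longrightarrow> sg_idempotent (eps_sg scale B) (ecl \<Lambda>)"
  unfolding sg_idempotent_def eps_sg_carrier
  by (auto simp: eps_sg_mult order_idem is_order_def[of \<Lambda>])

abbreviation lattice_group :: "'a zmod \<Rightarrow> 'a set monoid" where
  "lattice_group \<Lambda> \<equiv> sg_group (lattice_sg scale B) (elts \<Lambda>)"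

abbreviation class_group :: "'a zmod \<Rightarrow> 'a set set monoid" where
  "class_group \<Lambda> \<equiv> sg_group (eps_sg scale B) (ecl \<Lambda>)"

lemma carrier_lattice_group:
  assumes "is_order \<Lambda>"
  shows "carrier (lattice_group \<Lambda>) = elts ` {L. invl \<Lambda> L}"
proof -
  have "X \<in> carrier (lattice_group \<Lambda>) \<longleftrightarrow> X \<in> elts ` {L. invl \<Lambda> L}" for X
    unfolding mem_sg_group_iff[OF comm_semigrp_lattice_sg idempotent_lattice[OF assms]]
    unfolding invl_def image_iff by (auto simp: lattice_sg_simps elts_inject Bex_def)
  then show ?thesis by blast
qed

lemma invl_unit_mult:
  assumes a: "unit a" and L: "invl \<Lambda> L"
  shows "invl \<Lambda> (cyc a * L)"
proof -
  obtain b where b: "unit b" "a * b = 1" using a unit_inverse by blast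
  obtain K where K: "full B K" "L * K = \<Lambda>" using L by (auto simp: invl_def)
  have "(cyc a * L) * (cyc b * K) = cyc (a * b) * (L * K)" by (rule cyc_mult_cyc_mult)
  then have "(cyc a * L) * (cyc b * K) = \<Lambda>" using b K by simp
  then show ?thesis
    using L a b K full_unit_mult unfolding invl_def by (metis mult.assoc)
qed

text \<open>
  A class in the group is represented by a lattice that is invertible over \<open>\<Lambda>\<close> itself. Indeed,
  \<open>L K\<close> and \<open>\<Lambda>\<close> differ by a unit that can be moved into \<open>K\<close>, and \<open>L = c L \<Lambda>\<close> for a unit \<open>c\<close>
  already implies \<open>L \<Lambda> = c L \<Lambda> \<Lambda> = L\<close>.
\<close>

lemma carrier_eps_group:
  assumes \<Lambda>: "is_order \<Lambda>"
  shows "carrier (class_group \<Lambda>) = ecl ` {L. invl \<Lambda> L}" (is "?G = _")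
proof -
  note mem = mem_sg_group_iff[OF comm_semigrp_eps_sg idempotent_eps[OF \<Lambda>]]
  have full: "full B \<Lambda>" using \<Lambda> by (simp add: is_order_def)
  have "X \<in> ecl ` {L. invl \<Lambda> L}" if "X \<in> ?G" for X
  proof -
    have "X \<in> {ecl M | M. full B M}" "\<exists>Y \<in> {ecl M | M. full B M}. sg_mult (eps_sg scale B) X Y = ecl \<Lambda>"
      using that unfolding mem eps_sg_carrier by blast+
    then obtain L K where L: "full B L" "X = ecl L" and K: "full B K"
      "sg_mult (eps_sg scale B) X (ecl K) = ecl \<Lambda>" by blast
    have "ecl (L * K) = ecl \<Lambda>" using K L eps_sg_mult by simp
    then obtain a where a: "unit a" "\<Lambda> = cyc a * (L * K)"
      using ecl_eq_iff full_times L K full by metis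
    have "ecl (L * \<Lambda>) = ecl L" using that L eps_sg_mult full unfolding mem by simp
    then obtain c where c: "unit c" "L = cyc c * (L * \<Lambda>)"
      using ecl_eq_iff full_times L full by metis
    have "L * \<Lambda> = L"
      using c(2) order_idem[OF \<Lambda>] by (metis mult.assoc)
    moreover have "L * (cyc a * K) = \<Lambda>" using a(2) by (simp add: mult_ac)
    ultimately have "invl \<Lambda> L" using L full_unit_mult[OF a(1) K(1)] unfolding invl_def by blast
    then show ?thesis using L by blast
  qed
  moreover have "ecl L \<in> ?G" if inv: "invl \<Lambda> L" for L
  proof -
    obtain K where K: "full B K" "L * K = \<Lambda>" and L: "full B L" "L * \<Lambda> = L"
      using inv unfolding invl_def by blast
    show ?thesis unfolding mem eps_sg_carrier
      using K L full by (auto simp: eps_sg_mult intro!: bexI[of _ "ecl K"])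
  qed
  ultimately show ?thesis by blast
qed

lemma invl_mult:
  assumes "invl \<Lambda> L" "invl \<Lambda> K" shows "invl \<Lambda> (L * K)"
proof -
  obtain L' K' where *: "full B L'" "L * L' = \<Lambda>" "full B K'" "K * K' = \<Lambda>"
    using assms by (auto simp: invl_def)
  have "L * K * (L' * K') = \<Lambda>"
    using * assms by (metis invl_def mult.assoc mult.left_commute mult.commute)
  then show ?thesis using assms * full_times unfolding invl_def by (metis mult.assoc)
qed

lemma invl_order: "is_order \<Lambda> \<Longrightarrow> invl \<Lambda> \<Lambda>"
  using order_idem unfolding invl_def is_order_def by blast

end

section \<open>Subgroups of finite index\<close>

text \<open>
  Division with remainder by \<open>N\<close>, applied to the coefficients with respect to a finite
  generating set.
\<close>

lemma finite_representatives:
  assumes "fg M" "N > 0"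
  shows "\<exists>R. finite R \<and> (\<forall>m\<in>elts M. \<exists>r\<in>R. m - r \<in> elts (cyc (of_nat N) * M))"
proof -
  obtain X where X: "finite X" "M = gen X" using assms(1) by (auto simp: fg_def)
  have "\<exists>R. finite R \<and> (\<forall>m\<in>elts (gen X). \<exists>r\<in>R. m - r \<in> elts (cyc (of_nat N) * gen X))"
    using X(1)
  proof (induction rule: finite_induct)
    case empty
    then show ?case by (intro exI[of _ "{0}"]) (simp flip: zero_zmod_def)
  next
    case (insert x X)
    then obtain R where R: "finite R"
      "\<And>m. m \<in> elts (gen X) \<Longrightarrow> \<exists>r\<in>R. m - r \<in> elts (cyc (of_nat N) * gen X)" by auto
    define R' where "R' = (\<lambda>(j, r). of_nat j * x + r) ` ({..<N} \<times> R)"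
    have eq: "gen (insert x X) = cyc x + gen X" by (simp add: gen_plus)
    have "\<exists>r\<in>R'. m - r \<in> elts (cyc (of_nat N) * gen (insert x X))"
      if m: "m \<in> elts (gen (insert x X))" for m
    proof -
      from m obtain a b where ab: "a \<in> elts (cyc x)" "b \<in> elts (gen X)" "m = a + b"
        unfolding eq elts_plus_iff by blast
      from ab(1) obtain k where k: "a = of_int k * x"
        by (auto simp: elts_gen zmodule.span_singleton)
      from R(2)[OF ab(2)] obtain r where r: "r \<in> R" "b - r \<in> elts (cyc (of_nat N) * gen X)" by blast
      define j where "j = nat (k mod int N)"
      have j: "j < N" "int j = k mod int N" using assms(2) by (auto simp: j_def nat_less_iff)
      have "k = int N * (k div int N) + int j" using j by simp
      then have "(of_int k :: 'a) = of_nat N * of_int (k div int N) + of_nat j"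
        by (metis of_int_add of_int_mult of_int_of_nat_eq)
      then have "m - (of_nat j * x + r) = of_nat N * (of_int (k div int N) * x) + (b - r)"
        using ab k by (simp add: algebra_simps)
      also have "\<dots> \<in> elts (cyc (of_nat N) * gen (insert x X))"
      proof (rule elts_add)
        show "of_nat N * (of_int (k div int N) * x) \<in> elts (cyc (of_nat N) * gen (insert x X))"
          by (intro zmod_mult_mem elts_of_int_mult gen_base) auto
        have "cyc (of_nat N) * gen X \<le> cyc (of_nat N) * gen (insert x X)"
          by (intro zmod_mult_mono gen_mono) auto
        then show "b - r \<in> elts (cyc (of_nat N) * gen (insert x X))"
          using r zmod_leD by blast
      qed
      finally show ?thesis using j r unfolding R'_def by force
    qed
    moreover have "finite R'" using R by (simp add: R'_def)
    ultimately show ?case by blast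
  qed
  then show ?thesis using X by simp
qed

text \<open>
  A subgroup between \<open>N M\<close> and \<open>M\<close> is determined by the representatives modulo \<open>N M\<close> that it
  contains.
\<close>

lemma finite_between:
  assumes "fg M" "N > 0"
  shows "finite {K. cyc (of_nat N) * M \<le> K \<and> K \<le> M}"
proof -
  obtain R where R: "finite R"
    "\<And>m. m \<in> elts M \<Longrightarrow> \<exists>r\<in>R. m - r \<in> elts (cyc (of_nat N) * M)"
    using finite_representatives[OF assms] by blast
  let ?S = "{K. cyc (of_nat N) * M \<le> K \<and> K \<le> M}"
  have le: "K \<le> L" if K: "K \<in> ?S" and L: "L \<in> ?S" and eq: "elts K \<inter> R = elts L \<inter> R" for K L
  proof (rule zmod_leI)
    fix x assume x: "x \<in> elts K"
    then obtain r where r: "r \<in> R" "x - r \<in> elts (cyc (of_nat N) * M)"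
      using K R(2) zmod_leD by blast
    then have "x - r \<in> elts K" "x - r \<in> elts L" using K L zmod_leD by blast+
    then have "r \<in> elts K" using x elts_diff[of x K "x - r"] by simp
    then have "r \<in> elts L" using eq r by blast
    then show "x \<in> elts L" using \<open>x - r \<in> elts L\<close> elts_add[of "x - r" L r] by simp
  qed
  have "inj_on (\<lambda>K. elts K \<inter> R) ?S"
    by (intro inj_onI antisym le) auto
  moreover have "finite ((\<lambda>K. elts K \<inter> R) ` ?S)"
    by (rule finite_subset[of _ "Pow R"]) (use R in auto)
  ultimately show ?thesis using finite_imageD by blast
qed

text \<open>
  This replaces localisation. The least \<open>t > 0\<close> with \<open>t X \<le> Y\<close> must be \<open>1\<close>: a prime divisor \<open>p\<close>
  of \<open>t = p s\<close> could be cancelled because \<open>s X \<le> s Y + t X \<le> Y\<close>.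
\<close>

lemma zmod_le_if_mod_primes:
  fixes X Y :: "'a::comm_ring_1 zmod" and t :: nat
  assumes "t > 0" "cyc (of_nat t) * X \<le> Y"
    and p: "\<And>p. prime p \<Longrightarrow> X \<le> Y + cyc (of_nat (p::nat)) * X"
  shows "X \<le> Y"
  using assms(1,2)
proof (induction t rule: less_induct)
  case (less t)
  show ?case
  proof (cases "t = 1")
    case True
    then show ?thesis using less by simp
  next
    case False
    then obtain q where q: "prime q" "q dvd t" using prime_factor_nat by blast
    then obtain s where s: "t = q * s" by blast
    have "cyc (of_nat s) * X \<le> cyc (of_nat s) * (Y + cyc (of_nat q) * X)"
      by (intro zmod_mult_mono p q) auto
    also have "\<dots> = cyc (of_nat s) * Y + cyc (of_nat s) * cyc (of_nat q) * X"
      by (simp only: distrib_left mult.assoc)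
    also have "cyc (of_nat s) * cyc (of_nat q) = (cyc (of_nat t) :: 'a zmod)"
      by (simp add: s cyc_mult mult.commute)
    also have "cyc (of_nat s) * Y + cyc (of_nat t) * X \<le> Y + Y"
      by (intro add_mono cyc_of_nat_le less)
    finally have "cyc (of_nat s) * X \<le> Y" by simp
    moreover have "s < t" "s > 0" using s q less(2) prime_gt_1_nat[OF q(1)] by auto
    ultimately show ?thesis using less.IH by blast
  qed
qed

section \<open>Contents of polynomials\<close>

text \<open>
  The content of a polynomial, taken over the integers: it is a subgroup of the coefficient ring
  and not an ideal.
\<close>

definition coeff_span :: "'a::comm_ring_1 poly \<Rightarrow> 'a zmod" where
  "coeff_span f = gen (range (coeff f))"

lemma coeff_span_le_iff: "coeff_span f \<le> M \<longleftrightarrow> (\<forall>i. coeff f i \<in> elts M)"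
  by (auto simp: coeff_span_def gen_le_iff)

lemma coeff_in_coeff_span: "coeff f i \<in> elts (coeff_span f)"
  using coeff_span_le_iff[of f "coeff_span f"] by simp

lemma finite_range_coeff: "finite (range (coeff f))"
proof -
  have "range (coeff f) \<subseteq> insert 0 (coeff f ` {..degree f})"
    by (auto simp: image_iff) (metis coeff_eq_0 atMost_iff not_le)
  then show ?thesis using finite_subset by blast
qed

lemma fg_coeff_span: "fg (coeff_span f)"
  unfolding coeff_span_def by (rule fg_gen[OF finite_range_coeff])

lemma coeff_span_mult_le: "coeff_span (f * g) \<le> coeff_span f * coeff_span g"
  unfolding coeff_span_le_iff coeff_mult
  by (intro allI elts_sum zmod_mult_mem coeff_in_coeff_span)

lemma coeff_span_add_le: "coeff_span (f + g) \<le> coeff_span f + coeff_span g"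
  unfolding coeff_span_le_iff by (auto simp: elts_plus_iff intro: coeff_in_coeff_span)

lemma coeff_span_diff_le: "coeff_span (f - g) \<le> coeff_span f + coeff_span g"
proof -
  have "coeff (f - g) i \<in> elts (coeff_span f + coeff_span g)" for i
    using coeff_in_coeff_span[of f i] elts_uminus[OF coeff_in_coeff_span[of g i]]
    unfolding elts_plus_iff coeff_diff by force
  then show ?thesis by (simp add: coeff_span_le_iff)
qed

lemma coeff_span_0 [simp]: "coeff_span 0 = 0"
  by (rule antisym) (auto simp: coeff_span_le_iff)

text \<open>
  Here \<open>g\<close> is a sum of \<open>k\<close> terms \<open>b h\<close> with a ring element \<open>b\<close> and a monic integer polynomial
  \<open>h\<close>, of strictly decreasing degrees, and \<open>C\<close> is generated by the elements \<open>b\<close>. A polynomial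
  with \<open>k\<close> monomials is the special case where each \<open>h\<close> is a power of the variable.
\<close>

inductive echelon :: "nat \<Rightarrow> 'a::comm_ring_1 poly \<Rightarrow> 'a zmod \<Rightarrow> bool" where
  zero: "echelon 0 0 0"
| step: "echelon k g C \<Longrightarrow> \<forall>i\<ge>m. coeff g i = 0 \<Longrightarrow> \<forall>i>m. coeff h i = 0 \<Longrightarrow> coeff h m = 1 \<Longrightarrow>
    \<forall>i. coeff h i \<in> \<int> \<Longrightarrow> echelon (Suc k) (smult b h + g) (cyc b + C)"

lemma Ints_mult_elts: "c \<in> \<int> \<Longrightarrow> x \<in> elts M \<Longrightarrow> c * x \<in> elts M"
  by (auto simp: Ints_def intro: elts_of_int_mult)

lemma coeff_span_smult_Ints_le: "\<forall>i. coeff h i \<in> \<int> \<Longrightarrow> coeff_span (smult b h) \<le> cyc b"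
  using Ints_mult_elts[of _ b "cyc b"] gen_base[of b "{b}"]
  by (simp add: coeff_span_le_iff mult.commute[of b])

lemma echelon_coeff_span: "echelon k g C \<Longrightarrow> coeff_span g \<le> C"
proof (induction rule: echelon.induct)
  case (step k g C m h b)
  have "coeff_span (smult b h + g) \<le> coeff_span (smult b h) + coeff_span g" by (rule coeff_span_add_le)
  also have "\<dots> \<le> cyc b + C" by (intro add_mono step coeff_span_smult_Ints_le)
  finally show ?case .
qed simp

lemma coeff_mult_top:
  assumes "\<forall>i>n. coeff f i = 0" "\<forall>i>m. coeff g i = 0"
  shows "coeff (f * g) (n + m) = coeff f n * (coeff g m :: 'a::comm_ring_1)"
proof -
  have "coeff f i * coeff g (n + m - i) = (if i = n then coeff f n * coeff g m else 0)" for i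
    using assms by (cases i n rule: linorder_cases) auto
  then show ?thesis by (simp add: coeff_mult)
qed

lemma zmod_power_split:
  fixes F F' \<phi> :: "'a::comm_ring_1 zmod"
  assumes "F \<le> F' + \<phi>" "F' \<le> F"
  shows "F ^ Suc k \<le> F' ^ Suc k + \<phi> * F ^ k"
proof (induction k)
  case 0
  then show ?case using assms by simp
next
  case (Suc k)
  have "F ^ Suc (Suc k) \<le> F * (F' ^ Suc k + \<phi> * F ^ k)"
    using zmod_mult_mono[OF order_refl Suc.IH, of F] by simp
  also have "\<dots> = F * F' ^ Suc k + \<phi> * F ^ Suc k"
    by (simp add: distrib_left mult_ac)
  also have "\<dots> \<le> (F' + \<phi>) * F' ^ Suc k + \<phi> * F ^ Suc k"
    by (intro add_mono zmod_mult_mono assms order_refl)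
  also have "\<dots> = F' ^ Suc (Suc k) + \<phi> * F' ^ Suc k + \<phi> * F ^ Suc k"
    by (simp add: distrib_right)
  also have "\<dots> \<le> F' ^ Suc (Suc k) + \<phi> * F ^ Suc k + \<phi> * F ^ Suc k"
    by (intro add_mono zmod_mult_mono zmod_power_mono assms order_refl)
  finally show ?case by (simp add: add.assoc)
qed

text \<open>
  The calculation behind the induction step of the content formula. Here \<open>F\<close> and \<open>F'\<close> are the
  contents of \<open>f\<close> with and without its leading term, whose coefficient generates \<open>\<phi>\<close>; likewise
  \<open>C\<close> and \<open>C'\<close> are generated by the ring elements in an echelon form of \<open>g\<close> with and without its
  leading one, which generates \<open>\<beta>\<close>; and \<open>H\<close> contains the content of \<open>f g\<close>. The premises \<open>g'\<close>
  and \<open>f'\<close> are the content formulas after shortening \<open>g\<close> or \<open>f\<close>.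
\<close>

lemma dedekind_mertens_step:
  fixes F F' \<phi> \<beta> C C' H :: "'a::comm_ring_1 zmod"
  assumes F: "F \<le> F' + \<phi>" "F' \<le> F" "\<phi> \<le> F" and C: "C = \<beta> + C'" and H: "\<phi> * \<beta> \<le> H"
    and g': "F ^ k * C' \<le> F ^ (k - 1) * (H + \<beta> * F)" and zero: "k = 0 \<Longrightarrow> C' = 0"
    and f': "F' ^ Suc k * C \<le> F' ^ k * (H + \<phi> * C)"
  shows "F ^ Suc k * C \<le> F ^ k * H"
proof -
  \<comment> \<open>For \<open>k = 0\<close> the truncated exponent \<open>k - 1\<close> would be wrong in \<open>F * X \<le> F ^ k * H\<close>.\<close>
  define X where "X = (if k = 0 then 0 else F ^ (k - 1) * H)"
  have X: "F * X \<le> F ^ k * H"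
    by (cases k) (auto simp: X_def mult.assoc)
  have C': "F ^ k * C' \<le> X + F ^ k * \<beta>"
  proof (cases k)
    case 0
    then show ?thesis using zero by simp
  next
    case (Suc j)
    have "F ^ k * C' \<le> F ^ j * H + F ^ j * (\<beta> * F)"
      using g' Suc by (simp add: distrib_left)
    also have "F ^ j * (\<beta> * F) = F ^ k * \<beta>" using Suc by (simp add: mult_ac)
    finally show ?thesis using Suc by (simp add: X_def)
  qed
  have \<phi>\<beta>: "\<phi> * (F ^ k * \<beta>) \<le> F ^ k * H"
    using zmod_mult_mono[OF order_refl H, of "F ^ k"] by (simp add: mult_ac)
  have "\<phi> * (F ^ k * C) = \<phi> * (F ^ k * \<beta>) + \<phi> * (F ^ k * C')"
    by (simp add: C distrib_left)
  also have "\<dots> \<le> F ^ k * H + \<phi> * (X + F ^ k * \<beta>)"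
    by (intro add_mono \<phi>\<beta> zmod_mult_mono order_refl C')
  also have "\<dots> = F ^ k * H + (\<phi> * X + \<phi> * (F ^ k * \<beta>))"
    by (simp add: distrib_left)
  also have "\<dots> \<le> F ^ k * H"
    using \<phi>\<beta> X zmod_mult_mono[OF F(3) order_refl, of X]
    by (auto simp: zmod_add_le_iff intro: order_trans)
  finally have \<phi>C: "\<phi> * (F ^ k * C) \<le> F ^ k * H" .
  have "F ^ Suc k * C \<le> (F' ^ Suc k + \<phi> * F ^ k) * C"
    by (intro zmod_mult_mono zmod_power_split F order_refl)
  also have "\<dots> = F' ^ Suc k * C + \<phi> * (F ^ k * C)"
    by (simp add: distrib_right mult.assoc)
  also have "\<dots> \<le> F' ^ k * (H + \<phi> * C) + F ^ k * H"
    by (intro add_mono f' \<phi>C)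
  also have "\<dots> \<le> F ^ k * (H + \<phi> * C) + F ^ k * H"
    by (intro add_mono zmod_mult_mono zmod_power_mono F order_refl)
  also have "\<dots> = F ^ k * H + \<phi> * (F ^ k * C) + F ^ k * H"
    by (simp add: distrib_left mult_ac)
  also have "\<dots> \<le> F ^ k * H" using \<phi>C by (simp add: zmod_add_le_iff)
  finally show ?thesis .
qed

lemma echelon_0: "echelon 0 g C \<Longrightarrow> g = 0 \<and> C = 0"
  by (auto elim: echelon.cases)

text \<open>
  Induction on \<open>k\<close> and on the degree of \<open>f\<close>. The product of the leading coefficients is a
  coefficient of \<open>f g\<close>. Removing the leading term of \<open>g\<close> or of \<open>f\<close> changes the coefficients of
  \<open>f g\<close> only by elements of \<open>b F\<close> or of \<open>c C\<close>, with the leading coefficients \<open>b\<close> of \<open>g\<close> and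
  \<open>c\<close> of \<open>f\<close>.
\<close>

lemma dedekind_mertens:
  assumes "echelon k g C" "coeff_span (f * g) \<le> H"
  shows "coeff_span f ^ k * C \<le> coeff_span f ^ (k - 1) * H"
  using assms
proof (induction arbitrary: f H rule: echelon.induct)
  case (step k g C m h b)
  let ?g = "smult b h + g" and ?C = "cyc b + C"
  have ech: "echelon (Suc k) ?g ?C" using step.hyps by (rule echelon.step)
  \<comment> \<open>The bound \<open>n\<close> need not be sharp: the coefficient \<open>c\<close> that is removed below may be zero.\<close>
  have "coeff_span f ^ Suc k * ?C \<le> coeff_span f ^ k * H"
    if "\<forall>i\<ge>n. coeff f i = 0" "coeff_span (f * ?g) \<le> H" for n f H
    using that
  proof (induction n arbitrary: f H)
    case 0
    then have "f = 0" by (simp add: poly_eq_iff)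
    then show ?case by simp
  next
    case (Suc n)
    define c where "c = coeff f n"
    define f' where "f' = f - monom c n"
    have f': "\<forall>i\<ge>n. coeff f' i = 0"
      using Suc.prems(1) by (auto simp: f'_def c_def)
    have monom: "coeff_span (monom c n) \<le> cyc c"
      by (auto simp: coeff_span_le_iff gen_base)
    have c: "cyc c \<le> coeff_span f"
      by (simp add: cyc_le_iff c_def coeff_in_coeff_span)
    have coeff_f': "coeff f' i = (if i = n then 0 else coeff f i)" for i
      by (simp add: f'_def c_def)
    show ?case
    proof (rule dedekind_mertens_step[of _ "coeff_span f'" "cyc c" _ "cyc b" C])
      have "f = f' + monom c n" by (simp add: f'_def)
      then have "coeff_span f \<le> coeff_span f' + coeff_span (monom c n)" by (metis coeff_span_add_le)
      then show "coeff_span f \<le> coeff_span f' + cyc c" using monom by (meson add_left_mono order_trans)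
      show "coeff_span f' \<le> coeff_span f"
        by (simp add: coeff_span_le_iff coeff_f' coeff_in_coeff_span)
      have "coeff (f * ?g) (n + m) = coeff f n * coeff ?g m"
        using Suc.prems(1) step.hyps by (intro coeff_mult_top) auto
      then have "c * b \<in> elts H"
        using Suc.prems(2) step.hyps by (metis (no_types, lifting) c_def add.right_neutral coeff_add
            coeff_smult coeff_span_le_iff le_refl mult.right_neutral)
      then show "cyc c * cyc b \<le> H" by (simp add: cyc_mult cyc_le_iff)
      have "f * g = f * ?g - f * smult b h" by (simp add: algebra_simps)
      then have "coeff_span (f * g) \<le> coeff_span (f * ?g) + coeff_span (f * smult b h)"
        by (metis coeff_span_diff_le)
      also have "\<dots> \<le> H + coeff_span f * cyc b"
        using coeff_span_smult_Ints_le[OF step.hyps(5)] coeff_span_mult_le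
        by (meson Suc.prems(2) add_mono order_refl order_trans zmod_mult_mono)
      finally show "coeff_span f ^ k * C \<le> coeff_span f ^ (k - 1) * (H + cyc b * coeff_span f)"
        by (intro step.IH) (simp only: mult.commute)
      show "C = 0" if "k = 0" using echelon_0 step.hyps(1) that by blast
      have "f' * ?g = f * ?g - monom c n * ?g" by (simp add: f'_def algebra_simps)
      then have "coeff_span (f' * ?g) \<le> coeff_span (f * ?g) + coeff_span (monom c n * ?g)"
        by (metis coeff_span_diff_le)
      also have "\<dots> \<le> H + cyc c * ?C"
        using monom coeff_span_mult_le echelon_coeff_span[OF ech]
        by (meson Suc.prems(2) add_mono order_trans zmod_mult_mono)
      finally show "coeff_span f' ^ Suc k * ?C \<le> coeff_span f' ^ k * (H + cyc c * ?C)"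
        using Suc.IH[OF f'] by blast
    qed (rule c | rule refl)+
  qed
  moreover have "\<forall>i\<ge>Suc (degree f). coeff f i = 0" by (simp add: coeff_eq_0)
  ultimately show ?case using step.prems by simp
qed simp

section \<open>Elimination modulo a prime\<close>

text \<open>
  No element of the list lies in the subgroup generated by \<open>P\<close> and the later elements. For
  \<open>P = p M\<close> this says that the list is linearly independent modulo \<open>p\<close>.
\<close>

fun triangular :: "'a::comm_ring_1 zmod \<Rightarrow> 'a list \<Rightarrow> bool" where
  "triangular P [] \<longleftrightarrow> True"
| "triangular P (b # bs) \<longleftrightarrow> b \<notin> elts (gen (set bs) + P) \<and> triangular P bs"

lemma bezout_mod_prime:
  assumes "prime (p::nat)" "\<not> int p dvd c"
  obtains u v where "u * c + v * int p = 1"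
proof -
  have "coprime (int p) c" using assms by (simp add: prime_imp_coprime)
  then have "gcd c (int p) = 1" by (simp add: coprime_iff_gcd_eq_1 gcd.commute)
  then show thesis using bezout_int[of c "int p"] that by metis
qed

text \<open>
  A combination of the list that vanishes modulo \<open>p\<close> has coefficients divisible by \<open>p\<close>: a
  coefficient of the first element that is prime to \<open>p\<close> could be inverted modulo \<open>p\<close>.
\<close>

lemma triangular_mem_multiple:
  assumes p: "prime p" and "triangular P bs" "y \<in> elts (gen (set bs))" "y \<in> elts P"
    and P: "\<And>b. b \<in> set bs \<Longrightarrow> of_nat p * b \<in> elts P"
  shows "y \<in> elts (cyc (of_nat p) * gen (set bs))"
  using assms(2-)
proof (induction bs arbitrary: y)
  case Nil
  then show ?case by (simp flip: zero_zmod_def)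
next
  case (Cons b bs)
  have eq: "gen (set (b # bs)) = cyc b + gen (set bs)" by (simp add: gen_plus)
  obtain a y' where y: "a \<in> elts (cyc b)" "y' \<in> elts (gen (set bs))" "y = a + y'"
    using Cons.prems(2) unfolding eq elts_plus_iff by blast
  obtain c where a: "a = of_int c * b"
    using y(1) by (auto simp: elts_gen zmodule.span_singleton)
  have pb: "of_nat p * b \<in> elts P" using Cons.prems by simp
  have "int p dvd c"
  proof (rule ccontr)
    assume "\<not> int p dvd c"
    then obtain u v where uv: "u * c + v * int p = 1" using bezout_mod_prime[OF p] by blast
    have "b = of_int (u * c + v * int p) * b" by (simp add: uv)
    also have "\<dots> = of_int (- u) * y' + (of_int u * y + of_int v * (of_nat p * b))"
      using y a by (simp add: algebra_simps)
    finally have "b \<in> elts (gen (set bs) + P)"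
      using Cons.prems(3) pb elts_of_int_mult[OF y(2)] elts_add[OF elts_of_int_mult elts_of_int_mult]
      unfolding elts_plus_iff by blast
    then show False using Cons.prems(1) by simp
  qed
  then obtain d where "c = int p * d" by blast
  then have a': "a = of_int d * (of_nat p * b)" using a by (simp add: mult_ac)
  then have "a \<in> elts P" using pb elts_of_int_mult by blast
  then have "y' \<in> elts P" using y Cons.prems(3) elts_diff[of y P a] by simp
  then have "y' \<in> elts (cyc (of_nat p) * gen (set bs))"
    using Cons.IH Cons.prems y(2) by auto
  moreover have "a = of_nat p * (of_int d * b)" using a' by (simp add: mult_ac)
  then have "a \<in> elts (cyc (of_nat p) * cyc b)"
    by (simp add: zmod_mult_mem elts_of_int_mult gen_base)
  ultimately show ?case unfolding eq distrib_left elts_plus_iff using y(3) by blast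
qed

context fin_dim_rat_algebra
begin

text \<open>
  Independence modulo \<open>p\<close> implies independence over the rationals, since the coefficients of a
  rational relation, made integral, could be divided by \<open>p\<close> without end.
\<close>

lemma triangular_independent:
  assumes p: "prime p" and "triangular (cyc (of_nat p) * M) bs" "set bs \<subseteq> elts M"
  shows "independent (set bs) \<and> distinct bs"
  using assms(2-)
proof (induction bs)
  case Nil
  then show ?case by (simp add: independent_empty)
next
  case (Cons b bs)
  let ?P = "cyc (of_nat p) * M"
  have bP: "b \<notin> elts (gen (set bs) + ?P)" and bM: "b \<in> elts M"
    and tri: "triangular ?P bs" and sub: "set bs \<subseteq> elts M" using Cons.prems by auto
  have pP: "of_nat p * x \<in> elts ?P" if "x \<in> elts M" for x
    using that by (intro zmod_mult_mem gen_base) auto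
  have "of_nat N * b \<notin> int_span (set bs)" if "N > 0" for N
    using that
  proof (induction N rule: less_induct)
    case (less N)
    show ?case
    proof
      assume N: "of_nat N * b \<in> int_span (set bs)"
      show False
      proof (cases "p dvd N")
        case False
        then obtain u v where uv: "u * int N + v * int p = 1"
          using bezout_mod_prime[OF p, of "int N"] by auto
        have "b = of_int (u * int N + v * int p) * b" by (simp add: uv)
        also have "\<dots> = of_int u * (of_nat N * b) + of_int v * (of_nat p * b)"
          by (simp add: algebra_simps)
        finally have "b \<in> elts (gen (set bs) + ?P)"
          using N elts_of_int_mult pP[OF bM] unfolding elts_plus_iff elts_gen[symmetric] by blast
        then show False using bP by simp
      next
        case True
        then obtain K where K: "N = p * K" by blast
        have "of_nat N * b = of_nat p * (of_nat K * b)" by (simp add: K mult.assoc)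
        then have "of_nat N * b \<in> elts ?P" using pP[OF elts_of_nat_mult[OF bM]] by simp
        then have "of_nat N * b \<in> elts (cyc (of_nat p) * gen (set bs))"
          using N pP sub by (intro triangular_mem_multiple[OF p tri]) (auto simp: elts_gen)
        then obtain z where z: "z \<in> elts (gen (set bs))" "of_nat N * b = of_nat p * z"
          unfolding elts_cyc_mult by blast
        have "p > 0" using p prime_gt_0_nat by blast
        then have "of_nat K * b = z"
          using z(2) torsion_free_cancel[of p "of_nat K * b" z] by (simp add: K mult.assoc)
        moreover have "K < N" "K > 0" using K less.prems prime_gt_1_nat[OF p] by auto
        ultimately show False using less.IH[of K] z(1) by (simp add: elts_gen)
      qed
    qed
  qed
  then have "b \<notin> span (set bs)" using span_imp_int_span by blast
  moreover from this have "b \<notin> set bs" using span_base by blast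
  ultimately show ?case
    using Cons.IH tri sub independent_insertI by auto
qed

lemma triangular_length:
  fixes bs :: "'a list"
  assumes "prime p" "triangular (cyc (of_nat p) * M) bs" "set bs \<subseteq> elts M"
  shows "length bs \<le> dim UNIV"
proof -
  obtain T where T: "finite T" "independent T" "span T = UNIV"
    using finite_basis_of_subspace[OF subspace_UNIV] by metis
  have *: "independent (set bs)" "distinct bs" using triangular_independent assms by blast+
  then have "card (set bs) \<le> card T"
    using independent_span_bound[OF T(1) *(1)] T(3) by simp
  also have "card T = dim UNIV" using dim_eq_card[of T UNIV] T by simp
  finally show ?thesis using * distinct_card by metis
qed

end

text \<open>
  A maximal subgroup \<open>D'\<close> between \<open>p M\<close> and \<open>D\<close> that avoids \<open>b\<close> is a complement of \<open>b\<close>: adding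
  an element \<open>c\<close> outside \<open>D'\<close> produces \<open>b = d + w c\<close>, where \<open>w\<close> is invertible modulo \<open>p\<close>.
\<close>

lemma maximal_complement:
  assumes p: "prime p" and D: "fg M" "cyc (of_nat p) * M \<le> D" "D \<le> M"
    and b: "b \<in> elts D" "b \<notin> elts (cyc (of_nat p) * M)"
  obtains D' where "cyc (of_nat p) * M \<le> D'" "D' \<le> D" "b \<notin> elts D'"
    "\<And>c. c \<in> elts D \<Longrightarrow> \<exists>z. c - of_int z * b \<in> elts D'"
proof -
  let ?P = "cyc (of_nat p) * M"
  let ?S = "{K. ?P \<le> K \<and> K \<le> D \<and> b \<notin> elts K}"
  have "?S \<subseteq> {K. ?P \<le> K \<and> K \<le> M}" using D by auto
  then have "finite ?S"
    using finite_between[OF D(1), of p] prime_gt_0_nat[OF p] finite_subset by blast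
  moreover have "?P \<in> ?S" using D b by auto
  then have "?S \<noteq> {}" by blast
  ultimately obtain D' where D': "D' \<in> ?S" "\<And>K. K \<in> ?S \<Longrightarrow> D' \<le> K \<Longrightarrow> D' = K"
    using finite_has_maximal[of ?S] by blast
  have "\<exists>z. c - of_int z * b \<in> elts D'" if c: "c \<in> elts D" for c
  proof (cases "c \<in> elts D'")
    case True
    then show ?thesis by (intro exI[of _ 0]) simp
  next
    case False
    then have "D' + cyc c \<noteq> D'"
      using zmod_le_addI2[of "cyc c" D'] cyc_le_iff[of c D'] by metis
    then have "D' + cyc c \<notin> ?S" using D'(2)[of "D' + cyc c"] zmod_le_addI1[of D' "cyc c"] by auto
    moreover have "D' + cyc c \<le> D" using D'(1) c by (simp add: zmod_add_le_iff cyc_le_iff)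
    moreover have "?P \<le> D' + cyc c" using D'(1) by (simp add: zmod_le_add_trans1)
    ultimately have "b \<in> elts (D' + cyc c)" by blast
    then obtain d w where w: "d \<in> elts D'" "b = d + of_int w * c"
      by (auto simp: elts_plus_iff elts_gen zmodule.span_singleton)
    have "c \<in> elts M" using c D zmod_leD by blast
    then have "of_nat p * c \<in> elts ?P" by (intro zmod_mult_mem gen_base) auto
    then have pc: "of_nat p * c \<in> elts D'" using D'(1) zmod_leD by blast
    have "\<not> int p dvd w"
    proof
      assume "int p dvd w"
      then obtain e where "w = int p * e" by blast
      then have "b = d + of_int e * (of_nat p * c)" using w by (simp add: mult_ac)
      then have "b \<in> elts D'" using w pc elts_add elts_of_int_mult by metis
      then show False using D'(1) by simp
    qed
    then obtain u v where uv: "u * w + v * int p = 1" using bezout_mod_prime[OF p] by blast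
    have "c = of_int (u * w + v * int p) * c" by (simp add: uv)
    also have "\<dots> = of_int u * b + (of_int v * (of_nat p * c) - of_int u * d)"
      unfolding w(2) by (simp add: algebra_simps)
    finally have "c - of_int u * b = of_int v * (of_nat p * c) - of_int u * d"
      by (simp add: algebra_simps)
    then show ?thesis using pc w(1) elts_diff[OF elts_of_int_mult elts_of_int_mult] by metis
  qed
  then show thesis using that D'(1) by blast
qed

lemma coeff_Poly_map: "coeff (Poly (map F [0..<m])) i = (if i < m then F i else 0)"
  by (simp add: nth_default_def)

text \<open>
  Gaussian elimination modulo \<open>p\<close> on the coefficients of \<open>g\<close>. The topmost coefficient \<open>b\<close> that
  does not vanish modulo \<open>p\<close> is the pivot; the multiples of \<open>b\<close> in the lower coefficients form
  the integer polynomial \<open>h\<close>, and the remaining parts lie in a complement of \<open>b\<close>, where the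
  elimination continues. Either it stops after \<open>k\<close> steps, and \<open>g\<close> agrees modulo \<open>p\<close> with a
  polynomial in echelon form, or it yields \<open>k + 1\<close> pivots, which form a triangular list.
\<close>

lemma echelon_or_triangular:
  assumes p: "prime p" and M: "fg M"
    and "cyc (of_nat p) * M \<le> D" "D \<le> M" "coeff_span g \<le> D"
  shows "(\<exists>j g' C'. j \<le> k \<and> echelon j g' C' \<and> C' \<le> D \<and> coeff_span (g - g') \<le> cyc (of_nat p) * M \<and>
            (\<forall>m. (\<forall>i\<ge>m. coeff g i = 0) \<longrightarrow> (\<forall>i\<ge>m. coeff g' i = 0))) \<or>
         (\<exists>bs. length bs = Suc k \<and> triangular (cyc (of_nat p) * M) bs \<and> set bs \<subseteq> elts D)"
  using assms(3-)
proof (induction k arbitrary: D g)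
  case 0
  let ?P = "cyc (of_nat p) * M"
  show ?case
  proof (cases "coeff_span g \<le> ?P")
    case True
    then show ?thesis
      by (intro disjI1 exI[of _ 0]) (auto intro: echelon.zero)
  next
    case False
    then obtain i where "coeff g i \<notin> elts ?P" by (auto simp: coeff_span_le_iff)
    moreover have "coeff g i \<in> elts D" using 0 by (simp add: coeff_span_le_iff)
    ultimately show ?thesis
      by (intro disjI2 exI[of _ "[coeff g i]"]) (simp flip: zero_zmod_def)
  qed
next
  case (Suc k)
  let ?P = "cyc (of_nat p) * M"
  show ?case
  proof (cases "coeff_span g \<le> ?P")
    case True
    then show ?thesis
      by (intro disjI1 exI[of _ 0]) (auto intro: echelon.zero)
  next
    case False
    define m where "m = Max {i. coeff g i \<notin> elts ?P}"
    have sub: "{i. coeff g i \<notin> elts ?P} \<subseteq> {..degree g}"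
      by (auto intro: le_degree)
    then have fin: "finite {i. coeff g i \<notin> elts ?P}" using finite_subset by blast
    moreover have "{i. coeff g i \<notin> elts ?P} \<noteq> {}" using False by (auto simp: coeff_span_le_iff)
    ultimately have m: "coeff g m \<notin> elts ?P" unfolding m_def using Max_in by blast
    have above: "coeff g i \<in> elts ?P" if "i > m" for i
      using that Max_ge[OF fin, of i] unfolding m_def by fastforce
    define b where "b = coeff g m"
    have gD: "coeff g i \<in> elts D" for i using Suc.prems by (simp add: coeff_span_le_iff)
    obtain D' where D': "?P \<le> D'" "D' \<le> D" "b \<notin> elts D'"
      "\<And>c. c \<in> elts D \<Longrightarrow> \<exists>z. c - of_int z * b \<in> elts D'"
      using maximal_complement[OF p M Suc.prems(1,2) gD m] unfolding b_def by metis
    obtain z where z: "\<And>i. coeff g i - of_int (z i) * b \<in> elts D'"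
      using D'(4)[OF gD] by metis
    define h :: "'a poly" where "h = Poly (map (\<lambda>i. if i < m then of_int (z i) else 1) [0..<Suc m])"
    define g1 where "g1 = Poly (map (\<lambda>i. coeff g i - of_int (z i) * b) [0..<m])"
    have coeff_h: "coeff h i = (if i < m then of_int (z i) else if i = m then 1 else 0)" for i
      unfolding h_def coeff_Poly_map by auto
    have coeff_g1: "coeff g1 i = (if i < m then coeff g i - of_int (z i) * b else 0)" for i
      unfolding g1_def coeff_Poly_map by auto
    have g1: "coeff_span g1 \<le> D'" using z by (simp add: coeff_span_le_iff coeff_g1)
    have diff: "coeff_span (g - (smult b h + g1)) \<le> ?P"
      using above by (auto simp: coeff_span_le_iff coeff_h coeff_g1 b_def mult.commute)
    have "D' \<le> M" using D'(2) Suc.prems by simp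
    from Suc.IH[OF D'(1) this g1] show ?thesis
    proof
      assume "\<exists>j g' C'. j \<le> k \<and> echelon j g' C' \<and> C' \<le> D' \<and> coeff_span (g1 - g') \<le> ?P \<and>
            (\<forall>m. (\<forall>i\<ge>m. coeff g1 i = 0) \<longrightarrow> (\<forall>i\<ge>m. coeff g' i = 0))"
      then obtain j g' C' where *: "j \<le> k" "echelon j g' C'" "C' \<le> D'" "coeff_span (g1 - g') \<le> ?P"
        "\<And>m. (\<forall>i\<ge>m. coeff g1 i = 0) \<Longrightarrow> (\<forall>i\<ge>m. coeff g' i = 0)" by blast
      have g': "\<forall>i\<ge>m. coeff g' i = 0" using *(5)[of m] by (simp add: coeff_g1)
      have "echelon (Suc j) (smult b h + g') (cyc b + C')"
        using *(2) g' by (rule echelon.step) (auto simp: coeff_h)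
      moreover have "cyc b + C' \<le> D"
        using *(3) D'(2) gD by (auto simp: zmod_add_le_iff cyc_le_iff b_def)
      moreover have "g - (smult b h + g') = (g - (smult b h + g1)) + (g1 - g')" by simp
      then have "coeff_span (g - (smult b h + g')) \<le> coeff_span (g - (smult b h + g1)) + coeff_span (g1 - g')"
        by (metis coeff_span_add_le)
      then have "coeff_span (g - (smult b h + g')) \<le> ?P"
        using diff *(4) by (meson order_trans zmod_add_le_iff)
      moreover have "\<forall>i\<ge>l. coeff (smult b h + g') i = 0" if l: "\<forall>i\<ge>l. coeff g i = 0" for l
      proof -
        have "l > m" using l m by (metis elts_zero leI)
        then show ?thesis using g' by (auto simp: coeff_h)
      qed
      ultimately show ?thesis using *(1)
        by (intro disjI1 exI[of _ "Suc j"] exI[of _ "smult b h + g'"] exI[of _ "cyc b + C'"] conjI allI impI) auto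
    next
      assume "\<exists>bs. length bs = Suc k \<and> triangular ?P bs \<and> set bs \<subseteq> elts D'"
      then obtain bs where bs: "length bs = Suc k" "triangular ?P bs" "set bs \<subseteq> elts D'" by blast
      have "gen (set bs) + ?P \<le> D'" using bs D'(1) by (simp add: zmod_add_le_iff gen_le_iff)
      then have "b \<notin> elts (gen (set bs) + ?P)" using D'(3) zmod_leD by blast
      then show ?thesis
        using bs D'(2) gD by (intro disjI2 exI[of _ "b # bs"]) (auto simp: b_def dest: zmod_leD)
    qed
  qed
qed

context fin_dim_rat_algebra
begin

lemma dim_UNIV_pos: "dim (UNIV :: 'a set) > 0"
proof -
  obtain T :: "'a set" where T: "finite T" "independent T" "span T = UNIV"
    using finite_basis_of_subspace[OF subspace_UNIV] by metis
  have "T \<noteq> {}" using T(3) span_empty zero_neq_one by (metis UNIV_I singletonD)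
  then show ?thesis using T dim_eq_card[of T UNIV] by (simp add: card_gt_0_iff)
qed

text \<open>
  The content formula with the number of terms of \<open>g\<close> replaced by the rank of its content, as in
  a theorem of Heinzer and Huneke. Modulo a prime, elimination brings \<open>g\<close> into echelon form with
  at most \<open>n\<close> pivots, because the pivots are linearly independent over the rationals.
\<close>

lemma dedekind_mertens_rank:
  fixes f g :: "'a poly"
  assumes n: "n = dim (UNIV :: 'a set)"
    and t: "t > 0" "cyc (of_nat t) * (coeff_span f ^ n * coeff_span g) \<le> coeff_span f ^ (n - 1) * coeff_span (f * g)"
  shows "coeff_span f ^ n * coeff_span g \<le> coeff_span f ^ (n - 1) * coeff_span (f * g)"
proof (rule zmod_le_if_mod_primes[OF t])
  fix p :: nat assume p: "prime p"
  let ?F = "coeff_span f" and ?C = "coeff_span g" and ?H = "coeff_span (f * g)" and ?p = "cyc (of_nat p) :: 'a zmod"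
  have "\<not> (\<exists>bs. length bs = Suc n \<and> triangular (?p * ?C) bs \<and> set bs \<subseteq> elts ?C)"
    using triangular_length[OF p] n by (metis Suc_n_not_le_n)
  then obtain j g' C' where g': "j \<le> n" "echelon j g' C'" "coeff_span (g - g') \<le> ?p * ?C"
    using echelon_or_triangular[OF p fg_coeff_span cyc_of_nat_le order_refl order_refl, where g = g and k = n] by blast
  have "f * g' = f * g - f * (g - g')" by (simp add: algebra_simps)
  then have "coeff_span (f * g') \<le> ?H + coeff_span (f * (g - g'))" by (metis coeff_span_diff_le)
  also have "\<dots> \<le> ?H + ?F * (?p * ?C)"
    using coeff_span_mult_le[of f "g - g'"] zmod_mult_mono[OF order_refl g'(3), of ?F]
    by (meson add_left_mono order_trans)
  finally have dm: "?F ^ j * C' \<le> ?F ^ (j - 1) * (?H + ?F * (?p * ?C))"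
    by (rule dedekind_mertens[OF g'(2)])
  have "?F ^ n * C' \<le> ?F ^ (n - 1) * (?H + ?F * (?p * ?C))"
  proof (cases j)
    case 0
    then show ?thesis using echelon_0 g'(2) by fastforce
  next
    case (Suc i)
    have "?F ^ n * C' = ?F ^ (n - j) * (?F ^ j * C')"
      using g'(1) by (simp add: mult.assoc[symmetric] power_add[symmetric])
    also have "\<dots> \<le> ?F ^ (n - j) * (?F ^ (j - 1) * (?H + ?F * (?p * ?C)))"
      by (rule zmod_mult_mono[OF order_refl dm])
    also have "\<dots> = ?F ^ (n - 1) * (?H + ?F * (?p * ?C))"
      using g'(1) Suc by (simp add: mult.assoc[symmetric] power_add[symmetric])
    finally show ?thesis .
  qed
  also have "\<dots> \<le> ?F ^ (n - 1) * ?H + ?p * (?F ^ n * ?C)"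
  proof (cases n)
    case 0
    then show ?thesis using n dim_UNIV_pos by simp
  next
    case (Suc i)
    then show ?thesis by (simp add: distrib_left mult_ac)
  qed
  finally have C': "?F ^ n * C' \<le> ?F ^ (n - 1) * ?H + ?p * (?F ^ n * ?C)" .
  have "g = g' + (g - g')" by simp
  then have "?C \<le> coeff_span g' + coeff_span (g - g')" by (metis coeff_span_add_le)
  also have "\<dots> \<le> C' + ?p * ?C" using echelon_coeff_span g' by (intro add_mono) auto
  finally have "?F ^ n * ?C \<le> ?F ^ n * (C' + ?p * ?C)" by (rule zmod_mult_mono[OF order_refl])
  also have "\<dots> = ?F ^ n * C' + ?p * (?F ^ n * ?C)" by (simp add: distrib_left mult_ac)
  also have "\<dots> \<le> ?F ^ (n - 1) * ?H + ?p * (?F ^ n * ?C)"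
    using C' by (simp add: zmod_add_le_iff zmod_le_addI2)
  finally show "?F ^ n * ?C \<le> ?F ^ (n - 1) * ?H + ?p * (?F ^ n * ?C)" .
qed

end

section \<open>Powers of a lattice are invertible\<close>

lemma monic_division:
  fixes f r :: "'a::comm_ring_1 poly"
  assumes f: "\<forall>i>d. coeff f i = 0" "coeff f d * v = 1" and r: "\<forall>i>d. coeff r i = 0"
  shows "\<exists>s r'. r = f * s + r' \<and> (\<forall>i\<ge>d. coeff r' i = 0)"
proof -
  define c where "c = coeff r d * v"
  have "coeff (r - f * [:c:]) i = 0" if "i \<ge> d" for i
  proof (cases "i = d")
    case True
    have "coeff r d * v * coeff f d = coeff r d * (coeff f d * v)" by (simp add: mult_ac)
    then show ?thesis using True f(2) by (simp add: c_def)
  next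
    case False
    then show ?thesis using f r that by simp
  qed
  then show ?thesis by (intro exI[of _ "[:c:]"] exI[of _ "r - f * [:c:]"]) auto
qed

text \<open>
  Division by a polynomial whose leading coefficient is invertible, applied to the powers of the
  variable; their remainders span a space of finite dimension.
\<close>

lemma monom_mod_monic:
  fixes f :: "'a::comm_ring_1 poly"
  assumes f: "\<forall>i>d. coeff f i = 0" "coeff f d * v = 1"
  shows "\<exists>s r. monom 1 j = f * s + r \<and> (\<forall>i\<ge>d. coeff r i = 0)"
proof (induction j)
  case 0
  show ?case by (rule monic_division[OF f]) auto
next
  case (Suc j)
  then obtain s r where sr: "monom 1 j = f * s + r" "\<forall>i\<ge>d. coeff r i = 0" by blast
  have "\<forall>i>d. coeff (pCons 0 r) i = 0" using sr(2) by (auto simp: coeff_pCons split: nat.split)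
  then obtain s' r' where s': "pCons 0 r = f * s' + r'" "\<forall>i\<ge>d. coeff r' i = 0"
    using monic_division[OF f] by blast
  have "monom 1 (Suc j) = pCons 0 (f * s + r)" by (simp add: monom_Suc sr(1))
  also have "\<dots> = f * pCons 0 s + pCons 0 r" by simp
  also have "\<dots> = f * (pCons 0 s + s') + r'" unfolding s'(1) by (simp add: distrib_left)
  finally show ?case using s'(2) by blast
qed

context fin_dim_rat_algebra
begin

lemma scale_add_mult_1: "scale (a + b) 1 = scale a 1 + scale b 1"
  "scale (a * b) 1 = scale a 1 * scale b 1"
  by (simp_all add: scale_left_distrib scale_mult_left)

lemma poly_vector_space: "vector_space (\<lambda>q p. smult (scale q 1) (p :: 'a poly))"
  by unfold_locales (simp_all add: smult_add_right smult_add_left scale_add_mult_1)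

lemma rational_dependence:
  fixes r :: "nat \<Rightarrow> 'a poly"
  assumes r: "\<And>j. \<forall>i\<ge>d. coeff (r j) i = 0"
  shows "\<exists>J c. finite J \<and> (\<exists>j\<in>J. c j \<noteq> 0) \<and> (\<Sum>j\<in>J. smult (scale (c j) 1) (r j)) = 0"
proof (cases "inj r")
  case False
  then obtain i j where ij: "i \<noteq> j" "r i = r j" unfolding inj_def by blast
  define c :: "nat \<Rightarrow> rat" where "c = (\<lambda>k. if k = i then 1 else - 1)"
  have "(\<Sum>k\<in>{i, j}. smult (scale (c k) 1) (r k)) = 0" using ij by (simp add: c_def)
  moreover have "c i \<noteq> 0" by (simp add: c_def)
  ultimately show ?thesis by (intro exI[of _ "{i, j}"] exI[of _ c]) auto
next
  case True
  interpret pv: vector_space "\<lambda>q p. smult (scale q 1) (p :: 'a poly)" by (rule poly_vector_space)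
  obtain T where T: "finite T" "span T = UNIV" using finite_dimensional by blast
  define W where "W = (\<lambda>(b, i). monom b i) ` (T \<times> {..<d})"
  have W: "finite W" using T by (simp add: W_def)
  have monom: "monom c i \<in> pv.span W" if "i < d" for c i
  proof -
    have "c \<in> span T" using T by simp
    then show ?thesis
    proof (induction rule: span_induct_alt)
      case base
      then show ?case by (simp add: pv.span_zero)
    next
      case (step q x y)
      have "monom x i \<in> pv.span W" using step \<open>i < d\<close> by (intro pv.span_base) (auto simp: W_def)
      then have "smult (scale q 1) (monom x i) + monom y i \<in> pv.span W"
        using step by (intro pv.span_add pv.span_scale)
      moreover have "smult (scale q 1) (monom x i) = monom (scale q x) i"
        by (simp add: smult_monom flip: scale_eq_mult)
      ultimately show ?case by (simp add: add_monom)
    qed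
  qed
  have "r j \<in> pv.span W" for j
  proof -
    have "r j = (\<Sum>i<d. monom (coeff (r j) i) i)"
      using r[of j] by (auto simp: poly_eq_iff coeff_sum)
    then show ?thesis using monom by (metis (no_types, lifting) lessThan_iff pv.span_sum)
  qed
  then have sub: "r ` {..card W} \<subseteq> pv.span W" by blast
  have card: "card (r ` {..card W}) = Suc (card W)"
    using True by (simp add: card_image inj_on_subset[OF True])
  have "pv.dependent (r ` {..card W})"
    using pv.independent_span_bound[OF W _ sub] card by fastforce
  then obtain u where u: "\<exists>v\<in>r ` {..card W}. u v \<noteq> 0"
    "(\<Sum>v\<in>r ` {..card W}. smult (scale (u v) 1) v) = 0"
    by (auto simp: pv.dependent_finite)
  have "(\<Sum>j\<in>{..card W}. smult (scale (u (r j)) 1) (r j)) = 0"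
    using u(2) sum.reindex[OF inj_on_subset[OF True subset_UNIV[of "{..card W}"]],
        of "\<lambda>v. smult (scale (u v) 1) v"] by (simp add: o_def)
  then show ?thesis using u(1) by (intro exI[of _ "{..card W}"] exI[of _ "u \<circ> r"]) auto
qed

text \<open>
  Modulo \<open>f\<close> the powers of the variable are linearly dependent over the rationals. A dependency,
  cleared of denominators, is an integer polynomial divisible by \<open>f\<close>.
\<close>

lemma int_multiple_of_monic:
  fixes f :: "'a poly"
  assumes f: "\<forall>i>d. coeff f i = 0" "coeff f d * v = 1"
  shows "\<exists>g. f * g \<noteq> 0 \<and> (\<forall>i. coeff (f * g) i \<in> \<int>)"
proof -
  obtain s r where sr: "\<And>j. monom 1 j = f * s j + r j" "\<And>j. \<forall>i\<ge>d. coeff (r j) i = 0"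
    using monom_mod_monic[OF f] by metis
  obtain J c where J: "finite J" "\<exists>j\<in>J. c j \<noteq> 0" "(\<Sum>j\<in>J. smult (scale (c j) 1) (r j)) = 0"
    using rational_dependence[of d r, OF sr(2)] by (elim exE conjE) (rule that)
  define g where "g = (\<Sum>j\<in>J. smult (scale (c j) 1) (s j))"
  have "f * g = (\<Sum>j\<in>J. smult (scale (c j) 1) (f * s j)) + (\<Sum>j\<in>J. smult (scale (c j) 1) (r j))"
    by (simp add: J(3) g_def sum_distrib_left)
  also have "\<dots> = (\<Sum>j\<in>J. smult (scale (c j) 1) (monom 1 j))"
    by (simp add: sr(1) smult_add_right sum.distrib)
  finally have fg: "f * g = (\<Sum>j\<in>J. monom (scale (c j) 1) j)"
    by (simp add: smult_monom)
  have coeff_fg: "coeff (f * g) i = (if i \<in> J then scale (c i) 1 else 0)" for i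
    unfolding fg by (simp add: coeff_sum J(1))
  have "full (range (\<lambda>q. scale q 1)) 1"
  proof -
    have "\<exists>N>0. of_nat N * scale q 1 \<in> elts 1" for q
    proof -
      have "scale q 1 \<in> span {1}" by (intro span_scale span_base) auto
      from span_imp_int_span[OF this] show ?thesis by (simp flip: elts_gen)
    qed
    moreover have "elts 1 \<subseteq> range (\<lambda>q. scale q 1)"
      using scale_of_int by (auto simp: elts_gen zmodule.span_singleton simp flip: cyc_1)
        (metis mult.right_neutral rangeI)
    ultimately show ?thesis by (auto simp: full_def fg_one)
  qed
  then obtain N where N: "N > 0" "\<forall>x\<in>(\<lambda>j. scale (c j) 1) ` J. of_nat N * x \<in> elts 1"
    using common_denominator[of "range (\<lambda>q. scale q 1)" 1 "(\<lambda>j. scale (c j) 1) ` J"] J(1) by blast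
  have elts_1: "elts (1 :: 'a zmod) = \<int>"
    by (auto simp: elts_gen zmodule.span_singleton Ints_def simp flip: cyc_1)
  have coeff: "coeff (f * smult (of_nat N) g) i = of_nat N * coeff (f * g) i" for i by simp
  have "coeff (f * smult (of_nat N) g) i \<in> \<int>" for i
    unfolding coeff coeff_fg using N(2) by (auto simp: elts_1)
  moreover obtain j where "j \<in> J" "c j \<noteq> 0" using J by blast
  then have "coeff (f * g) j \<noteq> 0" by (simp add: coeff_fg)
  then have "coeff (f * smult (of_nat N) g) j \<noteq> 0"
    unfolding coeff using torsion_free N(1) by blast
  then have "f * smult (of_nat N) g \<noteq> 0" by (metis coeff_0)
  ultimately show ?thesis by blast
qed

end

lemma gen_Ints_principal:
  assumes "finite Y" "Y \<subseteq> \<int>"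
  shows "\<exists>k. gen Y = cyc (of_int k :: 'a::comm_ring_1)"
  using assms
proof (induction rule: finite_induct)
  case empty
  then show ?case
    by (intro exI[of _ 0] antisym) (simp_all add: gen_le_iff)
next
  case (insert y Y)
  then obtain k where k: "gen Y = cyc (of_int k)" by auto
  obtain l where l: "y = of_int l" using insert by (auto simp: Ints_def)
  obtain u v where uv: "u * l + v * k = gcd l k" using bezout_int by blast
  have mult: "(of_int m :: 'a) \<in> elts (cyc (of_int (gcd l k)))" if dvd: "gcd l k dvd m" for m
  proof -
    obtain e where "m = gcd l k * e" using dvd by blast
    then have m: "(of_int m :: 'a) = of_int e * of_int (gcd l k)" by (simp add: mult.commute)
    show ?thesis unfolding m by (rule elts_of_int_mult[OF gen_base]) simp
  qed
  have "gen (insert y Y) = cyc (of_int l) + cyc (of_int k)"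
    using gen_plus[of "{y}" Y] by (simp add: k l)
  also have "\<dots> = cyc (of_int (gcd l k))"
  proof (rule antisym)
    show "cyc (of_int l) + cyc (of_int k) \<le> cyc (of_int (gcd l k) :: 'a)"
      using mult by (simp add: zmod_add_le_iff cyc_le_iff)
    have "(of_int (gcd l k) :: 'a) = of_int u * of_int l + of_int v * of_int k"
      using uv by (metis of_int_add of_int_mult)
    then show "cyc (of_int (gcd l k) :: 'a) \<le> cyc (of_int l) + cyc (of_int k)"
      unfolding cyc_le_iff elts_plus_iff using elts_of_int_mult[OF gen_base] by blast
  qed
  finally show ?case by blast
qed

context fin_dim_rat_algebra
begin

lemma subalgebra_UNIV: "subalgebra scale UNIV"
  by unfold_locales auto

text \<open>
  Here \<open>U\<close> is the whole algebra as a subgroup, and the last premise says that every element is a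
  finite sum of multiples of elements of \<open>K\<close>. Such a \<open>K\<close> may have small rank; multiplication by
  a full lattice makes it full.
\<close>

lemma full_times_divisible:
  fixes M K U :: "'a zmod"
  assumes M: "full UNIV M" and K: "fg K" and U: "elts U = UNIV" "U \<le> U * K"
  shows "full UNIV (M * K)"
proof -
  have "\<exists>N>0. of_nat N * b \<in> elts (M * K)" for b
  proof -
    have "b \<in> lat_mult (elts U) (elts K)"
      using U unfolding lat_mult_elts by (metis UNIV_I zmod_leD)
    then obtain n u k where b: "b = (\<Sum>i<n. u i * k i)" "\<forall>i<(n::nat). k i \<in> elts K"
      unfolding lat_mult_def by blast
    obtain N where N: "N > 0" "\<forall>x\<in>u ` {..<n}. of_nat N * x \<in> elts M"
      using common_denominator[OF M, of "u ` {..<n}"] by auto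
    have "of_nat N * b = (\<Sum>i<n. (of_nat N * u i) * k i)"
      by (simp add: b(1) sum_distrib_left mult.assoc)
    also have "\<dots> \<in> elts (M * K)"
      using b(2) N(2) by (intro elts_sum zmod_mult_mem) auto
    finally show ?thesis using N(1) by blast
  qed
  then show ?thesis using M K fg_times by (auto simp: full_def)
qed

text \<open>
  Put \<open>D = M C\<close>. Then \<open>M D = M\<close>, hence \<open>D\<close> is idempotent, and \<open>M C C\<close> is an inverse of \<open>M\<close> with
  respect to \<open>D\<close>.
\<close>

lemma invertible_if_absorbs:
  fixes M C :: "'a zmod"
  assumes M: "full UNIV M" and C: "fg C" and MC: "M * (M * C) = M"
  shows "\<exists>D K. full UNIV D \<and> full UNIV K \<and> D * D = D \<and> M * D = M \<and> M * K = D"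
proof -
  obtain U :: "'a zmod" where U: "elts U = UNIV" using subspace_imp_zmod[OF subspace_UNIV] by blast
  have "U \<le> U * M"
  proof (rule zmod_leI)
    fix x
    obtain N where N: "N > 0" "of_nat N * 1 \<in> elts M" using M unfolding full_def by blast
    have "x = of_nat N * scale (1 / of_nat N) x"
      using of_nat_scale_inverse[OF N(1)] by simp
    then have "x = scale (1 / of_nat N) x * (of_nat N * 1)" by (simp add: mult.commute)
    then show "x \<in> elts (U * M)" using zmod_mult_mem[of _ U _ M] N(2) U by (metis UNIV_I)
  qed
  also have UM: "U * X \<le> U" for X using U by (auto intro!: zmod_leI)
  have "U * M = U * M * (M * C)" using MC by (simp add: mult.assoc)
  also have "\<dots> = (U * M * M) * C" by (simp add: mult.assoc)
  also have "\<dots> \<le> U * C"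
    using zmod_mult_mono[OF UM[of "M * M"] order_refl] by (simp add: mult.assoc)
  finally have UC: "U \<le> U * C" .
  have "U * C \<le> U * C * C" using zmod_mult_mono[OF UC order_refl] by simp
  then have UCC: "U \<le> U * (M * C * C)"
  proof -
    have "U \<le> U * M" by fact
    also have "\<dots> \<le> U * C * M" using zmod_mult_mono[OF UC order_refl] by simp
    also have "\<dots> \<le> U * C * C * M" using zmod_mult_mono[OF \<open>U * C \<le> U * C * C\<close> order_refl] by simp
    finally show ?thesis by (simp add: mult_ac)
  qed
  define D where "D = M * C"
  have MD: "M * D = M" using MC by (simp add: D_def)
  have DD: "D * D = D"
    by (metis D_def MD mult.assoc mult.commute)
  have fD: "full UNIV D" unfolding D_def by (rule full_times_divisible[OF M C U UC])
  have "U \<le> U * (C * C)"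
    using UC \<open>U * C \<le> U * C * C\<close> by (simp add: mult.assoc)
  then have "full UNIV (M * (C * C))"
    by (intro full_times_divisible[OF M fg_times[OF C C] U])
  moreover have "M * (M * (C * C)) = D"
    using DD by (simp add: D_def mult_ac)
  ultimately show ?thesis using fD DD MD by blast
qed

text \<open>
  The theorem of Dade, Taussky and Zassenhaus: for a polynomial \<open>f\<close> with content \<open>F\<close> and an
  integer polynomial \<open>f g\<close> with content generated by \<open>l\<close>, the content formula reads
  \<open>F\<^sup>n\<^sup>-\<^sup>1 (F C) = F\<^sup>n\<^sup>-\<^sup>1\<close> with \<open>C\<close> the content of \<open>g\<close> divided by \<open>l\<close>.
\<close>

theorem lattice_power_invertible:
  fixes F :: "'a zmod"
  assumes F: "full UNIV F" and n: "dim (UNIV :: 'a set) \<ge> 2" and k: "k \<ge> dim (UNIV :: 'a set) - 1"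
  shows "\<exists>D K. full UNIV D \<and> full UNIV K \<and> D * D = D \<and> F ^ k * D = F ^ k \<and> F ^ k * K = D"
proof -
  interpret U: subalgebra scale UNIV by (rule subalgebra_UNIV)
  obtain X where X: "finite X" "F = gen X" using F by (auto simp: full_def fg_def)
  obtain xs where xs: "set xs = X" using finite_list[OF X(1)] by blast
  obtain N where N: "N > 0" "of_nat N * 1 \<in> elts F" using F unfolding full_def by blast
  \<comment> \<open>The additional coefficient \<open>N\<close> lies in \<open>F\<close> and makes the leading coefficient invertible.\<close>
  define ys where "ys = xs @ [of_nat N]"
  define d where "d = length xs"
  define f where "f = Poly ys"
  have coeff_f: "coeff f i = (if i < Suc d then ys ! i else 0)" for i
    by (simp add: f_def nth_default_def ys_def d_def)
  have top: "coeff f d = of_nat N" by (simp add: coeff_f ys_def d_def)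
  obtain v where v: "of_nat N * v = (1 :: 'a)" using of_nat_scale_inverse[OF N(1), of 1] by metis
  have "coeff_span f = F"
  proof (rule antisym)
    show "coeff_span f \<le> F"
      unfolding coeff_span_le_iff
    proof
      fix i
      have "ys ! i \<in> elts F" if "i < Suc d"
      proof -
        have "ys ! i \<in> set ys" using that by (intro nth_mem) (simp add: ys_def d_def)
        then show ?thesis using N(2) X xs gen_base by (auto simp: ys_def)
      qed
      then show "coeff f i \<in> elts F" by (simp add: coeff_f)
    qed
    have "x \<in> elts (coeff_span f)" if x: "x \<in> X" for x
    proof -
      obtain i where "i < d" "x = xs ! i" using x xs by (metis d_def in_set_conv_nth)
      then have "x = coeff f i" by (simp add: coeff_f ys_def d_def nth_append)
      then show ?thesis by (simp add: coeff_in_coeff_span)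
    qed
    then show "F \<le> coeff_span f" unfolding X(2) gen_le_iff by blast
  qed
  note F_eq = this
  have "\<forall>i>d. coeff f i = 0" by (simp add: coeff_f)
  then obtain g where g: "f * g \<noteq> 0" "\<And>i. coeff (f * g) i \<in> \<int>"
    using int_multiple_of_monic[of d f v] top v by auto
  obtain l where l: "coeff_span (f * g) = cyc (of_int l)"
    using gen_Ints_principal[OF finite_range_coeff, of "f * g"] g(2) unfolding coeff_span_def by blast
  have "l \<noteq> 0"
  proof
    assume "l = 0"
    then have "coeff (f * g) i = 0" for i
      using coeff_in_coeff_span[of "f * g" i] l by (auto simp: elts_gen zmodule.span_singleton)
    then show False using g(1) by (simp add: poly_eq_iff)
  qed
  then obtain w where w: "of_int l * w = (1 :: 'a)"
    using scale_of_int[of l "scale (1 / of_int l) 1"] scale_scale[of "of_int l" "1 / of_int l" 1]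
    by (metis divide_self_if nonzero_eq_divide_eq of_int_eq_0_iff scale_one times_divide_eq_right mult.right_neutral)
  then have uw: "U.unit (of_int l)" unfolding U.unit_def by auto
  let ?n = "dim (UNIV :: 'a set)" and ?C = "coeff_span g"
  have "Suc (?n - 2) = ?n - 1" using n by simp
  then have "full UNIV (F ^ (?n - 1))"
    using U.full_power[OF F, of "?n - 2"] by (simp only:)
  then have full_H: "full UNIV (F ^ (?n - 1) * coeff_span (f * g))"
    using U.full_unit_mult[OF uw] by (simp only: l mult.commute[of _ "cyc (of_int l)"])
  obtain t where t: "t > 0" "cyc (of_nat t) * (F ^ ?n * ?C) \<le> F ^ (?n - 1) * coeff_span (f * g)"
    using common_denominator_lattice[OF full_H, of "F ^ ?n * ?C"] F
    by (auto simp: full_def fg_times fg_power fg_coeff_span)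
  have "F ^ ?n * ?C \<le> F ^ (?n - 1) * cyc (of_int l)"
    using dedekind_mertens_rank[OF refl, of t f g] t by (simp add: F_eq l)
  moreover have "F ^ (?n - 1) * cyc (of_int l) \<le> F ^ (?n - 1) * (F * ?C)"
    using coeff_span_mult_le[of f g] by (intro zmod_mult_mono order_refl) (simp add: F_eq l)
  moreover have "F ^ (?n - 1) * (F * ?C) = F ^ ?n * ?C"
    using n by (metis One_nat_def Suc_1 Suc_diff_1 Suc_le_lessD less_trans mult.assoc power_Suc2 zero_less_Suc)
  ultimately have eq: "F ^ (?n - 1) * (F * ?C) = F ^ (?n - 1) * cyc (of_int l)" by simp
  define C where "C = cyc w * ?C"
  have "F ^ (?n - 1) * (F * C) = cyc w * (F ^ (?n - 1) * (F * ?C))"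
    by (simp add: C_def mult_ac)
  also have "\<dots> = F ^ (?n - 1) * (cyc w * cyc (of_int l))"
    unfolding eq by (simp only: mult.left_commute)
  also have "\<dots> = F ^ (?n - 1)" using w by (simp add: cyc_mult mult.commute)
  finally have FC: "F ^ (?n - 1) * (F * C) = F ^ (?n - 1)" .
  have FkC: "F ^ k * (F * C) = F ^ k"
  proof -
    have "F ^ k = F ^ (k - (?n - 1)) * F ^ (?n - 1)"
      using k by (simp add: power_add[symmetric])
    then show ?thesis using FC by (metis mult.assoc)
  qed
  have "F ^ k * (F * C) ^ j = F ^ k" for j
  proof (induction j)
    case (Suc j)
    have "F ^ k * (F * C) ^ Suc j = F ^ k * (F * C) * (F * C) ^ j" by (simp add: mult.assoc)
    then show ?case using FkC Suc by simp
  qed simp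
  then have "F ^ k * (F ^ k * C ^ k) = F ^ k" by (simp add: power_mult_distrib)
  moreover have "full UNIV (F ^ k)"
    using U.full_power[OF F, of "k - 1"] k n by simp
  moreover have "fg (C ^ k)"
    unfolding C_def by (intro fg_power fg_times fg_coeff_span fg_gen) auto
  ultimately show ?thesis using invertible_if_absorbs by blast
qed

end

section \<open>Nakayama's lemma and idempotents modulo an integer\<close>

text \<open>
  The determinant trick, carried out by eliminating one generator after the other: if
  \<open>(1 - j) L\<close> is contained in \<open>I x + I X\<close>, then \<open>(1 - j) x = i x + y\<close> with \<open>y\<close> in \<open>I X\<close>, and
  multiplication by \<open>1 - (j + i)\<close> removes \<open>x\<close>.
\<close>

lemma nakayama:
  fixes I L :: "'a::comm_ring_1 zmod"
  assumes L: "fg L" "L \<le> I * L" and I: "I * I \<le> I"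
  shows "\<exists>i\<in>elts I. \<forall>l\<in>elts L. (1 - i) * l = 0"
proof -
  have gen: "\<exists>i\<in>elts I. \<forall>l\<in>elts L. (1 - i) * l = 0"
    if "finite X" "X \<subseteq> elts L" "j \<in> elts I" "\<forall>l\<in>elts L. (1 - j) * l \<in> elts (I * gen X)" for X j
    using that
  proof (induction arbitrary: j rule: finite_induct)
    case empty
    then show ?case by (intro bexI[of _ j]) (simp_all flip: zero_zmod_def)
  next
    case (insert x X)
    have split: "I * gen (insert x X) = I * cyc x + I * gen X"
      using gen_plus[of "{x}" X] distrib_left[of I "cyc x" "gen X"] by simp
    have decomp: "\<exists>i\<in>elts I. \<exists>y\<in>elts (I * gen X). (1 - j) * l = i * x + y" if l: "l \<in> elts L" for l
    proof -
      from l insert.prems(3) have "(1 - j) * l \<in> elts (I * cyc x + I * gen X)"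
        unfolding split by blast
      then obtain u y where uy: "u \<in> elts (I * cyc x)" "y \<in> elts (I * gen X)" "(1 - j) * l = u + y"
        unfolding elts_plus_iff by blast
      then obtain i where "i \<in> elts I" "u = x * i"
        unfolding mult.commute[of I "cyc x"] elts_cyc_mult by blast
      then show ?thesis using uy by (auto simp: mult.commute)
    qed
    obtain i y where iy: "i \<in> elts I" "y \<in> elts (I * gen X)" "(1 - j) * x = i * x + y"
      using decomp insert.prems(1) by blast
    define k where "k = j + i"
    have k: "k \<in> elts I" using iy insert.prems(2) by (simp add: k_def elts_add)
    have kx: "(1 - k) * x = y" using iy(3) by (simp add: k_def algebra_simps)
    \<comment> \<open>This \<open>m\<close> is chosen such that \<open>1 - m = (1 - j) (1 - k)\<close>.\<close>
    define m where "m = j + k - j * k"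
    have jk: "j * k \<in> elts I" using zmod_mult_mem[OF insert.prems(2) k] I zmod_leD by blast
    have m: "m \<in> elts I" unfolding m_def using k jk insert.prems(2) by (intro elts_diff elts_add)
    have absorb: "i' * z \<in> elts (I * gen X)" if "i' \<in> elts I" "z \<in> elts (I * gen X)" for i' z
      using zmod_mult_mem[OF that] zmod_mult_mono[OF I order_refl, of "gen X"]
      by (metis mult.assoc zmod_leD)
    have "(1 - m) * l \<in> elts (I * gen X)" if l: "l \<in> elts L" for l
    proof -
      obtain i' y' where l': "i' \<in> elts I" "y' \<in> elts (I * gen X)" "(1 - j) * l = i' * x + y'"
        using decomp[OF l] by blast
      have "(1 - m) * l = (1 - k) * ((1 - j) * l)" by (simp add: m_def algebra_simps)
      also have "\<dots> = i' * ((1 - k) * x) + (y' - k * y')" unfolding l'(3) by (simp add: algebra_simps)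
      also have "\<dots> \<in> elts (I * gen X)"
        unfolding kx using l' iy k by (intro elts_add elts_diff absorb)
      finally show ?thesis .
    qed
    then show ?case using insert.IH[of m] insert.prems(1) m by auto
  qed
  obtain X where X: "finite X" "L = gen X" using L by (auto simp: fg_def)
  have "\<forall>l\<in>elts L. (1 - 0) * l \<in> elts (I * gen X)" using L X zmod_leD by fastforce
  then show ?thesis using gen[of X 0] X gen_base by auto
qed

lemma sum_power_mem:
  fixes a b :: "'a::comm_ring_1"
  assumes J: "J * \<Lambda> \<le> J" and ring: "\<Lambda> * \<Lambda> \<le> \<Lambda>" "1 \<in> elts \<Lambda>"
    and a: "a \<in> elts \<Lambda>" "a ^ m \<in> elts J" and b: "b \<in> elts \<Lambda>" "b ^ n \<in> elts J"
  shows "(a + b) ^ (m + n) \<in> elts J"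
proof -
  have pow: "x ^ i \<in> elts \<Lambda>" if "x \<in> elts \<Lambda>" for x i
    using that ring by (induction i) (auto dest: zmod_leD intro: zmod_mult_mem)
  have ideal: "x * y \<in> elts J" if "x \<in> elts J" "y \<in> elts \<Lambda>" for x y
    using zmod_mult_mem[OF that] J zmod_leD by blast
  have "a ^ i * b ^ (m + n - i) \<in> elts J" if "i \<le> m + n" for i
  proof (cases "i \<ge> m")
    case True
    have "a ^ i * b ^ (m + n - i) = a ^ m * (a ^ (i - m) * b ^ (m + n - i))"
      using True by (simp add: mult.assoc[symmetric] flip: power_add)
    moreover have "a ^ (i - m) * b ^ (m + n - i) \<in> elts \<Lambda>"
      using zmod_mult_mem[OF pow[OF a(1)] pow[OF b(1)]] ring(1) zmod_leD by blast
    ultimately show ?thesis using ideal[OF a(2)] by simp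
  next
    case False
    have "n + (m - i) = m + n - i" using False by simp
    then have "b ^ n * b ^ (m - i) = b ^ (m + n - i)" by (metis power_add)
    then have "a ^ i * b ^ (m + n - i) = b ^ n * (a ^ i * b ^ (m - i))"
      by (simp add: mult_ac)
    moreover have "a ^ i * b ^ (m - i) \<in> elts \<Lambda>"
      using zmod_mult_mem[OF pow[OF a(1)] pow[OF b(1)]] ring(1) zmod_leD by blast
    ultimately show ?thesis using ideal[OF b(2)] by simp
  qed
  then show ?thesis
    unfolding binomial_ring by (intro elts_sum) (simp add: mult.assoc elts_of_nat_mult)
qed

text \<open>
  In the finite ring \<open>\<Lambda> / N \<Lambda>\<close> the powers of \<open>a\<close> are eventually periodic with some period \<open>d\<close>; a
  sufficiently large power with exponent divisible by \<open>d\<close> is idempotent.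
\<close>

lemma power_idempotent_mod:
  fixes a :: "'a::comm_ring_1"
  assumes \<Lambda>: "fg \<Lambda>" "\<Lambda> * \<Lambda> \<le> \<Lambda>" "1 \<in> elts \<Lambda>" and N: "N > 0" and a: "a \<in> elts \<Lambda>"
  defines "J \<equiv> cyc (of_nat N) * \<Lambda>"
  shows "\<exists>k>0. a ^ k * a ^ k - a ^ k \<in> elts J"
proof -
  have pow: "a ^ i \<in> elts \<Lambda>" for i
    using a \<Lambda> by (induction i) (auto dest: zmod_leD intro: zmod_mult_mem)
  have J: "J * \<Lambda> \<le> J"
    unfolding J_def mult.assoc by (intro zmod_mult_mono \<Lambda> order_refl)
  have ideal: "x * y \<in> elts J" if "x \<in> elts J" "y \<in> elts \<Lambda>" for x y
    using zmod_mult_mem[OF that] J zmod_leD by blast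
  obtain R where R: "finite R" "\<And>m. m \<in> elts \<Lambda> \<Longrightarrow> \<exists>r\<in>R. m - r \<in> elts J"
    using finite_representatives[OF \<Lambda>(1) N] unfolding J_def by blast
  obtain r where r: "\<And>i. r i \<in> R" "\<And>i. a ^ i - r i \<in> elts J"
    using R(2)[OF pow] by metis
  have "\<not> inj r"
    using R(1) r(1) finite_imageD[of r UNIV] finite_subset[of "range r" R] by (meson image_subsetI infinite_UNIV_nat)
  then obtain i j where ij: "i < j" "r i = r j"
    unfolding inj_def by (metis linorder_neqE_nat)
  define d where "d = j - i"
  have "(a ^ j - r j) - (a ^ i - r i) \<in> elts J" using r(2) elts_diff by blast
  then have base: "a ^ j - a ^ i \<in> elts J" using ij by simp
  have shift: "a ^ (m + t * d) - a ^ m \<in> elts J" if "i \<le> m" for m t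
  proof (induction t)
    case (Suc t)
    have "j + (m - i + t * d) = m + Suc t * d" "i + (m - i + t * d) = m + t * d"
      using that ij by (auto simp: d_def)
    then have "a ^ (m + Suc t * d) - a ^ (m + t * d) = (a ^ j - a ^ i) * a ^ (m - i + t * d)"
      by (metis left_diff_distrib power_add)
    then have "a ^ (m + Suc t * d) - a ^ (m + t * d) \<in> elts J" using ideal base pow by simp
    then show ?case using elts_add[OF Suc] by fastforce
  qed simp
  define k where "k = Suc i * d"
  have "d \<ge> 1" using ij by (simp add: d_def)
  then have "Suc i * 1 \<le> k" unfolding k_def by (rule mult_le_mono2)
  then have "k > 0" "i \<le> k" by auto
  moreover have "a ^ k * a ^ k - a ^ k \<in> elts J"
    using shift[OF \<open>i \<le> k\<close>, of "Suc i"] by (simp add: k_def flip: power_add)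
  ultimately show ?thesis by blast
qed

text \<open>
  Invertible modules over a finite ring are principal. Choose \<open>x\<close> and \<open>y\<close> such that \<open>e = x y\<close> is
  idempotent modulo \<open>N\<close> and generates an ideal that is as large as possible. If all the products
  \<open>(1 - e) z w\<close> are nilpotent modulo \<open>N\<close>, then so is \<open>1 - e\<close>, which is a sum of such products,
  and being idempotent it vanishes. Otherwise a power \<open>b\<close> of such a product is a nonzero
  idempotent orthogonal to \<open>e\<close>, and \<open>x' = e x + (1 - e) z\<close> together with a suitable \<open>y'\<close> has
  \<open>x' y'\<close> congruent to \<open>e + b\<close>, which contradicts the choice of \<open>e\<close>.
\<close>

lemma invertible_principal_mod:
  fixes L M \<Lambda> :: "'a::comm_ring_1 zmod"
  assumes \<Lambda>: "fg \<Lambda>" "\<Lambda> * \<Lambda> \<le> \<Lambda>" "1 \<in> elts \<Lambda>" and N: "N > 0"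
    and L: "L * \<Lambda> \<le> L" and M: "M * \<Lambda> \<le> M" and LM: "L * M = \<Lambda>"
  shows "\<exists>x\<in>elts L. \<exists>y\<in>elts M. x * y - 1 \<in> elts (cyc (of_nat N) * \<Lambda>)"
proof -
  define J where "J = cyc (of_nat N) * \<Lambda>"
  have J\<Lambda>: "J * \<Lambda> \<le> J"
    unfolding J_def mult.assoc by (intro zmod_mult_mono \<Lambda> order_refl)
  have J_le: "J \<le> \<Lambda>" unfolding J_def by (rule cyc_of_nat_le)
  have ideal: "x * y \<in> elts J" "y * x \<in> elts J" if "x \<in> elts J" "y \<in> elts \<Lambda>" for x y
    using zmod_mult_mem[OF that] J\<Lambda> zmod_leD by (auto simp: mult.commute)
  have ring: "x * y \<in> elts \<Lambda>" if "x \<in> elts \<Lambda>" "y \<in> elts \<Lambda>" for x y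
    using zmod_mult_mem[OF that] \<Lambda>(2) zmod_leD by blast
  have pow: "x ^ i \<in> elts \<Lambda>" if "x \<in> elts \<Lambda>" for x i
    using that \<Lambda>(3) by (induction i) (auto intro: ring)
  have LM': "x * y \<in> elts \<Lambda>" if "x \<in> elts L" "y \<in> elts M" for x y
    using zmod_mult_mem[OF that] LM by simp
  have L': "c * x \<in> elts L" if "x \<in> elts L" "c \<in> elts \<Lambda>" for c x
    using zmod_mult_mem[OF that] L zmod_leD by (metis mult.commute)
  have M': "c * x \<in> elts M" if "x \<in> elts M" "c \<in> elts \<Lambda>" for c x
    using zmod_mult_mem[OF that] M zmod_leD by (metis mult.commute)
  define idl where "idl e = cyc e * \<Lambda> + J" for e
  let ?E = "{x * y | x y. x \<in> elts L \<and> y \<in> elts M \<and> (x * y) * (x * y) - x * y \<in> elts J}"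
  have "idl e \<in> {K. J \<le> K \<and> K \<le> \<Lambda>}" if "e \<in> ?E" for e
    using that LM' ring J_le by (auto simp: idl_def zmod_add_le_iff zmod_le_addI2 cyc_mult_le_iff)
  then have "idl ` ?E \<subseteq> {K. J \<le> K \<and> K \<le> \<Lambda>}" by blast
  then have "finite (idl ` ?E)"
    using finite_between[OF \<Lambda>(1) N] finite_subset unfolding J_def by blast
  moreover have "idl ` ?E \<noteq> {}"
  proof -
    have "0 \<in> ?E" by (intro CollectI exI[of _ 0]) simp
    then show ?thesis by blast
  qed
  ultimately obtain Q where Q: "Q \<in> idl ` ?E" "\<And>e. e \<in> ?E \<Longrightarrow> Q \<le> idl e \<Longrightarrow> Q = idl e"
    using finite_has_maximal[of "idl ` ?E"] by blast
  then obtain x y where xy: "x \<in> elts L" "y \<in> elts M" "(x * y) * (x * y) - x * y \<in> elts J"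
    "Q = idl (x * y)" by blast
  define e where "e = x * y"
  have e: "e \<in> elts \<Lambda>" "e * e - e \<in> elts J" using xy LM' by (auto simp: e_def)
  have e1: "1 - e \<in> elts \<Lambda>" using e(1) \<Lambda>(3) elts_diff by blast
  have nil: "\<exists>k. ((1 - e) * (z * w)) ^ k \<in> elts J" if z: "z \<in> elts L" and w: "w \<in> elts M" for z w
  proof (rule ccontr)
    assume non: "\<nexists>k. ((1 - e) * (z * w)) ^ k \<in> elts J"
    define a where "a = (1 - e) * (z * w)"
    have a: "a \<in> elts \<Lambda>" unfolding a_def using e1 LM'[OF z w] by (rule ring)
    obtain k where k: "k > 0" "a ^ k * a ^ k - a ^ k \<in> elts J"
      using power_idempotent_mod[OF \<Lambda> N a] unfolding J_def by blast
    \<comment> \<open>The cofactor \<open>c\<close> turns \<open>a = (1 - e) z w\<close> into the idempotent \<open>b = a c\<close>.\<close>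
    define c where "c = a ^ (k - 1)"
    define b where "b = a ^ k"
    have b: "b \<in> elts \<Lambda>" "b * b - b \<in> elts J" "b \<notin> elts J"
      using k non pow[OF a] by (auto simp: b_def a_def)
    have c: "c \<in> elts \<Lambda>" using pow[OF a] by (simp add: c_def)
    have bc: "b = a * c" using k(1) by (simp add: b_def c_def flip: power_Suc)
    have eb: "e * b \<in> elts J"
    proof -
      have "e * b = (e * e - e) * (- (z * w * c))" by (simp add: bc a_def algebra_simps)
      moreover have "- (z * w * c) \<in> elts \<Lambda>" using ring[OF LM'[OF z w] c] by (rule elts_uminus)
      ultimately show ?thesis using ideal(1)[OF e(2), of "- (z * w * c)"] by (simp only:)
    qed
    define x' where "x' = e * x + (1 - e) * z"
    define y' where "y' = e * y + (1 - e) * (c * w)"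
    have x': "x' \<in> elts L" unfolding x'_def using xy z e e1 by (intro elts_add L')
    have y': "y' \<in> elts M" unfolding y'_def using xy w e e1 c by (intro elts_add M')
    define f where "f = x' * y'"
    have f: "f \<in> elts \<Lambda>" unfolding f_def using x' y' by (rule LM')
    have s: "c * (x * w) + z * y \<in> elts \<Lambda>" by (intro elts_add ring[OF c] LM' xy z w)
    have "f = e * e * (x * y) + (e - e * e) * (c * (x * w) + z * y) + (1 - e) * ((1 - e) * (z * w) * c)"
      unfolding f_def x'_def y'_def by (simp add: algebra_simps)
    then have "f - (e + b) = (e * e - e) * (e + 1) - (e * e - e) * (c * (x * w) + z * y) - e * b"
      unfolding e_def[symmetric] a_def[symmetric] bc[symmetric] by (simp add: algebra_simps)
    also have "\<dots> \<in> elts J"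
      by (rule elts_diff[OF elts_diff[OF ideal(1)[OF e(2) elts_add[OF e(1) \<Lambda>(3)]]
            ideal(1)[OF e(2) s]] eb])
    finally have nu: "f - (e + b) \<in> elts J" .
    have "f * f - f = (f - (e + b)) * (f + e + b - 1) + ((e * e - e) + (e * b + e * b) + (b * b - b))"
      by (simp add: algebra_simps)
    also have "\<dots> \<in> elts J"
      by (rule elts_add[OF
            ideal(1)[OF nu elts_diff[OF elts_add[OF elts_add[OF f e(1)] b(1)] \<Lambda>(3)]]
            elts_add[OF elts_add[OF e(2) elts_add[OF eb eb]] b(2)]])
    finally have "f \<in> ?E" unfolding f_def using x' y' by blast
    moreover have eQ: "e \<in> elts (idl f)"
    proof -
      have "e = e * f + (- (e * e - e) - e * b - e * (f - (e + b)))"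
        by (simp add: algebra_simps)
      moreover have "e * f \<in> elts (cyc f * \<Lambda>)"
        unfolding elts_cyc_mult using e(1) by (auto simp: mult.commute)
      moreover have "- (e * e - e) - e * b - e * (f - (e + b)) \<in> elts J"
        by (rule elts_diff[OF elts_diff[OF elts_uminus[OF e(2)] eb] ideal(2)[OF nu e(1)]])
      ultimately show ?thesis
        unfolding idl_def elts_plus_iff by blast
    qed
    moreover have idl\<Lambda>: "idl f * \<Lambda> \<le> idl f"
      unfolding idl_def distrib_right mult.assoc
      by (intro add_mono zmod_mult_mono \<Lambda>(2) order_refl J\<Lambda>[unfolded mult.assoc])
    moreover have "cyc e * \<Lambda> \<le> idl f"
      using zmod_mult_mono[of "cyc e" "idl f" \<Lambda> \<Lambda>] eQ idl\<Lambda> by (simp add: cyc_le_iff)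
    moreover from this have "Q \<le> idl f" unfolding xy(4) e_def[symmetric]
      by (simp add: idl_def zmod_add_le_iff zmod_le_addI2)
    ultimately have "Q = idl f" using Q(2) by blast
    moreover have "f \<in> elts (idl f)"
    proof -
      have "f * 1 \<in> elts (cyc f * \<Lambda>)" unfolding elts_cyc_mult using \<Lambda>(3) by blast
      then show ?thesis using zmod_le_addI1 zmod_leD unfolding idl_def by fastforce
    qed
    ultimately have "f \<in> elts (cyc e * \<Lambda> + J)" by (simp add: xy(4) e_def idl_def)
    then obtain l n where ln: "l \<in> elts \<Lambda>" "n \<in> elts J" "f = e * l + n"
      unfolding elts_plus_iff elts_cyc_mult by blast
    have "b = b * f - b * (f - (e + b)) - e * b - (b * b - b)" by (simp add: algebra_simps)
    also have "\<dots> = (e * b) * l + b * n - b * (f - (e + b)) - e * b - (b * b - b)"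
      unfolding ln(3) by (simp add: algebra_simps)
    also have "\<dots> \<in> elts J"
      by (rule elts_diff[OF elts_diff[OF elts_diff[OF elts_add[OF ideal(1)[OF eb ln(1)]
            ideal(2)[OF ln(2) b(1)]] ideal(2)[OF nu b(1)]] eb] b(2)])
    finally show False using b(3) by simp
  qed
  have mem: "\<exists>k. ((1 - e) * s) ^ k \<in> elts J" if "s \<in> elts (L * M)" for s
  proof -
    have "s \<in> lat_mult (elts L) (elts M)" using that by (simp add: lat_mult_elts)
    then obtain m z w where s: "s = (\<Sum>i<m. z i * w i)" "\<forall>i<(m::nat). z i \<in> elts L \<and> w i \<in> elts M"
      unfolding lat_mult_def by blast
    have "(\<exists>k. ((1 - e) * (\<Sum>i<m. z i * w i)) ^ k \<in> elts J) \<and> (\<Sum>i<m. z i * w i) \<in> elts \<Lambda>"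
      using s(2)
    proof (induction m)
      case 0
      have "((1 - e) * (\<Sum>i<0. z i * w i)) ^ 1 \<in> elts J" by simp
      then show ?case by (metis elts_zero lessThan_0 sum.empty)
    next
      case (Suc m)
      then obtain k where k: "((1 - e) * (\<Sum>i<m. z i * w i)) ^ k \<in> elts J"
        "(\<Sum>i<m. z i * w i) \<in> elts \<Lambda>" by auto
      obtain k' where k': "((1 - e) * (z m * w m)) ^ k' \<in> elts J" using nil Suc.prems by blast
      have zw: "z m * w m \<in> elts \<Lambda>" using Suc.prems LM' by blast
      have "((1 - e) * (\<Sum>i<m. z i * w i) + (1 - e) * (z m * w m)) ^ (k + k') \<in> elts J"
        by (rule sum_power_mem[OF J\<Lambda> \<Lambda>(2,3) ring[OF e1 k(2)] k(1) ring[OF e1 zw] k'])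
      then show ?case using k(2) zw by (auto simp: distrib_left elts_add)
    qed
    then show ?thesis using s by blast
  qed
  then obtain k where k: "(1 - e) ^ k \<in> elts J" using mem[of 1] LM \<Lambda>(3) by auto
  have "(1 - e) ^ Suc i - (1 - e) \<in> elts J" for i
  proof (induction i)
    case (Suc i)
    have "(1 - e) ^ Suc (Suc i) - (1 - e) = ((1 - e) ^ Suc i - (1 - e)) * (1 - e) + (e * e - e)"
      by (simp add: algebra_simps)
    then show ?case using ideal(1)[OF Suc e1] e(2) elts_add by metis
  qed simp
  from this[of k] have "(1 - e) * (1 - e) ^ k - (1 - e) \<in> elts J" by simp
  then have "(1 - e) * (1 - e) ^ k - ((1 - e) * (1 - e) ^ k - (1 - e)) \<in> elts J"
    using ideal(2)[OF k e1] elts_diff by blast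
  then have "1 - e \<in> elts J" by simp
  then have "e - 1 \<in> elts J" using elts_uminus by fastforce
  then show ?thesis using xy(1,2) unfolding e_def J_def by blast
qed

section \<open>The groups of invertible lattices over nested orders\<close>

context subalgebra
begin

lemma full_absorb_denominator:
  assumes "full B M" "full B K"
  obtains N where "N > 0" "cyc (of_nat N) * K \<le> M"
  using common_denominator_lattice[of B M K] assms unfolding full_def by blast

lemma order_fg: "is_order \<Lambda> \<Longrightarrow> fg \<Lambda>"
  by (simp add: is_order_def full_def)

text \<open>
  Let \<open>N \<Lambda>1 \<le> \<Lambda>2\<close>. Generators modulo \<open>N\<close>, \<open>x\<close> of \<open>L1\<close> and \<open>y\<close> of its inverse \<open>M1\<close>, give the lattices
  \<open>x \<Lambda>2 + N L1\<close> and \<open>y \<Lambda>2 + N M1\<close>. They are inverse to each other over \<open>\<Lambda>2\<close>, as \<open>x y\<close> is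
  congruent to \<open>1\<close> modulo \<open>N \<Lambda>1\<close>.
\<close>

lemma invl_lift:
  assumes o1: "is_order \<Lambda>1" and o2: "is_order \<Lambda>2" and le: "\<Lambda>2 \<le> \<Lambda>1" and L1: "invl \<Lambda>1 L1"
  shows "\<exists>L2. invl \<Lambda>2 L2 \<and> \<Lambda>1 * L2 = L1"
proof -
  have f1: "full B \<Lambda>1" and f2: "full B \<Lambda>2" using o1 o2 by (auto simp: is_order_def)
  have one: "1 \<in> elts \<Lambda>1" "1 \<in> elts \<Lambda>2" using o1 o2 by (auto simp: is_order_def)
  have idem: "\<Lambda>1 * \<Lambda>1 = \<Lambda>1" "\<Lambda>2 * \<Lambda>2 = \<Lambda>2" using o1 o2 order_idem by auto
  have "\<Lambda>1 * \<Lambda>2 \<le> \<Lambda>1" using zmod_mult_mono[OF order_refl le, of \<Lambda>1] idem by simp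
  then have \<Lambda>12: "\<Lambda>1 * \<Lambda>2 = \<Lambda>1" using le_order_mult[OF o2, of \<Lambda>1] by simp
  obtain M where M: "full B M" "L1 * M = \<Lambda>1" and fL1: "full B L1" and L1\<Lambda>: "L1 * \<Lambda>1 = L1"
    using L1 unfolding invl_def by blast
  define M1 where "M1 = M * \<Lambda>1"
  have M1: "full B M1" "L1 * M1 = \<Lambda>1" "M1 * \<Lambda>1 = M1"
    using M f1 full_times idem by (auto simp: M1_def mult.assoc[symmetric]) (simp add: mult.assoc idem)
  obtain N where N: "N > 0" "cyc (of_nat N) * \<Lambda>1 \<le> \<Lambda>2"
    using full_absorb_denominator[OF f2 f1] by blast
  define \<nu> :: "'a zmod" where "\<nu> = cyc (of_nat N)"
  have N': "\<nu> * \<Lambda>1 \<le> \<Lambda>2" "fg \<nu>" "\<nu> * \<nu> \<le> \<nu>"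
    using N(2) cyc_of_nat_le[of N \<nu>] by (auto simp: \<nu>_def fg_gen)
  have \<nu>_le: "\<nu> * X \<le> X" for X unfolding \<nu>_def by (rule cyc_of_nat_le)
  have \<nu>B: "elts \<nu> \<subseteq> B"
    using unit_of_nat[OF N(1)] unfolding unit_def \<nu>_def
    by (metis (no_types, lifting) cyc_le_iff ex_elts subspace_imp_zmod subspace_B less_eq_zmod_def)
  obtain x y where xy: "x \<in> elts L1" "y \<in> elts M1" "x * y - 1 \<in> elts (\<nu> * \<Lambda>1)"
    using invertible_principal_mod[OF order_fg[OF o1] _ one(1) N(1), of L1 M1] idem L1\<Lambda> M1
    unfolding \<nu>_def by auto
  have xL: "cyc x \<le> L1" and yM: "cyc y \<le> M1" using xy by (auto simp: cyc_le_iff)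
  define L2 where "L2 = cyc x * \<Lambda>2 + \<nu> * L1"
  define M2 where "M2 = cyc y * \<Lambda>2 + \<nu> * M1"
  have xB: "x \<in> B" and yB: "y \<in> B" using xy fL1 M1 unfolding full_def by blast+
  have cycB: "elts (cyc x) \<subseteq> B" "elts (cyc y) \<subseteq> B"
    using xL yM fL1 M1(1) unfolding full_def less_eq_zmod_def by blast+
  have sub: "elts \<Lambda>2 \<subseteq> B" "fg \<Lambda>2" using f2 by (auto simp: full_def)
  have full_\<nu>: "full B (\<nu> * X)" if "full B X" for X
    unfolding \<nu>_def using unit_of_nat[OF N(1)] that by (rule full_unit_mult)
  have fL2: "full B L2" unfolding L2_def add.commute[of "cyc x * \<Lambda>2"]
    using sub cycB by (intro full_plus full_\<nu> fL1 fg_times fg_gen mult_le_B) auto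
  have fM2: "full B M2" unfolding M2_def add.commute[of "cyc y * \<Lambda>2"]
    using sub cycB by (intro full_plus full_\<nu> M1(1) fg_times fg_gen mult_le_B) auto
  have L12: "L1 * \<Lambda>2 = L1" "M1 * \<Lambda>2 = M1"
    by (metis L1\<Lambda> \<Lambda>12 mult.assoc) (metis M1(3) \<Lambda>12 mult.assoc)
  have "L2 * M2 = cyc (x * y) * \<Lambda>2 + \<nu> * (cyc x * M1) + \<nu> * (cyc y * L1) + \<nu> * \<nu> * \<Lambda>1"
  proof -
    have "L2 * M2 = cyc x * cyc y * (\<Lambda>2 * \<Lambda>2) + \<nu> * (cyc x * (M1 * \<Lambda>2)) + \<nu> * (cyc y * (L1 * \<Lambda>2)) + \<nu> * \<nu> * (L1 * M1)"
      by (simp add: L2_def M2_def algebra_simps)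
    then show ?thesis by (simp add: idem L12 M1(2) cyc_mult)
  qed
  note prod = this
  have xM1: "cyc x * M1 \<le> \<Lambda>1" using zmod_mult_mono[OF xL order_refl, of M1] M1 by simp
  have yL1: "cyc y * L1 \<le> \<Lambda>1" using zmod_mult_mono[OF yM order_refl, of L1] M1 by (simp add: mult.commute)
  have xy1: "x * y \<in> elts \<Lambda>2"
    using xy(3) N'(1) one(2) zmod_leD elts_add by fastforce
  have "cyc (x * y) * \<Lambda>2 \<le> \<Lambda>2"
    using zmod_mult_mono[of "cyc (x * y)" \<Lambda>2 \<Lambda>2 \<Lambda>2] xy1 idem by (simp add: cyc_le_iff)
  moreover have "\<nu> * (cyc x * M1) \<le> \<Lambda>2" "\<nu> * (cyc y * L1) \<le> \<Lambda>2"
    using zmod_mult_mono[OF order_refl xM1, of \<nu>] zmod_mult_mono[OF order_refl yL1, of \<nu>] N'(1)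
    by (meson order_trans)+
  moreover have "\<nu> * \<nu> * \<Lambda>1 \<le> \<Lambda>2"
    using \<nu>_le[of "\<nu> * \<Lambda>1"] N'(1) by (simp add: mult.assoc)
  ultimately have LM_le: "L2 * M2 \<le> \<Lambda>2" unfolding prod by (simp add: zmod_add_le_iff)
  have "L2 * \<Lambda>2 = L2"
  proof -
    have "L2 * \<Lambda>2 = cyc x * (\<Lambda>2 * \<Lambda>2) + \<nu> * (L1 * \<Lambda>2)" by (simp add: L2_def algebra_simps)
    then show ?thesis by (simp add: idem L12 L2_def)
  qed
  note L2\<Lambda> = this
  \<comment> \<open>Since \<open>x y\<close> is congruent to \<open>1\<close>, the element \<open>x\<close> generates \<open>L1\<close> up to \<open>\<nu> * L1\<close>.\<close>
  have one_split: "\<Lambda>1 \<le> cyc x * M1 + \<nu> * \<Lambda>1"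
  proof -
    have "x * y \<in> elts (cyc x * M1)" using xy(2) by (auto simp: elts_cyc_mult)
    moreover have "1 = x * y + - (x * y - 1)" by simp
    ultimately have "1 \<in> elts (cyc x * M1 + \<nu> * \<Lambda>1)"
      using elts_uminus[OF xy(3)] unfolding elts_plus_iff by blast
    then have "1 * \<Lambda>1 \<le> (cyc x * M1 + \<nu> * \<Lambda>1) * \<Lambda>1"
      by (intro zmod_mult_mono order_refl) (simp add: one_le_iff)
    also have "\<dots> = cyc x * (M1 * \<Lambda>1) + \<nu> * (\<Lambda>1 * \<Lambda>1)" by (simp add: algebra_simps)
    finally show ?thesis by (simp add: M1 idem)
  qed
  have "1 \<in> elts (L2 * M2)"
  proof -
    have "\<nu> * \<Lambda>1 \<le> \<nu> * (cyc x * M1) + \<nu> * \<nu> * \<Lambda>1"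
      using zmod_mult_mono[OF order_refl one_split, of \<nu>] by (simp add: distrib_left mult.assoc)
    also have "\<dots> \<le> L2 * M2"
      unfolding prod by (simp add: zmod_add_le_iff) (simp add: zmod_le_addI1 zmod_le_addI2 zmod_le_add_trans1 zmod_le_add_trans2)
    finally have "x * y - 1 \<in> elts (L2 * M2)" using xy(3) zmod_leD by blast
    moreover have "x * y \<in> elts (L2 * M2)"
    proof -
      have "cyc (x * y) * \<Lambda>2 \<le> L2 * M2" unfolding prod by (simp add: zmod_le_addI1 zmod_le_add_trans1)
      moreover have "x * y * 1 \<in> elts (cyc (x * y) * \<Lambda>2)"
        unfolding elts_cyc_mult using one(2) by blast
      ultimately show ?thesis using zmod_leD by fastforce
    qed
    ultimately show ?thesis using elts_diff[of "x * y" _ "x * y - 1"] by simp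
  qed
  then have "\<Lambda>2 \<le> (L2 * M2) * \<Lambda>2"
    using zmod_mult_mono[of 1 "L2 * M2" \<Lambda>2 \<Lambda>2] by (simp add: one_le_iff)
  also have "\<dots> = L2 * M2" by (metis L2\<Lambda> mult.assoc mult.commute)
  finally have "L2 * M2 = \<Lambda>2" using LM_le by simp
  then have inv: "invl \<Lambda>2 L2" using fL2 fM2 L2\<Lambda> unfolding invl_def by blast
  have "\<Lambda>1 * L2 = cyc x * (\<Lambda>1 * \<Lambda>2) + \<nu> * (L1 * \<Lambda>1)" by (simp add: L2_def algebra_simps)
  then have eq: "\<Lambda>1 * L2 = cyc x * \<Lambda>1 + \<nu> * L1" by (simp add: \<Lambda>12 L1\<Lambda>)
  have "cyc x * \<Lambda>1 \<le> L1" using zmod_mult_mono[OF xL order_refl, of \<Lambda>1] L1\<Lambda> by simp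
  then have "\<Lambda>1 * L2 \<le> L1" unfolding eq using \<nu>_le by (simp add: zmod_add_le_iff)
  moreover have "L1 \<le> \<Lambda>1 * L2"
  proof -
    have "L1 \<le> L1 * (cyc x * M1 + \<nu> * \<Lambda>1)"
      using zmod_mult_mono[OF order_refl one_split, of L1] L1\<Lambda> by simp
    also have "\<dots> = cyc x * (L1 * M1) + \<nu> * (L1 * \<Lambda>1)" by (simp add: algebra_simps)
    finally show ?thesis by (simp add: eq M1 L1\<Lambda>)
  qed
  ultimately show ?thesis using inv by auto
qed

lemma order_mult_le:
  assumes "is_order \<Lambda>1" "is_order \<Lambda>2" "\<Lambda>2 \<le> \<Lambda>1"
  shows "\<Lambda>1 * \<Lambda>2 = \<Lambda>1"
  using zmod_mult_mono[OF order_refl assms(3), of \<Lambda>1] order_idem[OF assms(1)]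
    le_order_mult[OF assms(2), of \<Lambda>1] by simp

lemma invl_extend:
  assumes o1: "is_order \<Lambda>1" and o2: "is_order \<Lambda>2" and le: "\<Lambda>2 \<le> \<Lambda>1" and L: "invl \<Lambda>2 L"
  shows "invl \<Lambda>1 (\<Lambda>1 * L)"
proof -
  obtain K where K: "full B K" "L * K = \<Lambda>2" using L unfolding invl_def by blast
  have "\<Lambda>1 * L * (\<Lambda>1 * K) = \<Lambda>1 * \<Lambda>1 * (L * K)" by (simp only: mult.assoc mult.left_commute)
  then have "\<Lambda>1 * L * (\<Lambda>1 * K) = \<Lambda>1"
    using K(2) order_mult_le[OF o1 o2 le] order_idem[OF o1] by simp
  moreover have "\<Lambda>1 * L * \<Lambda>1 = \<Lambda>1 * L"
    using order_idem[OF o1] by (metis mult.assoc mult.commute)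
  moreover have "full B (\<Lambda>1 * L)" "full B (\<Lambda>1 * K)"
    using o1 K(1) L full_times unfolding is_order_def invl_def by blast+
  ultimately show ?thesis unfolding invl_def by blast
qed

lemma group_epi_lattice_groups:
  assumes o1: "is_order \<Lambda>1" and o2: "is_order \<Lambda>2" and le: "\<Lambda>2 \<le> \<Lambda>1"
  shows "group_epi (lattice_group \<Lambda>2) (lattice_group \<Lambda>1)
    (\<lambda>L. lat_mult (elts \<Lambda>1) L)"
proof (rule group_epi_sg_groupI[OF comm_semigrp_lattice_sg idempotent_lattice[OF o2]
      comm_semigrp_lattice_sg idempotent_lattice[OF o1]])
  show "lat_mult (elts \<Lambda>1) (sg_mult (lattice_sg scale B) X Y) =
      sg_mult (lattice_sg scale B) (lat_mult (elts \<Lambda>1) X) (lat_mult (elts \<Lambda>1) Y)"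
    if XY: "X \<in> carrier (lattice_group \<Lambda>2)"
      "Y \<in> carrier (lattice_group \<Lambda>2)" for X Y
  proof -
    obtain L K where LK: "X = elts L" "Y = elts K"
      using XY unfolding carrier_lattice_group[OF o2] by blast
    have "\<Lambda>1 * L * (\<Lambda>1 * K) = \<Lambda>1 * \<Lambda>1 * (L * K)" by (simp only: mult.assoc mult.left_commute)
    then show ?thesis unfolding LK using order_idem[OF o1] by (simp add: lattice_sg_simps lat_mult_elts)
  qed
  show "lat_mult (elts \<Lambda>1) ` carrier (lattice_group \<Lambda>2) =
    carrier (lattice_group \<Lambda>1)"
    unfolding carrier_lattice_group[OF o1] carrier_lattice_group[OF o2] image_image lat_mult_elts
    using invl_extend[OF assms] invl_lift[OF assms] by (force simp: image_iff)
qed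

lemma group_epi_eps_groups:
  assumes o1: "is_order \<Lambda>1" and o2: "is_order \<Lambda>2" and le: "\<Lambda>2 \<le> \<Lambda>1"
  shows "group_epi (class_group \<Lambda>2) (class_group \<Lambda>1)
    (eps_mult scale B (ecl \<Lambda>1))"
proof (rule group_epi_sg_groupI[OF comm_semigrp_eps_sg idempotent_eps[OF o2]
      comm_semigrp_eps_sg idempotent_eps[OF o1]])
  have f1: "full B \<Lambda>1" using o1 by (simp add: is_order_def)
  show "eps_mult scale B (ecl \<Lambda>1) (sg_mult (eps_sg scale B) X Y) =
      sg_mult (eps_sg scale B) (eps_mult scale B (ecl \<Lambda>1) X) (eps_mult scale B (ecl \<Lambda>1) Y)"
    if XY: "X \<in> carrier (class_group \<Lambda>2)"
      "Y \<in> carrier (class_group \<Lambda>2)" for X Y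
  proof -
    obtain L K where LK: "X = ecl L" "Y = ecl K" "full B L" "full B K"
      using XY unfolding carrier_eps_group[OF o2] invl_def by blast
    have "\<Lambda>1 * L * (\<Lambda>1 * K) = \<Lambda>1 * \<Lambda>1 * (L * K)" by (simp only: mult.assoc mult.left_commute)
    then show ?thesis unfolding LK using order_idem[OF o1] LK f1
      by (simp add: eps_sg_mult eps_mult_ecl full_times)
  qed
  have "eps_mult scale B (ecl \<Lambda>1) (ecl L) = ecl (\<Lambda>1 * L)" if "invl \<Lambda>2 L" for L
    using that f1 by (simp add: eps_mult_ecl invl_def)
  then have "eps_mult scale B (ecl \<Lambda>1) ` ecl ` {L. invl \<Lambda>2 L} = ecl ` (\<lambda>L. \<Lambda>1 * L) ` {L. invl \<Lambda>2 L}"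
    unfolding image_image by (intro image_cong) auto
  also have "(\<lambda>L. \<Lambda>1 * L) ` {L. invl \<Lambda>2 L} = {L. invl \<Lambda>1 L}"
    using invl_extend[OF assms] invl_lift[OF assms] by (force simp: image_iff)
  finally show "eps_mult scale B (ecl \<Lambda>1) ` carrier (class_group \<Lambda>2) =
    carrier (class_group \<Lambda>1)"
    unfolding carrier_eps_group[OF o1] carrier_eps_group[OF o2] .
qed

section \<open>Lattices with a given order\<close>

lemma order_of_elts: "order_of B (elts L) = {a \<in> B. cyc a * L \<le> L}"
  unfolding order_of_def lat_colon_def less_eq_zmod_def elts_cyc_mult ..

lemma order_of_eqD:
  assumes "order_of B (elts L) = elts \<Lambda>"
  shows "\<Lambda> * L \<le> L" and "elts K \<subseteq> B \<Longrightarrow> K * L \<le> L \<Longrightarrow> K \<le> \<Lambda>"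
proof -
  have *: "a \<in> elts \<Lambda> \<longleftrightarrow> a \<in> B \<and> (\<forall>l\<in>elts L. a * l \<in> elts L)" for a
    unfolding assms[symmetric] order_of_elts cyc_mult_le_iff by blast
  show "\<Lambda> * L \<le> L" using * by (auto simp: zmod_mult_le_iff)
  show "K \<le> \<Lambda>" if "elts K \<subseteq> B" "K * L \<le> L"
  proof (rule zmod_leI)
    fix x assume "x \<in> elts K"
    then show "x \<in> elts \<Lambda>"
      unfolding * using that(1) zmod_mult_mem[of x K _ L] zmod_leD[OF that(2)] by blast
  qed
qed

lemma order_of_absorb:
  assumes "is_order \<Lambda>" "order_of B (elts L) = elts \<Lambda>"
  shows "L * \<Lambda> = L"
  using order_of_eqD(1)[OF assms(2)] le_order_mult[OF assms(1), of L] by (simp add: mult.commute)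

lemma order_of_unit_mult: "unit a \<Longrightarrow> order_of B (elts (cyc a * L)) = order_of B (elts L)"
proof -
  have "cyc x * (cyc a * L) \<le> cyc a * L" if "cyc x * L \<le> L" for x a L
    using zmod_mult_mono[OF order_refl that, of "cyc a"] by (simp add: mult.left_commute)
  note 1 = this
  assume "unit a"
  then obtain b where b: "a * b = 1" unfolding unit_def by blast
  have "cyc b * (cyc a * L) = L" using cyc_cancel[OF b, of L "cyc a * L"] by simp
  then have "cyc x * (cyc a * L) \<le> cyc a * L \<longleftrightarrow> cyc x * L \<le> L" for x
    using 1[of x L a] 1[of x "cyc a * L" b] by auto
  then show ?thesis unfolding order_of_elts by simp
qed

lemma order_of_invl:
  assumes o: "is_order \<Lambda>" and L: "invl \<Lambda> L"
  shows "order_of B (elts L) = elts \<Lambda>"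
proof -
  obtain K where K: "L * K = \<Lambda>" "L * \<Lambda> = L" using L unfolding invl_def by blast
  have \<Lambda>: "elts \<Lambda> \<subseteq> B" "1 \<in> elts \<Lambda>" using o by (auto simp: is_order_def full_def)
  have "cyc a * L \<le> L \<longleftrightarrow> a \<in> elts \<Lambda>" for a
  proof
    assume "cyc a * L \<le> L"
    then have "cyc a * L * K \<le> L * K" by (intro zmod_mult_mono order_refl)
    then have "cyc a * \<Lambda> \<le> \<Lambda>" by (simp add: mult.assoc K)
    then have "a * 1 \<in> elts \<Lambda>" using \<Lambda>(2) unfolding cyc_mult_le_iff by blast
    then show "a \<in> elts \<Lambda>" by simp
  next
    assume "a \<in> elts \<Lambda>"
    then have "cyc a * L \<le> \<Lambda> * L" by (intro zmod_mult_mono order_refl) (simp add: cyc_le_iff)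
    then show "cyc a * L \<le> L" using K(2) by (simp add: mult.commute)
  qed
  then show ?thesis unfolding order_of_elts using \<Lambda> by auto
qed

text \<open>
  Cancellation. The ideal \<open>I = X Y \<Lambda>\<close> of the order \<open>\<Lambda>\<close> of \<open>L\<close> satisfies \<open>I L = L\<close>. By
  Nakayama's lemma some \<open>1 - i\<close> with \<open>i \<in> I\<close> kills \<open>L\<close>, which contains a positive integer, so
  \<open>1 \<in> I\<close> and \<open>I = \<Lambda>\<close>.
\<close>

lemma invl_if_absorbs:
  assumes o: "is_order \<Lambda>" and ord: "order_of B (elts L) = elts \<Lambda>" and L: "full B L"
    and X: "full B X" and Y: "full B Y" and LXY: "L * (X * Y) = L"
  shows "invl \<Lambda> (X * \<Lambda>)"
proof -
  note absorb = order_of_absorb[OF o ord]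
  have "X * Y * L \<le> L" using LXY by (simp add: mult.commute)
  moreover have "elts (X * Y) \<subseteq> B" using full_times[OF X Y] by (simp add: full_def)
  ultimately have XY: "X * Y \<le> \<Lambda>" using order_of_eqD(2)[OF ord] by blast
  define I where "I = X * Y * \<Lambda>"
  have I_le: "I \<le> \<Lambda>" using zmod_mult_mono[OF XY order_refl, of \<Lambda>] order_idem[OF o] by (simp add: I_def)
  have I\<Lambda>: "I * \<Lambda> = I" using order_idem[OF o] by (simp add: I_def mult.assoc)
  have II: "I * I \<le> I" using zmod_mult_mono[OF order_refl I_le, of I] I\<Lambda> by simp
  have "I * L = L"
  proof -
    have "I * L = L * (X * Y) * \<Lambda>" by (simp add: I_def mult_ac)
    then show ?thesis using LXY absorb by simp
  qed
  then obtain i where i: "i \<in> elts I" "\<forall>l\<in>elts L. (1 - i) * l = 0"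
    using nakayama[of L I] L II unfolding full_def by auto
  obtain N where N: "N > 0" "of_nat N * 1 \<in> elts L" using L one_B unfolding full_def by blast
  then have "of_nat N * (1 - i) = 0" using i(2) by (simp add: mult.commute)
  then have "i = 1" using torsion_free[OF _ N(1)] by fastforce
  then have "1 * \<Lambda> \<le> I * \<Lambda>" using i(1) by (intro zmod_mult_mono order_refl) (simp add: one_le_iff)
  then have "I = \<Lambda>" using I_le I\<Lambda> by simp
  then have "X * \<Lambda> * Y = \<Lambda>" by (simp add: I_def mult_ac)
  moreover have "X * \<Lambda> * \<Lambda> = X * \<Lambda>" using order_idem[OF o] by (simp add: mult.assoc)
  moreover have "full B (X * \<Lambda>)" using X o full_times by (simp add: is_order_def)
  ultimately show ?thesis using Y unfolding invl_def by blast
qed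

lemma classes_with_order_iff:
  "C \<in> eps_classes_with_order scale B (elts \<Lambda>) \<longleftrightarrow>
    (\<exists>L. C = ecl L \<and> full B L \<and> order_of B (elts L) = elts \<Lambda>)"
  unfolding eps_classes_with_order_def ecl_def by (auto simp: full_lattices_iff[OF subspace_B])

text \<open>
  If \<open>M = L X\<close> and \<open>L = M Y\<close> up to units, then \<open>X Y\<close> fixes \<open>L\<close> up to a unit, so \<open>X \<Lambda>\<close> is invertible
  by cancellation, and \<open>M = L (X \<Lambda>)\<close>.
\<close>

lemma w_rel_eps_iff:
  assumes L: "full B L" and C: "C \<in> sg_carrier (eps_sg scale B)"
    and o: "is_order \<Lambda>" and ord: "order_of B (elts L) = elts \<Lambda>"
  shows "(ecl L, C) \<in> w_rel (eps_sg scale B) \<longleftrightarrow> (\<exists>P. invl \<Lambda> P \<and> C = ecl (L * P))"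
proof
  obtain M where M: "C = ecl M" "full B M" using C unfolding eps_sg_carrier by blast
  note absorb = order_of_absorb[OF o ord]
  assume "(ecl L, C) \<in> w_rel (eps_sg scale B)"
  then consider "ecl L = C" | X Y where "full B X" "full B Y"
      "sg_mult (eps_sg scale B) (ecl L) (ecl X) = C" "sg_mult (eps_sg scale B) C (ecl Y) = ecl L"
    unfolding w_rel_def eps_sg_carrier by blast
  then show "\<exists>P. invl \<Lambda> P \<and> C = ecl (L * P)"
  proof cases
    case 1
    then show ?thesis using invl_order[OF o] absorb by metis
  next
    case 2
    then have eq: "ecl (L * X) = ecl M" "ecl (M * Y) = ecl L"
      using L M eps_sg_mult by simp_all
    obtain a where a: "unit a" "M = cyc a * (L * X)"
      using eq(1) ecl_eq_iff[OF full_times[OF L 2(1)] M(2)] by blast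
    obtain b where b: "unit b" "L = cyc b * (M * Y)"
      using eq(2) ecl_eq_iff[OF full_times[OF M(2) 2(2)] L] by blast
    have "L * ((cyc a * X) * (cyc b * Y)) = cyc b * ((cyc a * (L * X)) * Y)" by (simp add: mult_ac)
    also have "\<dots> = L" by (simp only: a(2)[symmetric] b(2)[symmetric])
    finally have "L * ((cyc a * X) * (cyc b * Y)) = L" .
    then have "invl \<Lambda> (cyc a * X * \<Lambda>)"
      using invl_if_absorbs[OF o ord L] full_unit_mult a(1) b(1) 2(1,2) by blast
    moreover have "L * (cyc a * X * \<Lambda>) = cyc a * ((L * \<Lambda>) * X)" by (simp add: mult_ac)
    then have "L * (cyc a * X * \<Lambda>) = M" using absorb a(2) by simp
    ultimately show ?thesis using M(1) by metis
  qed
next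
  assume "\<exists>P. invl \<Lambda> P \<and> C = ecl (L * P)"
  then obtain P Q where P: "full B P" "C = ecl (L * P)" "full B Q" "P * Q = \<Lambda>"
    unfolding invl_def by blast
  have "L * P * Q = L" using order_of_absorb[OF o ord] P(4) by (simp add: mult.assoc)
  then have "sg_mult (eps_sg scale B) (ecl L) (ecl P) = C" "sg_mult (eps_sg scale B) C (ecl Q) = ecl L"
    using P L full_times eps_sg_mult by auto
  then show "(ecl L, C) \<in> w_rel (eps_sg scale B)"
    unfolding w_rel_def eps_sg_carrier using P L C[unfolded eps_sg_carrier] by blast
qed

lemma order_of_mult_invl:
  assumes o: "is_order \<Lambda>" and ord: "order_of B (elts L) = elts \<Lambda>" and P: "invl \<Lambda> P"
  shows "order_of B (elts (L * P)) = elts \<Lambda>"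
proof -
  obtain Q where Q: "P * Q = \<Lambda>" using P unfolding invl_def by blast
  have LPQ: "L * P * Q = L" using order_of_absorb[OF o ord] Q by (simp add: mult.assoc)
  have "cyc a * (L * P) \<le> L * P" if "cyc a * L \<le> L" for a
    using zmod_mult_mono[OF that order_refl, of P] by (simp add: mult.assoc)
  moreover have "cyc a * L \<le> L" if "cyc a * (L * P) \<le> L * P" for a
    using zmod_mult_mono[OF that order_refl, of Q] LPQ by (simp add: mult.assoc)
  ultimately show ?thesis using ord unfolding order_of_elts by blast
qed

text \<open>
  The group of invertible classes acts freely on the classes with order \<open>\<Lambda>\<close>: if \<open>L P\<close> and \<open>L Q\<close>
  are equal up to a unit, then so are \<open>P\<close> and \<open>Q\<close>, because \<open>P Q\<^sup>-\<^sup>1\<close> and \<open>Q P\<^sup>-\<^sup>1\<close>, suitably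
  scaled, fix \<open>L\<close> and therefore lie in \<open>\<Lambda>\<close>.
\<close>

lemma w_class_bij:
  assumes o: "is_order \<Lambda>" and L: "full B L" and ord: "order_of B (elts L) = elts \<Lambda>"
  shows "bij_betw (\<lambda>C. eps_mult scale B (ecl L) C)
    (carrier (class_group \<Lambda>)) (w_rel (eps_sg scale B) `` {ecl L})"
proof -
  have mult: "eps_mult scale B (ecl L) (ecl P) = ecl (L * P)" if "invl \<Lambda> P" for P
    using that L eps_mult_ecl unfolding invl_def by blast
  have img: "w_rel (eps_sg scale B) `` {ecl L} = {ecl (L * P) | P. invl \<Lambda> P}"
  proof -
    have "C \<in> sg_carrier (eps_sg scale B)" if "(ecl L, C) \<in> w_rel (eps_sg scale B)" for C
      using that by (auto simp: w_rel_def)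
    moreover have "ecl (L * P) \<in> sg_carrier (eps_sg scale B)" if "invl \<Lambda> P" for P
      using that L full_times unfolding eps_sg_carrier invl_def by blast
    ultimately show ?thesis using w_rel_eps_iff[OF L _ o ord] by blast
  qed
  have "inj_on (\<lambda>C. eps_mult scale B (ecl L) C) (ecl ` {P. invl \<Lambda> P})"
  proof (rule inj_onI; clarsimp)
    fix P Q assume P: "invl \<Lambda> P" and Q: "invl \<Lambda> Q"
      and eq: "eps_mult scale B (ecl L) (ecl P) = eps_mult scale B (ecl L) (ecl Q)"
    have fP: "full B P" "full B Q" using P Q unfolding invl_def by blast+
    obtain P' where P': "P * P' = \<Lambda>" "full B P'" using P unfolding invl_def by blast
    obtain Q' where Q': "Q * Q' = \<Lambda>" "full B Q'" using Q unfolding invl_def by blast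
    have "ecl (L * P) = ecl (L * Q)" using eq mult P Q by simp
    then obtain a where a: "unit a" "L * Q = cyc a * (L * P)"
      using ecl_eq_iff full_times L fP by blast
    obtain b where b: "unit b" "a * b = 1" using a(1) unit_inverse by blast
    note absorb = order_of_absorb[OF o ord]
    have fixed: "L * (cyc a * (P * Q')) = L"
    proof -
      have "L * (cyc a * (P * Q')) = cyc a * (L * P) * Q'" by (simp add: mult_ac)
      also have "\<dots> = L * (Q * Q')" by (simp add: a(2)[symmetric] mult.assoc)
      finally show ?thesis using Q' absorb by simp
    qed
    have fixed': "L * (cyc b * (Q * P')) = L"
    proof -
      have "L * P = cyc b * (L * Q)" using cyc_cancel[OF b(2)] a(2) by metis
      then have "L * (cyc b * (Q * P')) = L * P * P'" by (simp add: mult_ac)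
      then show ?thesis using P' absorb by (simp add: mult.assoc)
    qed
    have "cyc a * (P * Q') \<le> \<Lambda>"
      using order_of_eqD(2)[OF ord, of "cyc a * (P * Q')"] fixed
        full_unit_mult[OF a(1) full_times[OF fP(1) Q'(2)]] by (simp add: full_def mult.commute)
    then have "cyc a * (P * Q') * Q \<le> \<Lambda> * Q" by (intro zmod_mult_mono order_refl)
    moreover have "cyc a * (P * Q') * Q = cyc a * (P * (Q * Q'))" by (simp add: mult_ac)
    ultimately have 1: "cyc a * P \<le> Q"
      using Q' P Q unfolding invl_def by (simp add: mult.commute)
    have "cyc b * (Q * P') \<le> \<Lambda>"
      using order_of_eqD(2)[OF ord, of "cyc b * (Q * P')"] fixed'
        full_unit_mult[OF b(1) full_times[OF fP(2) P'(2)]] by (simp add: full_def mult.commute)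
    then have "cyc b * (Q * P') * P \<le> \<Lambda> * P" by (intro zmod_mult_mono order_refl)
    moreover have "cyc b * (Q * P') * P = cyc b * (Q * (P * P'))" by (simp add: mult_ac)
    ultimately have "cyc b * Q \<le> P"
      using P' P Q unfolding invl_def by (simp add: mult.commute)
    then have "cyc a * (cyc b * Q) \<le> cyc a * P" by (intro zmod_mult_mono order_refl)
    then have "Q \<le> cyc a * P" using b(2) by (simp add: mult.assoc[symmetric] cyc_mult)
    then have "Q = cyc a * P" using 1 by simp
    then show "ecl P = ecl Q" using ecl_eq_iff fP a(1) by blast
  qed
  moreover have "(\<lambda>C. eps_mult scale B (ecl L) C) ` ecl ` {P. invl \<Lambda> P} = w_rel (eps_sg scale B) `` {ecl L}"
    unfolding img image_image using mult by (auto simp: image_iff)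
  ultimately show ?thesis unfolding carrier_eps_group[OF o] bij_betw_def by blast
qed

lemma w_classes:
  assumes o: "is_order \<Lambda>" and fin: "finite (eps_classes_with_order scale B (elts \<Lambda>))"
  defines "X \<equiv> eps_classes_with_order scale B (elts \<Lambda>)"
  defines "W \<equiv> X // w_rel (eps_sg scale B)"
  shows "\<Union>W = X" "finite W" "\<forall>C\<in>W. finite C" "\<forall>C\<in>W. \<forall>D\<in>W. card C = card D"
    "carrier (class_group \<Lambda>) \<in> W"
proof -
  have sub: "w_rel (eps_sg scale B) `` {ecl L} \<subseteq> X"
    if L: "full B L" "order_of B (elts L) = elts \<Lambda>" for L
  proof
    fix C assume C: "C \<in> w_rel (eps_sg scale B) `` {ecl L}"
    then have "C \<in> sg_carrier (eps_sg scale B)" by (auto simp: w_rel_def)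
    then obtain P where "invl \<Lambda> P" "C = ecl (L * P)"
      using C w_rel_eps_iff[OF L(1) _ o L(2)] by blast
    moreover from this have "full B (L * P)" using L full_times unfolding invl_def by blast
    ultimately show "C \<in> X"
      unfolding X_def classes_with_order_iff using order_of_mult_invl[OF o L(2)] by blast
  qed
  have W: "\<exists>L. full B L \<and> order_of B (elts L) = elts \<Lambda> \<and> C = w_rel (eps_sg scale B) `` {ecl L}"
    if C: "C \<in> W" for C
  proof -
    obtain x where "x \<in> X" "C = w_rel (eps_sg scale B) `` {x}"
      using C unfolding W_def by (rule quotientE)
    then show ?thesis unfolding X_def classes_with_order_iff by blast
  qed
  have W_sub: "C \<subseteq> X" if "C \<in> W" for C using W[OF that] sub by blast
  have self: "C \<in> w_rel (eps_sg scale B) `` {C}" if "C \<in> X" for C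
    using that unfolding w_rel_def eps_sg_carrier X_def classes_with_order_iff by blast
  show "\<Union>W = X"
  proof
    show "\<Union>W \<subseteq> X" using W_sub by blast
    show "X \<subseteq> \<Union>W" using self unfolding W_def quotient_def by blast
  qed
  have finX: "finite X" using fin by (simp add: X_def)
  have "W \<subseteq> Pow X" using W_sub by blast
  then show "finite W" using finX finite_subset by blast
  show "\<forall>C\<in>W. finite C" using W_sub finX finite_subset by blast
  have "card C = card (carrier (class_group \<Lambda>))" if "C \<in> W" for C
    using W[OF that] bij_betw_same_card[OF w_class_bij[OF o]] by metis
  then show "\<forall>C\<in>W. \<forall>D\<in>W. card C = card D" by simp
  have f: "full B \<Lambda>" using o by (simp add: is_order_def)
  have ord: "order_of B (elts \<Lambda>) = elts \<Lambda>" using order_of_invl[OF o invl_order[OF o]] .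
  have "w_rel (eps_sg scale B) `` {ecl \<Lambda>} =
      (\<lambda>C. eps_mult scale B (ecl \<Lambda>) C) ` carrier (class_group \<Lambda>)"
    using w_class_bij[OF o f ord] by (simp add: bij_betw_def)
  also have "\<dots> = (\<lambda>C. C) ` carrier (class_group \<Lambda>)"
  proof (rule image_cong)
    fix C assume "C \<in> carrier (class_group \<Lambda>)"
    then obtain L where "C = ecl L" "full B L" "L * \<Lambda> = L"
      unfolding carrier_eps_group[OF o] invl_def by blast
    then show "eps_mult scale B (ecl \<Lambda>) C = C" using f by (simp add: eps_mult_ecl mult.commute)
  qed simp
  finally have "carrier (class_group \<Lambda>) = w_rel (eps_sg scale B) `` {ecl \<Lambda>}" by simp
  moreover have "ecl \<Lambda> \<in> X" unfolding X_def classes_with_order_iff using f ord by blast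
  ultimately show "carrier (class_group \<Lambda>) \<in> W"
    unfolding W_def quotient_def by blast
qed

end

section \<open>Finiteness of the class number\<close>

context fin_dim_rat_algebra
begin

definition coord_bounded :: "'a set \<Rightarrow> rat \<Rightarrow> 'a \<Rightarrow> bool" where
  "coord_bounded X H x \<longleftrightarrow> (\<forall>w\<in>X. \<bar>representation X x w\<bar> \<le> H)"

lemma coord_bounded_add:
  assumes "independent X" "x \<in> span X" "y \<in> span X" "coord_bounded X H x" "coord_bounded X H' y"
  shows "coord_bounded X (H + H') (x + y)"
  unfolding coord_bounded_def
proof
  fix w assume w: "w \<in> X"
  have "representation X (x + y) w = representation X x w + representation X y w"
    using representation_add[OF assms(1,3,2)] representation_add[OF assms(1,2,3)]
    by (metis add.commute)
  then show "\<bar>representation X (x + y) w\<bar> \<le> H + H'"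
    using assms(4,5) w abs_triangle_ineq[of "representation X x w" "representation X y w"]
    unfolding coord_bounded_def by fastforce
qed

lemma coord_bounded_ex:
  assumes "finite X" "finite A"
  obtains H :: nat where "\<And>x. x \<in> A \<Longrightarrow> coord_bounded X (of_nat H) x"
proof -
  define S where "S = (\<lambda>(x, w). \<bar>representation X x w\<bar>) ` (A \<times> X)"
  have fin: "finite S" using assms by (simp add: S_def)
  obtain H :: nat where H: "Max (insert 0 S) \<le> of_nat H" using real_arch_simple by blast
  have "\<bar>representation X x w\<bar> \<le> of_nat H" if "x \<in> A" "w \<in> X" for x w
  proof -
    have "\<bar>representation X x w\<bar> \<in> S" using that by (auto simp: S_def)
    then have "\<bar>representation X x w\<bar> \<le> Max (insert 0 S)" using fin by simp
    then show ?thesis using H by simp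
  qed
  then show thesis using that unfolding coord_bounded_def by blast
qed

text \<open>
  Multiplication is bilinear, so it multiplies bounds on coordinates up to a constant.
\<close>

lemma coord_bounded_mult:
  assumes X: "finite X" "independent X" and mult: "\<And>x y. x \<in> span X \<Longrightarrow> y \<in> span X \<Longrightarrow> x * y \<in> span X"
    and c: "\<And>u v. u \<in> X \<Longrightarrow> v \<in> X \<Longrightarrow> coord_bounded X c (u * v)"
    and x: "x \<in> span X" "coord_bounded X H x" and y: "y \<in> span X" "coord_bounded X H' y"
    and nonneg: "H \<ge> 0" "H' \<ge> 0"
  shows "coord_bounded X (of_nat (card X) ^ 2 * c * H * H') (x * y)"
  unfolding coord_bounded_def
proof
  fix w assume w: "w \<in> X"
  let ?r = "representation X"
  have uv: "u * v \<in> span X" if "u \<in> X" "v \<in> X" for u v using that by (intro mult span_base)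
  have "x * y = (\<Sum>u\<in>X. scale (?r x u) u) * (\<Sum>v\<in>X. scale (?r y v) v)"
    using sum_representation_eq[OF X(2) x(1) X(1) order_refl]
      sum_representation_eq[OF X(2) y(1) X(1) order_refl] by simp
  also have "\<dots> = (\<Sum>u\<in>X. \<Sum>v\<in>X. scale (?r x u * ?r y v) (u * v))"
    by (simp add: sum_product scale_mult_left scale_mult_right mult.commute[of "representation X y _"])
  finally have "?r (x * y) w = ?r (\<Sum>u\<in>X. \<Sum>v\<in>X. scale (?r x u * ?r y v) (u * v)) w" by simp
  also have "\<dots> = (\<Sum>u\<in>X. \<Sum>v\<in>X. ?r x u * ?r y v * ?r (u * v) w)"
    using uv by (simp add: representation_sum[OF X(2)] representation_scale[OF X(2)] span_sum span_scale)
  also have "\<bar>\<dots>\<bar> \<le> (\<Sum>u\<in>X. \<Sum>v\<in>X. H * H' * c)"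
  proof (rule order_trans[OF sum_abs sum_mono], rule order_trans[OF sum_abs sum_mono])
    fix u v assume uv: "u \<in> X" "v \<in> X"
    have "\<bar>?r x u\<bar> \<le> H" "\<bar>?r y v\<bar> \<le> H'" "\<bar>?r (u * v) w\<bar> \<le> c"
      using x(2) y(2) c[OF uv] uv w by (auto simp: coord_bounded_def)
    then show "\<bar>?r x u * ?r y v * ?r (u * v) w\<bar> \<le> H * H' * c"
      unfolding abs_mult using nonneg by (intro mult_mono) auto
  qed
  also have "\<dots> = of_nat (card X) ^ 2 * c * H * H'"
    by (simp add: power2_eq_square mult_ac)
  finally show "\<bar>?r (x * y) w\<bar> \<le> of_nat (card X) ^ 2 * c * H * H'" .
qed

lemma representation_int_span:
  assumes X: "independent X" and x: "x \<in> int_span X"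
  shows "representation X x w \<in> \<int>"
proof -
  have "x \<in> span X \<and> representation X x w \<in> \<int>"
    using x
  proof (induction rule: zmodule.span_induct_alt)
    case base
    then show ?case by (simp add: representation_zero span_zero)
  next
    case (step c z y)
    have z: "z \<in> span X" using step by (intro span_base)
    have y: "y \<in> span X" using step by blast
    moreover have cz: "of_int c * z \<in> span X" using span_scale[OF z, of "of_int c"] by (simp add: scale_of_int)
    ultimately have "representation X (of_int c * z + y) w
        = representation X (of_int c * z) w + representation X y w"
      using representation_add[OF X, of y "of_int c * z"] representation_add[OF X, of "of_int c * z" y]
      by (metis add.commute)
    moreover have "representation X (of_int c * z) w = of_int c * representation X z w"
      using representation_scale[OF X z, of "of_int c"] by (simp add: scale_of_int)
    moreover have "representation X z w \<in> \<int>"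
      using representation_basis[OF X step.hyps(1)] by simp
    ultimately show ?case using step.IH span_add[OF cz y] by simp
  qed
  then show ?thesis by blast
qed

lemma card_coord_bounded:
  assumes X: "finite X" "independent X"
  shows "finite {x \<in> int_span X. coord_bounded X (of_nat H) x}"
    and "card {x \<in> int_span X. coord_bounded X (of_nat H) x} \<le> (2 * H + 1) ^ card X"
proof -
  let ?S = "{x \<in> int_span X. coord_bounded X (of_nat H) x}"
  define \<phi> where "\<phi> x = (\<lambda>w\<in>X. \<lfloor>representation X x w\<rfloor>)" for x
  have \<phi>: "representation X x w = of_int (\<phi> x w)" if "x \<in> ?S" "w \<in> X" for x w
    using representation_int_span[OF X(2), of x w] that by (auto simp: \<phi>_def Ints_def)
  have inj: "inj_on \<phi> ?S"
  proof (rule inj_onI)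
    fix x y assume x: "x \<in> ?S" and y: "y \<in> ?S" and eq: "\<phi> x = \<phi> y"
    have "x \<in> span X" "y \<in> span X" using x y int_span_subset_span by blast+
    note expand = this[THEN sum_representation_eq[OF X(2) _ X(1) order_refl]]
    have "x = (\<Sum>w\<in>X. scale (representation X x w) w)" by (rule expand(1)[symmetric])
    also have "\<dots> = (\<Sum>w\<in>X. scale (representation X y w) w)"
      using \<phi>[OF x] \<phi>[OF y] eq by (intro sum.cong) auto
    also have "\<dots> = y" by (rule expand(2))
    finally show "x = y" .
  qed
  have "\<phi> x \<in> (\<Pi>\<^sub>E w\<in>X. {- int H..int H})" if x: "x \<in> ?S" for x
  proof
    fix w assume w: "w \<in> X"
    have "\<bar>of_int (\<phi> x w)\<bar> \<le> (of_nat H :: rat)"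
      using \<phi>[OF x w] x w by (auto simp: coord_bounded_def)
    then have "\<bar>\<phi> x w\<bar> \<le> int H"
      by (metis of_int_abs of_int_le_iff of_int_of_nat_eq)
    then show "\<phi> x w \<in> {- int H..int H}" by auto
  qed (simp add: \<phi>_def)
  then have sub: "\<phi> ` ?S \<subseteq> (\<Pi>\<^sub>E w\<in>X. {- int H..int H})" by blast
  have fin: "finite (\<Pi>\<^sub>E w\<in>X. {- int H..int H})" using X by (intro finite_PiE) auto
  show "finite ?S" using finite_subset[OF sub fin] inj finite_imageD by blast
  have "card ?S \<le> card (\<Pi>\<^sub>E w\<in>X. {- int H..int H})"
    using card_inj_on_le[OF inj sub fin] .
  also have "\<dots> = (2 * H + 1) ^ card X"
    using X by (simp add: card_PiE nat_add_distrib nat_mult_distrib algebra_simps)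
  finally show "card ?S \<le> (2 * H + 1) ^ card X" .
qed

definition box :: "'a set \<Rightarrow> nat \<Rightarrow> 'a set" where
  "box X S = (\<lambda>a. \<Sum>w\<in>X. of_nat (a w) * w) ` (\<Pi>\<^sub>E w\<in>X. {..S})"

lemma box_int_span: "box X S \<subseteq> int_span X"
  unfolding box_def elts_gen[symmetric]
  by (auto intro!: elts_sum elts_of_nat_mult[OF gen_base])

lemma representation_combination:
  assumes X: "finite X" "independent X" and w: "w \<in> X"
  shows "representation X (\<Sum>v\<in>X. of_int (a v) * v) w = of_int (a w)"
proof -
  have "representation X (\<Sum>v\<in>X. scale (of_int (a v)) v) w = (\<Sum>v\<in>X. of_int (a v) * representation X v w)"
    by (simp add: representation_sum[OF X(2)] representation_scale[OF X(2)] span_scale span_base)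
  also have "\<dots> = (\<Sum>v\<in>X. if v = w then of_int (a w) else 0)"
    by (intro sum.cong) (auto simp: representation_basis[OF X(2)])
  also have "\<dots> = of_int (a w)" using X(1) w by simp
  finally show ?thesis by (simp add: scale_of_int)
qed

lemma card_box:
  assumes X: "finite X" "independent X"
  shows "finite (box X S)" "card (box X S) = (S + 1) ^ card X"
proof -
  have fin: "finite (\<Pi>\<^sub>E w\<in>X. {..S})" using X by (intro finite_PiE) auto
  then show "finite (box X S)" by (simp add: box_def)
  have "inj_on (\<lambda>a. \<Sum>w\<in>X. of_nat (a w) * w) (\<Pi>\<^sub>E w\<in>X. {..S})"
  proof (rule inj_onI)
    fix a b assume ab: "a \<in> (\<Pi>\<^sub>E w\<in>X. {..S})" "b \<in> (\<Pi>\<^sub>E w\<in>X. {..S})"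
      and eq: "(\<Sum>w\<in>X. of_nat (a w) * w) = (\<Sum>w\<in>X. of_nat (b w) * w)"
    have "a w = b w" if "w \<in> X" for w
    proof -
      have "(of_int (int (a w)) :: rat) = of_int (int (b w))"
        using representation_combination[OF X that, of "\<lambda>w. int (a w)"]
          representation_combination[OF X that, of "\<lambda>w. int (b w)"] eq by simp
      then show ?thesis by simp
    qed
    then show "a = b" using ab by (intro PiE_ext)
  qed
  then show "card (box X S) = (S + 1) ^ card X"
    using X by (simp add: box_def card_image card_PiE)
qed

lemma box_diff_bounded:
  assumes X: "finite X" "independent X" and b: "b \<in> box X S" "b' \<in> box X S"
  shows "coord_bounded X (of_nat S) (b - b')"
proof -
  obtain a a' where a: "a \<in> (\<Pi>\<^sub>E w\<in>X. {..S})" "b = (\<Sum>w\<in>X. of_nat (a w) * w)"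
    and a': "a' \<in> (\<Pi>\<^sub>E w\<in>X. {..S})" "b' = (\<Sum>w\<in>X. of_nat (a' w) * w)"
    using b by (auto simp: box_def)
  have eq: "b - b' = (\<Sum>w\<in>X. of_int (int (a w) - int (a' w)) * w)"
    by (simp add: a a' sum_subtractf left_diff_distrib)
  show ?thesis
    unfolding coord_bounded_def
  proof
    fix w assume w: "w \<in> X"
    have "\<bar>int (a w) - int (a' w)\<bar> \<le> int S" using a(1) a'(1) w by (force simp: PiE_iff)
    then have "\<bar>of_int (int (a w) - int (a' w))\<bar> \<le> (of_nat S :: rat)"
      by (metis of_int_abs of_int_le_iff of_int_of_nat_eq)
    then show "\<bar>representation X (b - b') w\<bar> \<le> of_nat S"
      unfolding eq representation_combination[OF X w] .
  qed
qed

lemma zero_in_box: "finite X \<Longrightarrow> 0 \<in> box X S"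
  unfolding box_def by (rule image_eqI[of _ _ "\<lambda>w\<in>X. 0"]) auto

lemma box_bounded:
  assumes "finite X" "independent X" "b \<in> box X S"
  shows "coord_bounded X (of_nat S) b"
  using box_diff_bounded[OF assms zero_in_box[OF assms(1)]] by simp

definition incongruent :: "'a zmod \<Rightarrow> 'a set \<Rightarrow> bool" where
  "incongruent P A \<longleftrightarrow> (\<forall>a\<in>A. \<forall>b\<in>A. a - b \<in> elts P \<longrightarrow> a = b)"

lemma incongruent_card_bound:
  assumes "fg O1" "N > 0" "cyc (of_nat N) * O1 \<le> P"
  obtains m where "\<And>A. A \<subseteq> elts O1 \<Longrightarrow> incongruent P A \<Longrightarrow> finite A \<and> card A \<le> m"
proof -
  obtain R where R: "finite R" "\<And>x. x \<in> elts O1 \<Longrightarrow> \<exists>r\<in>R. x - r \<in> elts (cyc (of_nat N) * O1)"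
    using finite_representatives[OF assms(1,2)] by blast
  obtain r where r: "\<And>x. x \<in> elts O1 \<Longrightarrow> r x \<in> R \<and> x - r x \<in> elts P"
    using R(2) zmod_leD[OF assms(3)] by meson
  have "finite A \<and> card A \<le> card R" if A: "A \<subseteq> elts O1" "incongruent P A" for A
  proof -
    have inj: "inj_on r A"
    proof (rule inj_onI)
      fix x y assume xy: "x \<in> A" "y \<in> A" "r x = r y"
      then have "x - r x \<in> elts P" "y - r y \<in> elts P" using r A(1) by blast+
      from elts_diff[OF this] have "x - y \<in> elts P" using xy(3) by simp
      then show "x = y" using xy A(2) unfolding incongruent_def by blast
    qed
    have "r ` A \<subseteq> R" using r A(1) by blast
    then show ?thesis using inj R(1) by (meson card_inj_on_le finite_imageD finite_subset)
  qed
  then show thesis using that by blast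
qed

text \<open>
  The integer part of the \<open>n\<close>-th root of \<open>m\<close>.
\<close>

lemma power_sandwich:
  assumes "m \<ge> 1" "n \<ge> 1"
  obtains T :: nat where "T \<ge> 1" "T ^ n \<le> m" "m < (T + 1) ^ n"
proof -
  define T where "T = (GREATEST t. t ^ n \<le> m)"
  have bound: "t \<le> m" if "t ^ n \<le> m" for t
    using that assms(2) self_le_power[of t n] by (cases "t = 0") auto
  have ex: "1 ^ n \<le> m" using assms by simp
  have T: "T ^ n \<le> m" unfolding T_def by (rule GreatestI_nat[of "\<lambda>t. t ^ n \<le> m", OF ex]) (use bound in auto)
  have "T \<ge> 1" unfolding T_def by (rule Greatest_le_nat[of "\<lambda>t. t ^ n \<le> m", OF ex]) (use bound in auto)
  moreover have "\<not> (T + 1) ^ n \<le> m"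
  proof
    assume "(T + 1) ^ n \<le> m"
    then have "T + 1 \<le> T" unfolding T_def by (rule Greatest_le_nat) (use bound in auto)
    then show False by simp
  qed
  ultimately show thesis using that T by simp
qed

text \<open>
  Two applications of the pigeonhole principle bound the index of a principal submodule by a
  constant that does not depend on \<open>P\<close>. Write \<open>O\<close> for the integer span of the basis \<open>X\<close>, let
  \<open>m0\<close> be the index of \<open>P\<close> in \<open>O\<close>, and let \<open>T\<^sup>n \<le> m0 < (T + 1)\<^sup>n\<close>. The box of elements of \<open>O\<close>
  with coordinates in \<open>{0..T}\<close> has more than \<open>m0\<close> elements, so a difference \<open>x \<noteq> 0\<close> of two of
  them lies in \<open>P\<close>; it has coordinates bounded by \<open>T\<close>. If \<open>q\<close> runs over representatives of \<open>O\<close>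
  modulo \<open>P\<close>, \<open>a\<close> over elements of \<open>P\<close> that are incongruent modulo \<open>x O\<close>, and \<open>b\<close> over a large
  box of side \<open>S\<close>, then the elements \<open>q + a + x b\<close> of \<open>O\<close> are distinct and their coordinates are
  bounded by a constant times \<open>T S\<close>. Counting them gives a bound for the number of the \<open>a\<close>.
\<close>

lemma field_lattice_bound_integral:
  assumes X: "finite X" "independent X" "X \<noteq> {}"
    and mult: "\<And>x y. x \<in> span X \<Longrightarrow> y \<in> span X \<Longrightarrow> x * y \<in> span X"
    and cancel: "\<And>x y. x \<in> span X \<Longrightarrow> y \<in> span X \<Longrightarrow> x * y = 0 \<Longrightarrow> x = 0 \<or> y = 0"
    and c: "\<And>u v. u \<in> X \<Longrightarrow> v \<in> X \<Longrightarrow> coord_bounded X (of_nat c) (u * v)"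
    and P: "full (span X) P" "P \<le> gen X" "gen X * P \<le> P"
  defines "C \<equiv> (2 * (card X ^ 2 * c) + 3) ^ card X"
  shows "\<exists>x\<in>elts P. x \<noteq> 0 \<and> (\<forall>A \<subseteq> elts P. incongruent (cyc x * gen X) A \<longrightarrow> finite A \<longrightarrow> card A \<le> C)"
proof -
  let ?n = "card X" and ?c = "card X ^ 2 * c" and ?O = "gen X"
  have n: "?n \<ge> 1" using X by (simp add: Suc_le_eq card_gt_0_iff)
  have O_span: "elts ?O \<subseteq> span X" using int_span_subset_span by (simp add: elts_gen)
  have P_span: "elts P \<subseteq> span X" using P(1) by (simp add: full_def)
  have fgO: "fg ?O" using X(1) by (rule fg_gen)
  obtain N where N: "N > 0" "cyc (of_nat N) * ?O \<le> P"
    using common_denominator_lattice[OF P(1) fgO O_span] by blast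
  obtain m1 where m1: "\<And>A. A \<subseteq> elts ?O \<Longrightarrow> incongruent P A \<Longrightarrow> finite A \<and> card A \<le> m1"
    using incongruent_card_bound[OF fgO N] by blast
  define good where "good m \<longleftrightarrow> (\<exists>A. A \<subseteq> elts ?O \<and> incongruent P A \<and> card A = m)" for m
  define m0 where "m0 = (GREATEST m. good m)"
  have "good 1" unfolding good_def by (intro exI[of _ "{0}"]) (simp add: incongruent_def)
  moreover have good_le: "m \<le> m1" if "good m" for m using that m1 unfolding good_def by blast
  ultimately have m0: "good m0" "m0 \<ge> 1"
    unfolding m0_def by (metis GreatestI_nat) (metis Greatest_le_nat \<open>good 1\<close> good_le)
  have m0_max: "m \<le> m0" if "good m" for m
    unfolding m0_def using that good_le by (rule Greatest_le_nat)
  obtain Q where Q: "Q \<subseteq> elts ?O" "incongruent P Q" "card Q = m0" using m0(1) unfolding good_def by blast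
  have finQ: "finite Q" using m1 Q by blast
  obtain T where T: "T \<ge> 1" "T ^ ?n \<le> m0" "m0 < (T + 1) ^ ?n" using power_sandwich[OF m0(2) n] by blast
  have "\<not> incongruent P (box X T)"
  proof
    assume "incongruent P (box X T)"
    then have "good ((T + 1) ^ ?n)"
      unfolding good_def elts_gen using card_box(2)[OF X(1,2)] box_int_span
      by (intro exI[of _ "box X T"] conjI)
    then show False using m0_max T(3) by fastforce
  qed
  then obtain b b' where b: "b \<in> box X T" "b' \<in> box X T" "b - b' \<in> elts P" "b \<noteq> b'"
    unfolding incongruent_def by blast
  define x where "x = b - b'"
  have x: "x \<in> elts P" "x \<noteq> 0" "coord_bounded X (of_nat T) x"
    using b box_diff_bounded[OF X(1,2)] by (auto simp: x_def)
  have xO: "cyc x * ?O \<le> P"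
    using zmod_mult_mono[of "cyc x" P ?O ?O] x(1) P(3) by (simp add: cyc_le_iff mult.commute)
  have "card A \<le> C" if A: "A \<subseteq> elts P" "incongruent (cyc x * ?O) A" "finite A" for A
  proof -
    define S0 where "S0 = (\<lambda>(q, a). q + a) ` (Q \<times> A)"
    obtain D where D: "\<And>y. y \<in> S0 \<Longrightarrow> coord_bounded X (of_nat D) y"
      using coord_bounded_ex[OF X(1), of S0] finQ A(3) unfolding S0_def by (metis finite_cartesian_product finite_imageI)
    \<comment> \<open>The side \<open>S\<close> only has to exceed the size \<open>D\<close> of the elements \<open>q + a\<close>.\<close>
    define S where "S = D + 1"
    define \<psi> where "\<psi> = (\<lambda>(q, a, b). q + a + x * b)"
    let ?dom = "Q \<times> A \<times> box X S"
    have inj: "inj_on \<psi> ?dom"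
    proof (rule inj_onI)
      fix s t assume s: "s \<in> ?dom" and t: "t \<in> ?dom" and eq: "\<psi> s = \<psi> t"
      obtain q a b q' a' b' where st: "s = (q, a, b)" "t = (q', a', b')" by (metis prod_cases3)
      have mem: "q \<in> Q" "a \<in> A" "b \<in> box X S" "q' \<in> Q" "a' \<in> A" "b' \<in> box X S"
        using s t by (auto simp: st)
      have bO: "b \<in> elts ?O" "b' \<in> elts ?O" using mem box_int_span by (auto simp: elts_gen)
      then have bb: "b' - b \<in> elts ?O" by (simp add: elts_diff)
      have xbb: "x * (b' - b) \<in> elts (cyc x * ?O)" unfolding elts_cyc_mult using bb by blast
      have eq': "q + a + x * b = q' + a' + x * b'" using eq by (simp add: \<psi>_def st)
      have "q - q' = (a' - a) + x * (b' - b)" using eq' by (simp add: algebra_simps)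
      moreover have "(a' - a) + x * (b' - b) \<in> elts P"
        using mem A(1) xbb zmod_leD[OF xO] by (intro elts_add elts_diff) auto
      ultimately have q: "q = q'" using Q(2) mem unfolding incongruent_def by simp
      then have "a - a' = x * (b' - b)" using eq' by (simp add: algebra_simps)
      then have a: "a = a'" using A(2) mem xbb unfolding incongruent_def by simp
      then have "x * (b' - b) = 0" using eq' q by (simp add: algebra_simps)
      then have "b' - b = 0"
        using cancel[of x "b' - b"] x P_span O_span bb by blast
      then show "s = t" using st q a by simp
    qed
    have img: "\<psi> ` ?dom \<subseteq> {y \<in> int_span X. coord_bounded X (of_nat (D + ?c * T * S)) y}"
    proof (clarsimp simp: \<psi>_def)
      fix q a b assume mem: "q \<in> Q" "a \<in> A" "b \<in> box X S"
      have bO: "b \<in> elts ?O" using mem box_int_span by (auto simp: elts_gen)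
      have aO: "a \<in> elts ?O" using mem A(1) P(2) zmod_leD by blast
      have qO: "q \<in> elts ?O" using mem Q(1) by blast
      have "x * b \<in> elts (cyc x * ?O)" unfolding elts_cyc_mult using bO by blast
      then have xb: "x * b \<in> elts ?O" using xO P(2) zmod_leD by blast
      have "coord_bounded X (of_nat ?n ^ 2 * of_nat c * of_nat T * of_nat S) (x * b)"
        using x(1) P_span bO O_span
        by (intro coord_bounded_mult X(1,2) mult c x(3) box_bounded[OF X(1,2) mem(3)]) auto
      then have "coord_bounded X (of_nat D + of_nat ?n ^ 2 * of_nat c * of_nat T * of_nat S) (q + a + x * b)"
        using D[of "q + a"] mem qO aO xb O_span
        by (intro coord_bounded_add X(2)) (auto simp: S0_def intro: elts_add)
      then show "q + a + x * b \<in> int_span X \<and>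
          coord_bounded X (of_nat D + (of_nat ?n)\<^sup>2 * of_nat c * of_nat T * of_nat S) (q + a + x * b)"
        using qO aO xb by (auto simp flip: elts_gen intro: elts_add)
    qed
    have "m0 * card A * (S + 1) ^ ?n = card ?dom"
      using Q(3) card_box[OF X(1,2)] by (simp add: card_cartesian_product mult.assoc)
    also have "\<dots> \<le> (2 * (D + ?c * T * S) + 1) ^ ?n"
      using card_inj_on_le[OF inj img card_coord_bounded(1)[OF X(1,2)]] card_coord_bounded(2)[OF X(1,2)]
      by (meson order_trans)
    also have "\<dots> \<le> (T * S * (2 * ?c + 3)) ^ ?n"
    proof (rule power_mono)
      have "S \<le> T * S" using T(1) by simp
      then have "2 * D + 1 \<le> 3 * (T * S)" by (simp add: S_def)
      then show "2 * (D + ?c * T * S) + 1 \<le> T * S * (2 * ?c + 3)"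
        by (simp add: distrib_left mult_ac)
    qed simp
    also have "\<dots> = T ^ ?n * (S ^ ?n * C)" by (simp add: C_def power_mult_distrib mult.assoc)
    also have "\<dots> \<le> m0 * ((S + 1) ^ ?n * C)"
      using T(2) by (intro mult_le_mono power_mono) auto
    finally have "(m0 * (S + 1) ^ ?n) * card A \<le> (m0 * (S + 1) ^ ?n) * C" by (simp add: mult_ac)
    then show "card A \<le> C" using m0(2) by simp
  qed
  then show ?thesis using x by blast
qed

text \<open>
  Among the \<open>C + 1\<close> multiples \<open>0, y, \<dots>, C y\<close> two are congruent, so some \<open>t y\<close> with \<open>1 \<le> t \<le> C\<close> lies
  in \<open>J\<close>.
\<close>

lemma fact_multiple_if_few_incongruent:
  assumes bound: "\<And>A. A \<subseteq> elts P \<Longrightarrow> incongruent J A \<Longrightarrow> finite A \<Longrightarrow> card A \<le> C" and y: "y \<in> elts P"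
  shows "of_nat (fact C) * y \<in> elts J"
proof -
  have "\<exists>i j. i < j \<and> j \<le> C \<and> of_nat j * y - of_nat i * y \<in> elts J"
  proof (rule ccontr)
    assume none: "\<nexists>i j. i < j \<and> j \<le> C \<and> of_nat j * y - of_nat i * y \<in> elts J"
    have no: "\<not> of_nat i * y - of_nat j * y \<in> elts J" if "i \<noteq> j" "i \<le> C" "j \<le> C" for i j
    proof (cases i j rule: linorder_cases)
      case less
      then show ?thesis using none that elts_uminus[of "of_nat i * y - of_nat j * y" J] by auto
    qed (use none that in auto)
    have inj: "inj_on (\<lambda>i. of_nat i * y) {..C}"
    proof (rule inj_onI, rule ccontr)
      fix i j assume "i \<in> {..C}" "j \<in> {..C}" "of_nat i * y = of_nat j * y" "i \<noteq> j"
      then show False using no[of i j] by simp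
    qed
    have "incongruent J ((\<lambda>i. of_nat i * y) ` {..C})"
      unfolding incongruent_def using no by auto metis
    then have "card ((\<lambda>i. of_nat i * y) ` {..C}) \<le> C"
      using y by (intro bound) (auto intro: elts_of_nat_mult)
    then show False using inj by (simp add: card_image)
  qed
  then obtain i j where ij: "i < j" "j \<le> C" "of_nat j * y - of_nat i * y \<in> elts J" by blast
  then have "j - i dvd fact C" by (intro dvd_fact) auto
  then obtain d where d: "fact C = (j - i) * d" by blast
  have "of_nat (fact C) * y = of_nat d * (of_nat j * y - of_nat i * y)"
    unfolding d using ij(1) by (simp add: of_nat_diff algebra_simps)
  then show ?thesis using ij(3) elts_of_nat_mult by simp
qed

text \<open>
  Finiteness of the class number of a number field \<open>span X\<close>, in quantitative form: up to a
  factor \<open>C\<close> that depends on \<open>X\<close> only, every lattice that is stable under \<open>X\<close> is principal.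
\<close>

theorem field_lattice_bound:
  assumes X: "finite X" "independent X" "X \<noteq> {}"
    and mult: "\<And>x y. x \<in> span X \<Longrightarrow> y \<in> span X \<Longrightarrow> x * y \<in> span X"
    and cancel: "\<And>x y. x \<in> span X \<Longrightarrow> y \<in> span X \<Longrightarrow> x * y = 0 \<Longrightarrow> x = 0 \<or> y = 0"
  shows "\<exists>C>0. \<forall>P. full (span X) P \<longrightarrow> gen X * P \<le> P \<longrightarrow>
    (\<exists>x\<in>elts P. x \<noteq> 0 \<and> cyc (of_nat C) * P \<le> cyc x * gen X)"
proof -
  obtain c where "\<And>y. y \<in> (\<lambda>(u, v). u * v) ` (X \<times> X) \<Longrightarrow> coord_bounded X (of_nat c) y"
    using coord_bounded_ex[OF X(1), of "(\<lambda>(u, v). u * v) ` (X \<times> X)"] X(1) by auto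
  then have c: "\<And>u v. u \<in> X \<Longrightarrow> v \<in> X \<Longrightarrow> coord_bounded X (of_nat c) (u * v)" by auto
  define C where "C = (2 * (card X ^ 2 * c) + 3) ^ card X"
  have "\<exists>x\<in>elts P. x \<noteq> 0 \<and> cyc (of_nat (fact C)) * P \<le> cyc x * gen X"
    if P: "full (span X) P" "gen X * P \<le> P" for P
  proof -
    have fullX: "full (span X) (gen X)"
      unfolding full_def using span_imp_int_span int_span_subset_span X(1) by (auto simp: fg_gen elts_gen)
    have fgP: "fg P" "elts P \<subseteq> span X" using P(1) by (simp_all add: full_def)
    obtain t where t: "t > 0" "cyc (of_nat t) * P \<le> gen X"
      using common_denominator_lattice[OF fullX fgP] by blast
    define P' where "P' = cyc (of_nat t) * P"
    have P't: "P' \<le> gen X" using t(2) by (simp add: P'_def)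
    have full': "full (span X) P'"
      unfolding full_def
    proof (intro conjI ballI)
      show "fg P'" unfolding P'_def using P(1) by (intro fg_times fg_gen) (auto simp: full_def)
      show "elts P' \<subseteq> span X" using P(1) cyc_of_nat_le[of t P] unfolding P'_def full_def less_eq_zmod_def by blast
      fix b assume "b \<in> span X"
      then obtain M where M: "M > 0" "of_nat M * b \<in> elts P" using P(1) unfolding full_def by blast
      then have "of_nat t * (of_nat M * b) \<in> elts P'" unfolding P'_def elts_cyc_mult by blast
      then show "\<exists>N>0. of_nat N * b \<in> elts P'"
        using M(1) t(1) by (intro exI[of _ "t * M"]) (simp add: mult.assoc)
    qed
    have stable: "gen X * P' \<le> P'"
      using zmod_mult_mono[OF order_refl P(2), of "cyc (of_nat t)"] by (simp add: P'_def mult.left_commute)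
    have "\<exists>x\<in>elts P'. x \<noteq> 0 \<and>
        (\<forall>A \<subseteq> elts P'. incongruent (cyc x * gen X) A \<longrightarrow> finite A \<longrightarrow> card A \<le> C)"
      unfolding C_def by (rule field_lattice_bound_integral[OF X mult cancel c full' P't stable])
    then obtain x where x: "x \<in> elts P'" "x \<noteq> 0" and
      few: "\<forall>A \<subseteq> elts P'. incongruent (cyc x * gen X) A \<longrightarrow> finite A \<longrightarrow> card A \<le> C"
      by (elim bexE conjE) (rule that)
    obtain x' where x': "x' \<in> elts P" "x = of_nat t * x'"
      using x(1) unfolding P'_def elts_cyc_mult by blast
    have "of_nat (fact C) * y \<in> elts (cyc x' * gen X)" if y: "y \<in> elts P" for y
    proof -
      have "of_nat t * y \<in> elts P'" unfolding P'_def elts_cyc_mult using y by blast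
      then have "of_nat (fact C) * (of_nat t * y) \<in> elts (cyc x * gen X)"
        using few by (intro fact_multiple_if_few_incongruent[of P']) auto
      then obtain w where w: "w \<in> elts (gen X)" "of_nat (fact C) * (of_nat t * y) = x * w"
        unfolding elts_cyc_mult by blast
      then have "of_nat t * (of_nat (fact C) * y) = of_nat t * (x' * w)"
        unfolding x'(2) by (metis mult.assoc mult.left_commute)
      then have "of_nat (fact C) * y = x' * w" using torsion_free_cancel t(1) by blast
      then show ?thesis unfolding elts_cyc_mult using w(1) by blast
    qed
    moreover have "x' \<noteq> 0" using x(2) x'(2) by auto
    ultimately show ?thesis using x'(1) by (auto simp: cyc_mult_le_iff)
  qed
  then show ?thesis by (intro exI[of _ "fact C"]) auto
qed

end

section \<open>The radical\<close>

lemma radical_mult: "x \<in> radical \<Longrightarrow> x * y \<in> (radical :: 'a::comm_ring_1 set)"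
  unfolding radical_def by (auto simp: power_mult_distrib) (metis mult_zero_left)

lemma radical_add:
  assumes "x \<in> radical" "y \<in> (radical :: 'a::comm_ring_1 set)"
  shows "x + y \<in> radical"
proof -
  obtain m n where mn: "x ^ m = 0" "y ^ n = 0" using assms unfolding radical_def by blast
  obtain U :: "'a zmod" where U: "elts U = UNIV" using ex_elts[OF zmodule.subspace_UNIV] by blast
  have "(x + y) ^ (m + n) \<in> elts 0"
    by (rule sum_power_mem[of 0 U]) (use U mn in \<open>auto simp: less_eq_zmod_def\<close>)
  then show ?thesis unfolding radical_def by auto
qed

lemma radical_zero: "0 \<in> radical"
  unfolding radical_def by (auto intro: exI[of _ 1])

text \<open>
  The geometric series for the inverse; it shows that the inverse lies in every ring that
  contains \<open>r\<close>.
\<close>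

lemma one_plus_radical_unit:
  assumes "r \<in> (radical :: 'a::comm_ring_1 set)"
  shows "\<exists>b. (1 + r) * b = 1 \<and> (\<exists>n. b = (\<Sum>i<n. (- r) ^ i))"
proof -
  obtain n where n: "r ^ n = 0" using assms unfolding radical_def by blast
  have "(- r) ^ n = 0" using n by (simp add: power_minus[of r])
  then have "(1 - (- r)) * (\<Sum>i<n. (- r) ^ i) = 1"
    using one_diff_power_eq[of "- r" n] by simp
  then show ?thesis by auto
qed

context fin_dim_rat_algebra
begin

lemma subspace_radical: "subspace radical"
  unfolding subspace_def
  using radical_add radical_zero radical_mult
  by (metis mult.commute scale_eq_mult)

lemma subspace_mult_image:
  assumes "subspace V"
  shows "subspace ((*) e ` V)"
  unfolding subspace_def
proof safe
  show "0 \<in> (*) e ` V" using subspace_0[OF assms] by force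
  show "e * x + e * y \<in> (*) e ` V" if "x \<in> V" "y \<in> V" for x y
    using that subspace_add[OF assms] by (metis distrib_left image_eqI)
  show "scale c (e * x) \<in> (*) e ` V" if "x \<in> V" for c x
    using that subspace_scale[OF assms] by (metis scale_mult_right image_eqI)
qed

end

text \<open>
  The consequences of the canonical decomposition that are needed: \<open>F\<close> is a subalgebra
  complementary to the radical, and \<open>E\<close> is the set of the unit elements of its field factors.
\<close>

locale split_algebra = fin_dim_rat_algebra scale
  for scale :: "rat \<Rightarrow> 'a::comm_ring_1 \<Rightarrow> 'a" +
  fixes F E :: "'a set"
  assumes subspace_F: "subspace F" and one_F: "1 \<in> F"
    and mult_F: "x \<in> F \<Longrightarrow> y \<in> F \<Longrightarrow> x * y \<in> F"
    and F_radical: "x \<in> F \<Longrightarrow> x \<in> radical \<Longrightarrow> x = 0"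
    and split: "\<exists>y\<in>F. x - y \<in> radical"
    and finite_E: "finite E" and E_F: "E \<subseteq> F" and sum_E: "\<Sum>E = 1" and zero_E: "0 \<notin> E"
    and orthogonal: "e \<in> E \<Longrightarrow> f \<in> E \<Longrightarrow> e \<noteq> f \<Longrightarrow> e * f = 0"
    and field_E: "e \<in> E \<Longrightarrow> x \<in> F \<Longrightarrow> e * x \<noteq> 0 \<Longrightarrow> \<exists>y\<in>F. e * x * y = e"

sublocale split_algebra \<subseteq> F: subalgebra scale F
  by unfold_locales (rule subspace_F one_F mult_F; assumption?)+

sublocale split_algebra \<subseteq> A: subalgebra scale UNIV
  by (rule subalgebra_UNIV)

context split_algebra
begin

lemma idem_E: "e \<in> E \<Longrightarrow> e * e = e"
proof -
  assume e: "e \<in> E"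
  have "e = e * \<Sum>E" by (simp add: sum_E)
  also have "\<dots> = (\<Sum>f\<in>E. e * f)" by (simp add: sum_distrib_left)
  also have "\<dots> = (\<Sum>f\<in>E. if f = e then e * e else 0)"
    using orthogonal[OF e] by (intro sum.cong) auto
  finally show ?thesis using e finite_E by simp
qed

lemma pr_eqI: "y \<in> F \<Longrightarrow> x - y \<in> radical \<Longrightarrow> pr F x = y"
  unfolding pr_def
proof (rule the_equality)
  fix z assume y: "y \<in> F" "x - y \<in> radical" and z: "z \<in> F \<and> x - z \<in> radical"
  have "(x - y) - (x - z) \<in> radical" using y z subspace_diff[OF subspace_radical] by blast
  moreover have "z - y \<in> F" using y z subspace_diff[OF subspace_F] by blast
  ultimately show "z = y" using F_radical[of "z - y"] by simp
qed blast

lemma pr_mem: "pr F x \<in> F" and pr_diff: "x - pr F x \<in> radical"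
  using split[of x] pr_eqI by auto

lemma pr_F: "x \<in> F \<Longrightarrow> pr F x = x"
  by (rule pr_eqI) (simp_all add: radical_zero)

lemma pr_radical: "x \<in> radical \<Longrightarrow> pr F x = 0"
  by (rule pr_eqI) (simp_all add: subspace_0[OF subspace_F])

lemma pr_add: "pr F (x + y) = pr F x + pr F y"
proof (rule pr_eqI)
  show "pr F x + pr F y \<in> F" using pr_mem subspace_add[OF subspace_F] by blast
  have "x + y - (pr F x + pr F y) = (x - pr F x) + (y - pr F y)" by simp
  then show "x + y - (pr F x + pr F y) \<in> radical" using pr_diff radical_add by metis
qed

lemma pr_mult: "pr F (x * y) = pr F x * pr F y"
proof (rule pr_eqI)
  show "pr F x * pr F y \<in> F" using pr_mem mult_F by blast
  have "x * y - pr F x * pr F y = (x - pr F x) * y + (y - pr F y) * pr F x"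
    by (simp add: algebra_simps)
  then show "x * y - pr F x * pr F y \<in> radical"
    using radical_add[OF radical_mult[OF pr_diff] radical_mult[OF pr_diff]] by metis
qed

lemma pr_one: "pr F 1 = 1"
  using pr_F one_F by blast

lemma pr_of_int: "pr F (of_int k) = of_int k"
  using pr_F subspace_scale[OF subspace_F one_F, of "of_int k"] scale_of_int[of k 1] by simp

lemma pr_of_nat: "pr F (of_nat k) = of_nat k"
  using pr_of_int[of "int k"] by simp

lemma unit_if_pr_unit:
  assumes "F.unit (pr F x)"
  shows "A.unit x"
proof -
  obtain u where u: "pr F x * u = 1" using assms unfolding F.unit_def by blast
  have "x * u = 1 + (x - pr F x) * u" using u by (simp add: algebra_simps)
  moreover have "(x - pr F x) * u \<in> radical" using pr_diff radical_mult by blast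
  ultimately obtain b where "x * u * b = 1" using one_plus_radical_unit by metis
  then show ?thesis unfolding A.unit_def by (metis UNIV_I mult.assoc)
qed

section \<open>Generators of lattices in the separable part\<close>

definition factor :: "'a \<Rightarrow> 'a set" where
  "factor e = (*) e ` F"

lemma subspace_factor: "subspace (factor e)"
  unfolding factor_def by (rule subspace_mult_image[OF subspace_F])

lemma factor_absorb: "e \<in> E \<Longrightarrow> x \<in> factor e \<Longrightarrow> e * x = x"
  unfolding factor_def using idem_E by (auto simp: mult.assoc[symmetric])

lemma factor_orthogonal: "e \<in> E \<Longrightarrow> f \<in> E \<Longrightarrow> e \<noteq> f \<Longrightarrow> x \<in> factor e \<Longrightarrow> f * x = 0"
  unfolding factor_def using orthogonal[of f e] by (auto simp: mult.assoc[symmetric])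

lemma factor_F: "e \<in> E \<Longrightarrow> factor e \<subseteq> F"
  unfolding factor_def using E_F mult_F by auto

lemma basis_in_order:
  assumes \<Lambda>: "full UNIV \<Lambda>" and V: "subspace V"
  obtains X where "finite X" "independent X" "X \<subseteq> elts \<Lambda>" "X \<subseteq> V" "span X = V"
proof -
  obtain X where X: "X \<subseteq> elts \<Lambda> \<inter> V" "independent X" "elts \<Lambda> \<inter> V \<subseteq> span X"
    using maximal_independent_subset[of "elts \<Lambda> \<inter> V"] by blast
  have "v \<in> span X" if v: "v \<in> V" for v
  proof -
    obtain N where N: "N > 0" "of_nat N * v \<in> elts \<Lambda>" using \<Lambda> unfolding full_def by blast
    have "of_nat N * v \<in> V" using subspace_scale[OF V v, of "of_nat N"] by (simp add: scale_of_nat)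
    then have "scale (1 / of_nat N) (of_nat N * v) \<in> span X" using N(2) X(3) by (intro span_scale) blast
    then show ?thesis using of_nat_scale_inverse[OF N(1), of v] by (simp add: scale_mult_right)
  qed
  moreover have "span X \<subseteq> V" using X(1) V by (intro span_minimal) auto
  moreover have "finite X"
    using finite_dimensional independent_span_bound X(2) by (metis subset_UNIV)
  ultimately show thesis using that X by blast
qed

text \<open>
  The class number bound for one field factor, with a generating set \<open>X\<close> inside \<open>\<Lambda>\<close> and a
  constant \<open>C\<close> that serve all lattices \<open>P\<close> at once.
\<close>

definition factor_bound :: "'a zmod \<Rightarrow> 'a \<Rightarrow> 'a set \<Rightarrow> nat \<Rightarrow> bool" where
  "factor_bound \<Lambda> e X C \<longleftrightarrow> C > 0 \<and> X \<subseteq> elts \<Lambda> \<and> X \<subseteq> factor e \<and>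
    (\<forall>P. full (factor e) P \<longrightarrow> gen X * P \<le> P \<longrightarrow>
      (\<exists>x\<in>elts P. x \<noteq> 0 \<and> cyc (of_nat C) * P \<le> cyc x * gen X))"

text \<open>
  The basis of the factor is chosen inside \<open>\<Lambda>\<close>; then stability under \<open>\<Lambda>\<close> implies stability
  under the basis.
\<close>

lemma factor_bound_exists:
  assumes \<Lambda>: "full UNIV \<Lambda>" and e: "e \<in> E"
  shows "\<exists>X C. factor_bound \<Lambda> e X C"
proof -
  obtain X where X: "finite X" "independent X" "X \<subseteq> elts \<Lambda>" "X \<subseteq> factor e" "span X = factor e"
    using basis_in_order[OF \<Lambda> subspace_factor] by blast
  have ne: "X \<noteq> {}"
  proof
    assume "X = {}"
    then have "factor e = {0}" using X(5) by simp
    moreover have "e * 1 \<in> factor e" unfolding factor_def using one_F by blast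
    ultimately show False using e zero_E by auto
  qed
  have mult: "x * y \<in> factor e" if x: "x \<in> factor e" and y: "y \<in> factor e" for x y
  proof -
    obtain x' where x': "x = e * x'" "x' \<in> F" using x unfolding factor_def by blast
    have "x * y = e * (x' * y)" by (simp add: x' mult.assoc)
    moreover have "x' * y \<in> F" using y factor_F[OF e] x' mult_F by blast
    ultimately show ?thesis unfolding factor_def by blast
  qed
  have cancel: "x = 0 \<or> y = 0" if xy: "x \<in> factor e" "y \<in> factor e" "x * y = 0" for x y
  proof (rule ccontr)
    assume *: "\<not> (x = 0 \<or> y = 0)"
    obtain x' where x': "x = e * x'" "x' \<in> F" using xy(1) unfolding factor_def by blast
    then obtain z where "x * z = e" using field_E[OF e] * by blast
    then have "e * y = z * (x * y)" by (metis mult.commute mult.left_commute)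
    then have "e * y = 0" using xy(3) by simp
    then show False using factor_absorb[OF e xy(2)] * by simp
  qed
  obtain C where "C > 0" "\<forall>P. full (span X) P \<longrightarrow> gen X * P \<le> P \<longrightarrow>
      (\<exists>x\<in>elts P. x \<noteq> 0 \<and> cyc (of_nat C) * P \<le> cyc x * gen X)"
    using field_lattice_bound[OF X(1,2) ne] mult cancel unfolding X(5) by blast
  then show ?thesis unfolding factor_bound_def using X by auto
qed

text \<open>
  The generators \<open>x e\<close> of the components \<open>e P\<close> are combined to \<open>y = \<Sum> N0 x e\<close>, where \<open>N0\<close> is a common
  denominator that brings the idempotents \<open>e\<close> into \<open>\<Lambda>\<close>; this puts \<open>y\<close> into \<open>P\<close>. As all the
  components of \<open>y\<close> are nonzero elements of fields, \<open>y\<close> is a unit of \<open>F\<close>.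
\<close>

lemma lattice_generator:
  assumes \<Lambda>: "full UNIV \<Lambda>"
  shows "\<exists>N>0. \<forall>P. full F P \<longrightarrow> (\<forall>l\<in>elts \<Lambda> \<inter> F. \<forall>p\<in>elts P. l * p \<in> elts P) \<longrightarrow>
    (\<exists>x\<in>elts P. F.unit x \<and> (\<forall>p\<in>elts P. \<exists>l\<in>elts \<Lambda>. of_nat N * p = x * l))"
proof -
  obtain N0 where N0: "N0 > 0" "\<forall>e\<in>E. of_nat N0 * e \<in> elts \<Lambda>"
    using common_denominator[OF \<Lambda> finite_E] by auto
  obtain X C where XC: "\<And>e. e \<in> E \<Longrightarrow> factor_bound \<Lambda> e (X e) (C e)"
    using factor_bound_exists[OF \<Lambda>] by metis
  then have C: "\<forall>e\<in>E. C e > 0 \<and> X e \<subseteq> elts \<Lambda> \<and> X e \<subseteq> factor e"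
    by (simp add: factor_bound_def)
  define C' where "C' = (\<Prod>e\<in>E. C e)"
  have "\<exists>x\<in>elts P. F.unit x \<and> (\<forall>p\<in>elts P. \<exists>l\<in>elts \<Lambda>. of_nat (N0 * C') * p = x * l)"
    if P: "full F P" and stable: "\<forall>l\<in>elts \<Lambda> \<inter> F. \<forall>p\<in>elts P. l * p \<in> elts P" for P
  proof -
    have "\<exists>x\<in>elts (cyc e * P). x \<noteq> 0 \<and> cyc (of_nat (C e)) * (cyc e * P) \<le> cyc x * gen (X e)"
      if e: "e \<in> E" for e
    proof -
      have "full (factor e) (cyc e * P)"
        unfolding full_def
      proof (intro conjI ballI)
        show "fg (cyc e * P)" using P by (intro fg_times fg_gen) (auto simp: full_def)
        show "elts (cyc e * P) \<subseteq> factor e"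
          using P unfolding elts_cyc_mult factor_def full_def by blast
        fix b assume "b \<in> factor e"
        then obtain f where f: "b = e * f" "f \<in> F" unfolding factor_def by blast
        then obtain M where M: "M > 0" "of_nat M * f \<in> elts P" using P unfolding full_def by blast
        have "of_nat M * b = e * (of_nat M * f)" by (simp add: f mult.left_commute)
        then have "of_nat M * b \<in> elts (cyc e * P)" unfolding elts_cyc_mult using M(2) by blast
        then show "\<exists>M>0. of_nat M * b \<in> elts (cyc e * P)" using M(1) by blast
      qed
      moreover have "gen (X e) * (cyc e * P) \<le> cyc e * P"
      proof -
        have XF: "X e \<subseteq> elts \<Lambda> \<inter> F" using C e factor_F[OF e] by blast
        have "{x * y |x y. x \<in> X e \<and> y \<in> elts P} \<subseteq> elts P" using XF stable by blast
        then have "gen (X e) * P \<le> P"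
          using gen_mult[of "X e" "elts P"] by (simp add: gen_le_iff)
        then show ?thesis
          using zmod_mult_mono[OF order_refl, of "gen (X e) * P" P "cyc e"]
          by (simp add: mult.left_commute)
      qed
      ultimately show ?thesis using XC[OF e] unfolding factor_bound_def by blast
    qed
    then obtain x where x: "\<And>e. e \<in> E \<Longrightarrow> x e \<in> elts (cyc e * P)" "\<And>e. e \<in> E \<Longrightarrow> x e \<noteq> 0"
      "\<And>e. e \<in> E \<Longrightarrow> cyc (of_nat (C e)) * (cyc e * P) \<le> cyc (x e) * gen (X e)"
      by metis
    have xe: "x e \<in> factor e" if "e \<in> E" for e
      using x(1)[OF that] P unfolding elts_cyc_mult factor_def full_def by blast
    define y where "y = (\<Sum>e\<in>E. of_nat N0 * x e)"
    have "of_nat N0 * x e \<in> elts P" if e: "e \<in> E" for e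
    proof -
      obtain p where p: "p \<in> elts P" "x e = e * p" using x(1)[OF e] unfolding elts_cyc_mult by blast
      have "of_nat N0 * e \<in> F"
        using e E_F subspace_scale[OF subspace_F, of e "of_nat N0"] by (auto simp: scale_of_nat)
      then have "(of_nat N0 * e) * p \<in> elts P" using stable N0(2) e p(1) by blast
      then show ?thesis using p(2) by (simp add: mult.assoc)
    qed
    then have yP: "y \<in> elts P" unfolding y_def by (intro elts_sum)
    have y_mult: "y * z = of_nat N0 * x e * z" if e: "e \<in> E" and z: "z \<in> factor e" for e z
    proof -
      have "x f * z = 0" if "f \<in> E" "f \<noteq> e" for f
      proof -
        have "x f * z = x f * (f * z)"
          using factor_absorb[OF that(1) xe[OF that(1)]] by (metis mult.assoc mult.commute)
        then show ?thesis using factor_orthogonal[OF e that(1) _ z] that(2) by simp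
      qed
      then have "y * z = (\<Sum>f\<in>E. if f = e then of_nat N0 * x e * z else 0)"
        unfolding y_def sum_distrib_right by (intro sum.cong) (auto simp: mult.assoc)
      then show ?thesis using e finite_E by simp
    qed
    have "\<exists>z\<in>F. x e * z = e" if e: "e \<in> E" for e
    proof -
      obtain f where "x e = e * f" "f \<in> F" using xe[OF e] unfolding factor_def by blast
      then show ?thesis using x(2)[OF e] field_E[OF e, of f] by simp
    qed
    then obtain z where z: "\<And>e. e \<in> E \<Longrightarrow> z e \<in> F" "\<And>e. e \<in> E \<Longrightarrow> x e * z e = e" by metis
    define i where "i = scale (1 / of_nat N0) 1"
    have i: "of_nat N0 * i = 1" unfolding i_def by (rule of_nat_scale_inverse[OF N0(1)])
    have iF: "i \<in> F" unfolding i_def using subspace_scale[OF subspace_F one_F] .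
    have inv_term: "y * (e * (i * z e)) = e" if e: "e \<in> E" for e
    proof -
      have "e * (i * z e) \<in> factor e" unfolding factor_def using iF z(1)[OF e] mult_F by blast
      then have "y * (e * (i * z e)) = of_nat N0 * x e * (e * (i * z e))" using y_mult e by blast
      also have "\<dots> = (of_nat N0 * i) * ((x e * z e) * e)" by (simp add: mult_ac)
      finally show ?thesis using i z(2)[OF e] idem_E[OF e] by simp
    qed
    have "y * (\<Sum>e\<in>E. e * (i * z e)) = 1"
      using inv_term sum_E by (simp add: sum_distrib_left)
    moreover have "(\<Sum>e\<in>E. e * (i * z e)) \<in> F"
      using E_F iF z(1) by (intro subspace_sum[OF subspace_F] mult_F) auto
    moreover have "y \<in> F" using yP P unfolding full_def by blast
    ultimately have unit: "F.unit y" unfolding F.unit_def by blast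
    have "\<exists>l\<in>elts \<Lambda>. of_nat (N0 * C') * p = y * l" if p: "p \<in> elts P" for p
    proof -
      have "\<exists>w\<in>elts (gen (X e)). of_nat (C e) * (e * p) = x e * w" if e: "e \<in> E" for e
      proof -
        have "of_nat (C e) * (e * p) \<in> elts (cyc (of_nat (C e)) * (cyc e * P))"
          unfolding elts_cyc_mult using p by blast
        then have "of_nat (C e) * (e * p) \<in> elts (cyc (x e) * gen (X e))" using x(3)[OF e] zmod_leD by blast
        then show ?thesis unfolding elts_cyc_mult by blast
      qed
      then obtain w where w: "\<And>e. e \<in> E \<Longrightarrow> w e \<in> elts (gen (X e))"
        "\<And>e. e \<in> E \<Longrightarrow> of_nat (C e) * (e * p) = x e * w e" by metis
      obtain D where D: "\<And>e. e \<in> E \<Longrightarrow> C' = C e * D e"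
        using dvd_prodI[OF finite_E, of _ C] unfolding C'_def dvd_def by metis
      define l where "l = (\<Sum>e\<in>E. of_nat (D e) * w e)"
      have "gen (X e) \<le> \<Lambda>" if "e \<in> E" for e using C that by (simp add: gen_le_iff)
      then have l: "l \<in> elts \<Lambda>" unfolding l_def using w(1) zmod_leD by (intro elts_sum elts_of_nat_mult) blast
      have wf: "w e \<in> factor e" if e: "e \<in> E" for e
      proof -
        obtain Z where Z: "elts Z = factor e" using subspace_imp_zmod[OF subspace_factor] by blast
        then have "gen (X e) \<le> Z" using C e by (simp add: gen_le_iff)
        then show ?thesis using w(1)[OF e] Z zmod_leD by blast
      qed
      have "y * (of_nat (D e) * w e) = of_nat (N0 * C') * (e * p)" if e: "e \<in> E" for e
      proof -
        have "y * (of_nat (D e) * w e) = of_nat (D e) * (y * w e)" by (simp add: mult.left_commute)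
        also have "\<dots> = of_nat (D e) * of_nat N0 * (x e * w e)"
          using y_mult[OF e wf[OF e]] by (simp add: mult.assoc)
        also have "\<dots> = of_nat (D e) * of_nat N0 * (of_nat (C e) * (e * p))" using w(2)[OF e] by simp
        also have "\<dots> = of_nat (N0 * C') * (e * p)" by (simp add: D[OF e] mult_ac)
        finally show ?thesis .
      qed
      then have "y * l = of_nat (N0 * C') * (\<Sum>E * p)"
        unfolding l_def sum_distrib_left sum_distrib_right by (intro sum.cong) auto
      then show ?thesis using l sum_E by (intro bexI[of _ l]) simp_all
    qed
    then show ?thesis using unit yP by blast
  qed
  moreover have "N0 * C' > 0" using N0 C by (simp add: C'_def prod_pos)
  ultimately show ?thesis by blast
qed

section \<open>Finitely many classes with a given order\<close>

text \<open>
  In a product of more than \<open>q |Rs|\<close> factors from \<open>Rs\<close> some factor occurs more than \<open>q\<close> times.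
\<close>

lemma products_vanish:
  assumes "finite Rs" "Rs \<subseteq> radical"
  shows "\<exists>k. \<forall>X. set_mset X \<subseteq> Rs \<longrightarrow> size X = k \<longrightarrow> prod_mset X = (0::'a)"
proof -
  have "\<forall>r\<in>Rs. \<exists>n. r ^ n = 0" using assms(2) unfolding radical_def by blast
  then obtain n where n: "\<And>r. r \<in> Rs \<Longrightarrow> r ^ n r = 0" by metis
  define q where "q = (\<Sum>r\<in>Rs. n r)"
  have q: "r ^ q = 0" if "r \<in> Rs" for r
  proof -
    have "n r \<le> q" unfolding q_def using that assms(1) by (simp add: member_le_sum)
    then have "r ^ q = r ^ n r * r ^ (q - n r)" by (simp flip: power_add)
    then show ?thesis using n[OF that] by simp
  qed
  have "prod_mset X = 0" if X: "set_mset X \<subseteq> Rs" "size X = card Rs * q + 1" for X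
  proof -
    have "\<exists>r\<in>set_mset X. count X r > q"
    proof (rule ccontr)
      assume "\<not> (\<exists>r\<in>set_mset X. count X r > q)"
      then have "sum (count X) (set_mset X) \<le> card (set_mset X) * q"
        using sum_bounded_above[of "set_mset X" "count X" q] by (simp add: not_less)
      also have "\<dots> \<le> card Rs * q" using X(1) assms(1) by (simp add: card_mono)
      finally show False using X(2) by (simp add: size_multiset_overloaded_eq)
    qed
    then obtain r where r: "r \<in> Rs" "count X r > q" using X(1) by blast
    then have "replicate_mset q r \<subseteq># X" by (simp flip: count_le_replicate_mset_subset_eq)
    then have "prod_mset (replicate_mset q r) dvd prod_mset X" by (rule prod_mset_subset_imp_dvd)
    then show ?thesis using q[OF r(1)] by simp
  qed
  then show ?thesis by blast
qed

text \<open>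
  If \<open>a Rs \<subseteq> \<Lambda>\<close>, then a bounded multiple of \<open>a\<close> lies in \<open>\<Lambda>\<close> up to an element that annihilates
  \<open>Rs\<close>. One element \<open>r\<close> at a time: on the annihilator \<open>V\<close> of the others,
  multiplication by \<open>r\<close> has a linear section \<open>g\<close> on its image, and \<open>g\<close> maps \<open>\<Lambda>\<close> into a lattice
  of bounded denominator.
\<close>

lemma annihilator_split:
  assumes \<Lambda>: "A.is_order \<Lambda>" and Rs: "finite Rs" "Rs \<subseteq> elts \<Lambda>"
  shows "\<exists>N>0. \<forall>a. (\<forall>r\<in>Rs. a * r \<in> elts \<Lambda>) \<longrightarrow>
    (\<exists>s. (\<forall>r\<in>Rs. s * r = 0) \<and> of_nat N * a - s \<in> elts \<Lambda>)"
  using Rs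
proof (induction rule: finite_induct)
  case empty
  have "\<exists>s. of_nat 1 * a - s \<in> elts \<Lambda>" for a by (intro exI[of _ a]) simp
  then show ?case by (intro exI[of _ 1]) auto
next
  case (insert r Rs)
  have ring: "x * y \<in> elts \<Lambda>" if "x \<in> elts \<Lambda>" "y \<in> elts \<Lambda>" for x y
    using zmod_mult_mem[OF that] \<Lambda> zmod_leD unfolding A.is_order_def by blast
  obtain N where N: "N > 0" "\<And>a. (\<forall>r\<in>Rs. a * r \<in> elts \<Lambda>) \<Longrightarrow>
      \<exists>s. (\<forall>r\<in>Rs. s * r = 0) \<and> of_nat N * a - s \<in> elts \<Lambda>"
    using insert by auto
  define V where "V = {v :: 'a. \<forall>r\<in>Rs. v * r = 0}"
  have V: "subspace V"
    unfolding subspace_def V_def by (auto simp: distrib_right scale_mult_left)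
  interpret vv: vector_space_pair scale scale ..
  have lin: "Vector_Spaces.linear scale scale (\<lambda>v. v * r)"
    by unfold_locales (auto simp: distrib_right scale_mult_left)
  obtain g where g: "range g \<subseteq> V" "Vector_Spaces.linear scale scale g"
    "\<And>w. w \<in> (\<lambda>v. v * r) ` V \<Longrightarrow> g w * r = w"
    using vv.linear_exists_right_inverse_on[OF lin V] by auto
  interpret g: Vector_Spaces.linear scale scale g by (rule g(2))
  obtain Y where Y: "finite Y" "\<Lambda> = gen Y"
    using \<Lambda> unfolding A.is_order_def full_def fg_def by blast
  obtain K where K: "K > 0" "\<forall>y\<in>g ` Y. of_nat K * y \<in> elts \<Lambda>"
    using common_denominator[of UNIV \<Lambda> "g ` Y"] \<Lambda> Y(1) unfolding A.is_order_def by blast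
  have gK: "of_nat K * g w \<in> elts \<Lambda>" if "w \<in> elts \<Lambda>" for w
    using that[unfolded Y(2) elts_gen]
  proof (induction rule: zmodule.span_induct_alt)
    case base
    then show ?case by (simp add: g.zero)
  next
    case (step c x y)
    have "g (of_int c * x + y) = of_int c * g x + g y"
      by (simp add: g.add g.scale flip: scale_of_int)
    then have "of_nat K * g (of_int c * x + y) = of_int c * (of_nat K * g x) + of_nat K * g y"
      by (simp add: algebra_simps)
    moreover have "of_int c * (of_nat K * g x) \<in> elts \<Lambda>"
      using K(2) step by (intro elts_of_int_mult) blast
    ultimately show ?case using elts_add step by simp
  qed
  have "\<exists>s. (\<forall>q\<in>insert r Rs. s * q = 0) \<and> of_nat (K * N) * a - s \<in> elts \<Lambda>"
    if a: "\<forall>q\<in>insert r Rs. a * q \<in> elts \<Lambda>" for a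
  proof -
    obtain s where s: "\<forall>q\<in>Rs. s * q = 0" "of_nat N * a - s \<in> elts \<Lambda>" using N(2) a by blast
    have "s * r = of_nat N * (a * r) - (of_nat N * a - s) * r" by (simp add: algebra_simps)
    moreover have "(of_nat N * a - s) * r \<in> elts \<Lambda>" using ring[OF s(2)] insert.prems by blast
    ultimately have sr: "s * r \<in> elts \<Lambda>" using a elts_diff elts_of_nat_mult by (metis insertI1)
    define b where "b = g (s * r)"
    have b: "b * r = s * r" "b \<in> V" "of_nat K * b \<in> elts \<Lambda>"
      using g(1) g(3)[of "s * r"] s(1) gK[OF sr] by (auto simp: b_def V_def)
    have "(of_nat K * (s - b)) * q = 0" if "q \<in> insert r Rs" for q
      using that b(1,2) s(1) by (auto simp: V_def mult.assoc left_diff_distrib)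
    moreover have "of_nat (K * N) * a - of_nat K * (s - b) = of_nat K * (of_nat N * a - s) + of_nat K * b"
      by (simp add: algebra_simps)
    then have "of_nat (K * N) * a - of_nat K * (s - b) \<in> elts \<Lambda>"
      using elts_add[OF elts_of_nat_mult[OF s(2)] b(3)] by simp
    ultimately show ?thesis by blast
  qed
  then show ?case using K(1) N(1) by (intro exI[of _ "K * N"]) auto
qed

text \<open>
  Elements of \<open>L\<close> that annihilate the radical lie in \<open>\<Lambda>\<close> up to the factor \<open>N1\<close>, because they
  multiply \<open>L\<close> through its projection only. By \<open>annihilator_split\<close> the same holds, with
  another factor \<open>N\<close>, for the elements \<open>a\<close> with \<open>a Rs \<subseteq> \<Lambda>\<close>, where \<open>Rs\<close> is a basis of the radical
  inside \<open>\<Lambda>\<close>. Iterating this \<open>k\<close> times covers all \<open>a\<close> whose products with \<open>k\<close> factors from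
  \<open>Rs\<close> lie in \<open>\<Lambda>\<close>; for large \<open>k\<close> these products vanish.
\<close>

lemma lattice_bounded_by_order:
  assumes \<Lambda>: "A.is_order \<Lambda>" and N1: "N1 > 0"
  shows "\<exists>N>0. \<forall>L. 1 \<in> elts L \<longrightarrow> order_of UNIV (elts L) = elts \<Lambda> \<longrightarrow>
    (\<forall>l\<in>elts L. of_nat N1 * pr F l \<in> elts \<Lambda>) \<longrightarrow> cyc (of_nat N) * L \<le> \<Lambda>"
proof -
  have full: "full UNIV \<Lambda>" using \<Lambda> by (simp add: A.is_order_def)
  obtain Rs where "finite Rs" "independent Rs" "Rs \<subseteq> elts \<Lambda>" "Rs \<subseteq> radical" "span Rs = radical"
    by (rule basis_in_order[OF full subspace_radical])
  note Rs = this(1,3,4,5)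
  obtain k where k: "\<forall>X. set_mset X \<subseteq> Rs \<longrightarrow> size X = k \<longrightarrow> prod_mset X = 0"
    using products_vanish[OF Rs(1,3)] by (elim exE) (rule that)
  obtain N2 where N2: "N2 > 0" "\<forall>a. (\<forall>r\<in>Rs. a * r \<in> elts \<Lambda>) \<longrightarrow>
    (\<exists>s. (\<forall>r\<in>Rs. s * r = 0) \<and> of_nat N2 * a - s \<in> elts \<Lambda>)"
    using annihilator_split[OF \<Lambda> Rs(1,2)] by (elim exE conjE) (rule that)
  define N where "N = N1 * N2"
  have "cyc (of_nat (N ^ k)) * L \<le> \<Lambda>"
    if one: "1 \<in> elts L" and ord: "order_of UNIV (elts L) = elts \<Lambda>"
      and prL: "\<forall>l\<in>elts L. of_nat N1 * pr F l \<in> elts \<Lambda>" for L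
  proof -
    have absorb: "L * \<Lambda> = L" by (rule A.order_of_absorb[OF \<Lambda> ord])
    have mem: "x * y \<in> elts L" if "x \<in> elts L" "y \<in> elts \<Lambda>" for x y
      using zmod_mult_mem[OF that] absorb by simp
    have \<Lambda>L: "\<Lambda> \<le> L" using mem[OF one] by (intro zmod_leI) simp
    have kill: "of_nat N1 * a \<in> elts \<Lambda>" if a: "a \<in> elts L" "\<forall>r\<in>Rs. a * r = 0" for a
    proof -
      have zero: "a * x = 0" if "x \<in> radical" for x
        using that[unfolded Rs(4)[symmetric]]
        by (induction rule: span_induct_alt) (use a(2) in \<open>auto simp: distrib_left scale_mult_right\<close>)
      have "cyc (of_nat N1 * a) * L \<le> L"
        unfolding cyc_mult_le_iff
      proof
        fix l assume l: "l \<in> elts L"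
        have "of_nat N1 * a * l = a * (of_nat N1 * pr F l) + of_nat N1 * (a * (l - pr F l))"
          by (simp add: algebra_simps)
        also have "\<dots> = a * (of_nat N1 * pr F l)" using zero[OF pr_diff] by simp
        finally show "of_nat N1 * a * l \<in> elts L" using mem[OF a(1)] prL l by simp
      qed
      then have "cyc (of_nat N1 * a) \<le> \<Lambda>" using A.order_of_eqD(2)[OF ord] by simp
      then show ?thesis by (simp add: cyc_le_iff)
    qed
    have step: "of_nat N * a \<in> elts \<Lambda>" if a: "a \<in> elts L" "\<forall>r\<in>Rs. a * r \<in> elts \<Lambda>" for a
    proof -
      obtain s where s: "\<forall>r\<in>Rs. s * r = 0" "of_nat N2 * a - s \<in> elts \<Lambda>" using N2(2) a(2) by blast
      have "of_nat N2 * a - (of_nat N2 * a - s) \<in> elts L"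
        using elts_of_nat_mult[OF a(1)] s(2) zmod_leD[OF \<Lambda>L] elts_diff by blast
      then have "of_nat N1 * s \<in> elts \<Lambda>" using kill[of s] s(1) by simp
      moreover have "of_nat N * a = of_nat N1 * (of_nat N2 * a - s) + of_nat N1 * s"
        by (simp add: N_def algebra_simps)
      ultimately show ?thesis using elts_add[OF elts_of_nat_mult[OF s(2)]] by simp
    qed
    have "of_nat (N ^ j) * a \<in> elts \<Lambda>"
      if "a \<in> elts L" "\<And>X. set_mset X \<subseteq> Rs \<Longrightarrow> size X = j \<Longrightarrow> a * prod_mset X \<in> elts \<Lambda>" for j a
      using that
    proof (induction j arbitrary: a)
      case 0
      then show ?case using 0(2)[of "{#}"] by simp
    next
      case (Suc j)
      have "of_nat (N ^ j) * (a * r) \<in> elts \<Lambda>" if r: "r \<in> Rs" for r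
      proof (rule Suc.IH)
        show "a * r \<in> elts L" using mem Suc.prems(1) Rs(2) r by blast
        fix X assume "set_mset X \<subseteq> Rs" "size X = j"
        then have "a * prod_mset (add_mset r X) \<in> elts \<Lambda>" using r by (intro Suc.prems(2)) auto
        then show "a * r * prod_mset X \<in> elts \<Lambda>" by (simp add: mult.assoc)
      qed
      then have "of_nat N * (of_nat (N ^ j) * a) \<in> elts \<Lambda>"
        using Suc.prems(1) by (intro step elts_of_nat_mult ballI) (auto simp: mult.assoc)
      then show ?case by (simp add: mult.assoc)
    qed
    then have "of_nat (N ^ k) * a \<in> elts \<Lambda>" if "a \<in> elts L" for a
      using that k by simp
    then show ?thesis by (simp add: cyc_mult_le_iff)
  qed
  then show ?thesis using N1 N2(1) by (intro exI[of _ "N ^ k"]) (auto simp: N_def)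
qed

definition prl :: "'a zmod \<Rightarrow> 'a zmod" where
  "prl L = gen (pr F ` elts L)"

lemma elts_prl: "elts (prl L) = pr F ` elts L"
proof -
  have "zmodule.subspace (pr F ` elts L)"
    unfolding zmodule.subspace_def
  proof safe
    show "0 \<in> pr F ` elts L" using pr_of_nat[of 0] by (metis elts_zero image_eqI of_nat_0)
    show "pr F x + pr F y \<in> pr F ` elts L" if "x \<in> elts L" "y \<in> elts L" for x y
      using that elts_add by (metis image_eqI pr_add)
    show "of_int c * pr F x \<in> pr F ` elts L" if "x \<in> elts L" for c x
      using that elts_of_int_mult by (metis image_eqI pr_mult pr_of_int)
  qed
  then show ?thesis unfolding prl_def elts_gen using zmodule.span_eq_iff by blast
qed

lemma full_prl:
  assumes "full UNIV L"
  shows "full F (prl L)"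
proof -
  obtain X where X: "finite X" "L = gen X" using assms unfolding full_def fg_def by blast
  have "prl L = gen (pr F ` X)"
  proof (rule antisym)
    have "pr F x \<in> elts (gen (pr F ` X))" if "x \<in> int_span X" for x
      using that
    proof (induction rule: zmodule.span_induct_alt)
      case base
      then show ?case using pr_of_nat[of 0] by simp
    next
      case (step c x y)
      have "pr F (of_int c * x + y) = of_int c * pr F x + pr F y"
        by (simp add: pr_add pr_mult pr_of_int)
      moreover have "of_int c * pr F x \<in> elts (gen (pr F ` X))"
        using step by (intro elts_of_int_mult gen_base) blast
      ultimately show ?case using elts_add step by simp
    qed
    then show "prl L \<le> gen (pr F ` X)" using X(2) by (auto simp: less_eq_zmod_def elts_prl elts_gen)
    show "gen (pr F ` X) \<le> prl L" using X(2) gen_base unfolding gen_le_iff elts_prl by blast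
  qed
  then have "fg (prl L)" using X(1) fg_gen[of "pr F ` X"] by simp
  moreover have "\<exists>N>0. of_nat N * b \<in> elts (prl L)" if b: "b \<in> F" for b
  proof -
    obtain N where N: "N > 0" "of_nat N * b \<in> elts L" using assms unfolding full_def by blast
    have "of_nat N * b = pr F (of_nat N * b)" by (simp add: pr_mult pr_of_nat pr_F[OF b])
    then show ?thesis using N elts_prl by blast
  qed
  moreover have "elts (prl L) \<subseteq> F" unfolding elts_prl using pr_mem by (rule image_subsetI)
  ultimately show ?thesis unfolding full_def by blast
qed

text \<open>
  Up to a unit, \<open>L\<close> contains \<open>1\<close>, so \<open>\<Lambda> \<le> L\<close>; and \<open>N L \<le> \<Lambda>\<close> by \<open>lattice_bounded_by_order\<close>.
\<close>

theorem finite_classes_with_order: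
  assumes \<Lambda>: "A.is_order \<Lambda>"
  shows "finite (eps_classes_with_order scale UNIV (elts \<Lambda>))"
proof -
  have full: "full UNIV \<Lambda>" using \<Lambda> by (simp add: A.is_order_def)
  obtain N1 where N1: "N1 > 0" and gen: "\<And>P. full F P \<Longrightarrow> (\<forall>l\<in>elts \<Lambda> \<inter> F. \<forall>p\<in>elts P. l * p \<in> elts P) \<Longrightarrow>
    (\<exists>x\<in>elts P. F.unit x \<and> (\<forall>p\<in>elts P. \<exists>l\<in>elts \<Lambda>. of_nat N1 * p = x * l))"
    using lattice_generator[OF full] by blast
  obtain N where N: "N > 0" and bound: "\<And>L. 1 \<in> elts L \<Longrightarrow> order_of UNIV (elts L) = elts \<Lambda> \<Longrightarrow>
    (\<forall>l\<in>elts L. of_nat N1 * pr F l \<in> elts \<Lambda>) \<Longrightarrow> cyc (of_nat N) * L \<le> \<Lambda>"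
    using lattice_bounded_by_order[OF \<Lambda> N1] by blast
  define S where "S = {L. \<Lambda> \<le> L \<and> cyc (of_nat N) * L \<le> \<Lambda>}"
  have inj: "inj_on (\<lambda>L. cyc (of_nat N) * L) S"
  proof (rule inj_onI)
    fix L K :: "'a zmod" assume "cyc (of_nat N) * L = cyc (of_nat N) * K"
    moreover have inv: "of_nat N * scale (1 / of_nat N) 1 = (1 :: 'a)"
      by (rule of_nat_scale_inverse[OF N])
    have "L = cyc (scale (1 / of_nat N) 1) * (cyc (of_nat N) * L)" for L
      using cyc_cancel[OF inv, of L "cyc (of_nat N) * L"] by simp
    ultimately show "L = K" by metis
  qed
  have "(\<lambda>L. cyc (of_nat N) * L) ` S \<subseteq> {K. cyc (of_nat N) * \<Lambda> \<le> K \<and> K \<le> \<Lambda>}"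
    unfolding S_def using zmod_mult_mono[OF order_refl] by blast
  moreover have "finite {K. cyc (of_nat N) * \<Lambda> \<le> K \<and> K \<le> \<Lambda>}"
    using full by (intro finite_between[OF _ N]) (simp add: full_def)
  ultimately have "finite ((\<lambda>L. cyc (of_nat N) * L) ` S)" by (rule finite_subset)
  then have "finite S" using inj by (rule finite_imageD)
  moreover have "eps_classes_with_order scale UNIV (elts \<Lambda>) \<subseteq> A.ecl ` S"
  proof
    fix C assume "C \<in> eps_classes_with_order scale UNIV (elts \<Lambda>)"
    then obtain L where L: "C = A.ecl L" "full UNIV L" "order_of UNIV (elts L) = elts \<Lambda>"
      unfolding A.classes_with_order_iff by blast
    have absorb: "L * \<Lambda> = L" by (rule A.order_of_absorb[OF \<Lambda> L(3)])
    define P where "P = prl L"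
    have P: "elts P = pr F ` elts L" "full F P" using elts_prl full_prl[OF L(2)] by (simp_all add: P_def)
    have "l * p \<in> elts P" if l: "l \<in> elts \<Lambda> \<inter> F" and p: "p \<in> elts P" for l p
    proof -
      obtain y where y: "y \<in> elts L" "p = pr F y" using p P(1) by blast
      have "y * l \<in> elts L" using zmod_mult_mem[OF y(1), of l \<Lambda>] l absorb by simp
      moreover have "l * p = pr F (y * l)" using l by (simp add: y pr_mult pr_F mult.commute)
      ultimately show ?thesis using P(1) by blast
    qed
    then have "\<forall>l\<in>elts \<Lambda> \<inter> F. \<forall>p\<in>elts P. l * p \<in> elts P" by simp
    then have "\<exists>x\<in>elts P. F.unit x \<and> (\<forall>p\<in>elts P. \<exists>l\<in>elts \<Lambda>. of_nat N1 * p = x * l)"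
      by (rule gen[OF P(2)])
    then obtain x where x: "x \<in> elts P" "F.unit x"
      "\<forall>p\<in>elts P. \<exists>l\<in>elts \<Lambda>. of_nat N1 * p = x * l"
      by (elim bexE conjE) (rule that)
    obtain u where u: "u \<in> elts L" "pr F u = x" using x(1) unfolding P(1) by blast
    have "A.unit u" using unit_if_pr_unit u(2) x(2) by simp
    then obtain v where v: "A.unit v" "u * v = 1" using A.unit_inverse by blast
    define L' where "L' = cyc v * L"
    have ord: "order_of UNIV (elts L') = elts \<Lambda>"
      unfolding L'_def using A.order_of_unit_mult[OF v(1)] L(3) by simp
    have one: "1 \<in> elts L'"
      unfolding L'_def elts_cyc_mult using u(1) v(2) by (metis image_eqI mult.commute)
    have "of_nat N1 * pr F l \<in> elts \<Lambda>" if l: "l \<in> elts L'" for l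
    proof -
      obtain y where y: "y \<in> elts L" "l = v * y" using l unfolding L'_def elts_cyc_mult by blast
      have "pr F y \<in> elts P" unfolding P(1) using y(1) by (rule imageI)
      then obtain m where m: "m \<in> elts \<Lambda>" "of_nat N1 * pr F y = x * m" using x(3) by blast
      have "pr F u * pr F v = 1" using v(2) pr_mult pr_one by metis
      then have xv: "x * pr F v = 1" using u(2) by simp
      have "of_nat N1 * pr F l = pr F v * (of_nat N1 * pr F y)"
        by (simp add: y(2) pr_mult mult.left_commute)
      also have "\<dots> = (x * pr F v) * m" unfolding m(2) by (simp add: mult_ac)
      finally show ?thesis using xv m(1) by simp
    qed
    then have "cyc (of_nat N) * L' \<le> \<Lambda>" using bound one ord by blast
    moreover have "\<Lambda> \<le> L'"
    proof (rule zmod_leI)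
      fix y assume "y \<in> elts \<Lambda>"
      then have "1 * y \<in> elts (L' * \<Lambda>)" using one by (rule_tac zmod_mult_mem)
      then show "y \<in> elts L'" using A.order_of_absorb[OF \<Lambda> ord] by simp
    qed
    ultimately have "L' \<in> S" by (simp add: S_def)
    moreover have "C = A.ecl L'" unfolding L'_def using A.ecl_unit_mult[OF v(1) L(2)] L(1) by simp
    ultimately show "C \<in> A.ecl ` S" by blast
  qed
  ultimately show ?thesis using finite_surj by blast
qed

end

section \<open>The canonical decomposition\<close>

lemma ring_on_simps [simp]:
  "carrier (ring_on A e) = A" "monoid.mult (ring_on A e) = (*)" "monoid.one (ring_on A e) = e"
  "ring.zero (ring_on A e) = 0" "ring.add (ring_on A e) = (+)"
  by (simp_all add: ring_on_def)

lemma ideal_ring_on_iff: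
  assumes ring: "cring (ring_on A e)" and neg: "\<forall>x\<in>A. - x \<in> A"
  shows "ideal J (ring_on A e) \<longleftrightarrow> J \<subseteq> A \<and> 0 \<in> J \<and> (\<forall>x\<in>J. \<forall>y\<in>J. x + y \<in> J) \<and>
    (\<forall>x\<in>J. \<forall>a\<in>A. a * x \<in> J)"
proof
  assume J: "ideal J (ring_on A e)"
  interpret J: ideal J "ring_on A e" by (rule J)
  show "J \<subseteq> A \<and> 0 \<in> J \<and> (\<forall>x\<in>J. \<forall>y\<in>J. x + y \<in> J) \<and> (\<forall>x\<in>J. \<forall>a\<in>A. a * x \<in> J)"
    using J.a_subset additive_subgroup.zero_closed[OF J.additive_subgroup_axioms]
      additive_subgroup.a_closed[OF J.additive_subgroup_axioms] J.I_l_closed by auto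
next
  interpret cring "ring_on A e" by (rule ring)
  have e: "e \<in> A" using one_closed by simp
  have ex: "e * x = x" if "x \<in> A" for x using l_one[of x] that by simp
  assume J: "J \<subseteq> A \<and> 0 \<in> J \<and> (\<forall>x\<in>J. \<forall>y\<in>J. x + y \<in> J) \<and> (\<forall>x\<in>J. \<forall>a\<in>A. a * x \<in> J)"
  have negJ: "- x \<in> J" if x: "x \<in> J" for x
  proof -
    have "(- e) * x \<in> J" using J x neg e by blast
    moreover have "(- e) * x = - x" using ex[of x] J x by auto
    ultimately show ?thesis by simp
  qed
  show "ideal J (ring_on A e)"
  proof (rule idealI)
    show "ring (ring_on A e)" by (rule ring_axioms)
    show "subgroup J (add_monoid (ring_on A e))"
    proof
      show "J \<subseteq> carrier (add_monoid (ring_on A e))" using J by simp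
      show "\<one>\<^bsub>add_monoid (ring_on A e)\<^esub> \<in> J" using J by simp
      show "x \<otimes>\<^bsub>add_monoid (ring_on A e)\<^esub> y \<in> J" if "x \<in> J" "y \<in> J" for x y
        using J that by simp
      show "inv\<^bsub>add_monoid (ring_on A e)\<^esub> x \<in> J" if x: "x \<in> J" for x
      proof -
        have "inv\<^bsub>add_monoid (ring_on A e)\<^esub> x = - x"
          by (rule group.inv_equality[OF a_group]) (use J x neg in auto)
        then show ?thesis using negJ[OF x] by simp
      qed
    qed
    show "x \<otimes>\<^bsub>ring_on A e\<^esub> a \<in> J" if "a \<in> J" "x \<in> carrier (ring_on A e)" for a x
      using J that by simp
    show "a \<otimes>\<^bsub>ring_on A e\<^esub> x \<in> J" if "a \<in> J" "x \<in> carrier (ring_on A e)" for a x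
      using J that by (simp add: mult.commute[of a])
  qed
qed

context fin_dim_rat_algebra
begin

lemma subspace_eq_if_dim_le:
  assumes "subspace S" "subspace T" "S \<subseteq> T" "dim T \<le> dim S"
  shows "S = T"
proof -
  obtain X where X: "finite X" "independent X" "span X = UNIV"
    using finite_basis_of_subspace[OF subspace_UNIV] by metis
  interpret fd: finite_dimensional_vector_space scale X
    by unfold_locales (use X in auto)
  show ?thesis using fd.subspace_dim_equal assms by blast
qed

lemma dim_le_UNIV: "dim S \<le> dim (UNIV :: 'a set)"
proof -
  obtain X where X: "finite X" "independent X" "span X = UNIV"
    using finite_basis_of_subspace[OF subspace_UNIV] by metis
  interpret fd: finite_dimensional_vector_space scale X
    by unfold_locales (use X in auto)
  show ?thesis by (rule fd.dim_subset) simp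
qed

text \<open>
  The dimensions of the ideals generated by the powers of \<open>x\<close> cannot decrease forever.
\<close>

lemma power_stabilizes:
  fixes x :: 'a
  shows "\<exists>m z. m \<ge> 1 \<and> x ^ m = x ^ Suc m * z"
proof -
  define S where "S m = range (\<lambda>a. x ^ m * a)" for m
  have sub: "subspace (S m)" for m
    unfolding S_def by (rule subspace_mult_image[OF subspace_UNIV])
  have dec: "S (Suc m) \<subseteq> S m" for m
  proof
    fix u assume "u \<in> S (Suc m)"
    then obtain a where "u = x ^ Suc m * a" unfolding S_def by blast
    then have "u = x ^ m * (x * a)" by (simp add: mult_ac)
    then show "u \<in> S m" unfolding S_def by blast
  qed
  obtain m where m: "m \<ge> 1" "\<And>l. l \<ge> 1 \<Longrightarrow> dim (S m) \<le> dim (S l)"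
    using ex_has_least_nat[of "\<lambda>m. m \<ge> 1" 1 "\<lambda>m. dim (S m)"] by auto
  have "S (Suc m) = S m"
    using subspace_eq_if_dim_le[OF sub sub dec] m by simp
  moreover have "x ^ m * 1 \<in> S m" unfolding S_def by blast
  ultimately have "x ^ m \<in> S (Suc m)" by simp
  then show ?thesis using m(1) unfolding S_def by blast
qed

text \<open>
  In a local summand every element outside the maximal ideal is invertible: otherwise a proper
  ideal of maximal dimension among those that contain it would be a second maximal ideal.
\<close>

lemma local_summand_unit:
  assumes ring: "cring (ring_on A e)" and A: "subspace A"
    and N: "maximalideal N (ring_on A e)" and uniq: "\<And>J. maximalideal J (ring_on A e) \<Longrightarrow> J = N"
    and u: "u \<in> A" "u \<notin> N"
  shows "\<exists>v\<in>A. u * v = e"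
proof (rule ccontr)
  assume nu: "\<not> (\<exists>v\<in>A. u * v = e)"
  interpret R: cring "ring_on A e" by (rule ring)
  have e: "e \<in> A" using R.one_closed by simp
  have ex: "e * x = x" if "x \<in> A" for x using R.l_one[of x] that by simp
  have mult: "x * y \<in> A" if "x \<in> A" "y \<in> A" for x y using R.m_closed that by simp
  have neg: "\<forall>x\<in>A. - x \<in> A" using subspace_neg[OF A] by blast
  note ideal_iff = ideal_ring_on_iff[OF ring neg]
  define Pr where "Pr J \<longleftrightarrow> ideal J (ring_on A e) \<and> u \<in> J \<and> e \<notin> J" for J
  have "Pr ((*) u ` A)"
    unfolding Pr_def ideal_iff
  proof (intro conjI ballI)
    show "(*) u ` A \<subseteq> A" using mult u by blast
    note sub = subspace_mult_image[OF A, of u]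
    show "0 \<in> (*) u ` A" by (rule subspace_0[OF sub])
    show "x + y \<in> (*) u ` A" if "x \<in> (*) u ` A" "y \<in> (*) u ` A" for x y
      using subspace_add[OF sub that] .
    show "a * x \<in> (*) u ` A" if x: "x \<in> (*) u ` A" and a: "a \<in> A" for a x
    proof -
      obtain b where b: "b \<in> A" "x = u * b" using x by blast
      then have "a * x = u * (a * b)" by (simp add: mult.left_commute)
      then show ?thesis using mult[OF a b(1)] by blast
    qed
    have "u = u * e" using ex[OF u(1)] by (simp add: mult.commute)
    then show "u \<in> (*) u ` A" using e by blast
    show "e \<notin> (*) u ` A" using nu by force
  qed
  then obtain J where J: "Pr J" and max: "\<And>K. Pr K \<Longrightarrow> dim K \<le> dim J"
    using ex_has_greatest_nat[of Pr "(*) u ` A" dim "Suc (dim (UNIV :: 'a set))"] dim_le_UNIV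
    by (metis less_Suc_eq_le)
  have sub: "subspace K" if "ideal K (ring_on A e)" for K
  proof -
    have K: "K \<subseteq> A" "0 \<in> K" "\<And>x y. x \<in> K \<Longrightarrow> y \<in> K \<Longrightarrow> x + y \<in> K" "\<And>x a. x \<in> K \<Longrightarrow> a \<in> A \<Longrightarrow> a * x \<in> K"
      using that unfolding ideal_iff by blast+
    have "scale c x \<in> K" if "x \<in> K" for c x
    proof -
      have "scale c e * x \<in> K" using K(4)[OF that] subspace_scale[OF A e] by blast
      moreover have "scale c e * x = scale c x" using ex[of x] that K(1) by (auto simp: scale_mult_left)
      ultimately show ?thesis by simp
    qed
    then show ?thesis using K unfolding subspace_def by blast
  qed
  have "maximalideal J (ring_on A e)"
  proof (rule maximalidealI)
    show "ideal J (ring_on A e)" using J unfolding Pr_def by blast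
    show "carrier (ring_on A e) \<noteq> J" using J e unfolding Pr_def by auto
    fix K assume K: "ideal K (ring_on A e)" "J \<subseteq> K" "K \<subseteq> carrier (ring_on A e)"
    show "K = J \<or> K = carrier (ring_on A e)"
    proof (cases "e \<in> K")
      case True
      have "x \<in> K" if "x \<in> A" for x
        using K(1) True that ex[OF that] unfolding ideal_iff by (metis mult.commute)
      then show ?thesis using K(3) by auto
    next
      case False
      then have "Pr K" using J K unfolding Pr_def by blast
      then show ?thesis
        using subspace_eq_if_dim_le[OF sub sub K(2)] max[of K] J K(1) unfolding Pr_def by blast
    qed
  qed
  then have "J = N" by (rule uniq)
  then show False using J u(2) unfolding Pr_def by blast
qed

text \<open>
  The radical is the sum of the maximal ideals \<open>Ns j\<close>. Their elements are nilpotent: for \<open>n\<close> in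
  \<open>Ns j\<close> there are \<open>m\<close> and \<open>z\<close> with \<open>n\<^sup>m (e j - n z) = 0\<close>, and the second factor is a unit of the
  summand since it lies outside \<open>Ns j\<close>. Conversely, the components in \<open>Fs j\<close> of a nilpotent
  element of \<open>F\<close> are nilpotent elements of fields.
\<close>

lemma separable_part_split:
  assumes "separable_part scale F"
  shows "\<exists>E. split_algebra scale F E"
proof -
  obtain k As Fs Ns where D: "canonical_decomposition scale k As Fs Ns"
    and F: "F = {\<Sum>j=1..k. c j | c. \<forall>j\<in>{1..k}. c j \<in> Fs j}"
    using assms unfolding separable_part_def by blast
  let ?I = "{1..k}"
  have dec: "\<exists>c. (\<forall>j\<in>?I. c j \<in> As j) \<and> x = (\<Sum>j\<in>?I. c j)" for x
    using D unfolding canonical_decomposition_def by (meson PiE_mem)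
  have ortho: "x * y = 0" if "i \<in> ?I" "j \<in> ?I" "i \<noteq> j" "x \<in> As i" "y \<in> As j" for i j x y
    using D that unfolding canonical_decomposition_def by blast
  have "\<forall>j\<in>?I. \<exists>e. local_subalgebra scale (As j) e \<and>
        Fs j \<subseteq> As j \<and> subspace (Fs j) \<and> field (ring_on (Fs j) e) \<and>
        maximalideal (Ns j) (ring_on (As j) e) \<and>
        (\<forall>x\<in>As j. \<exists>!p. p \<in> Fs j \<times> Ns j \<and> x = fst p + snd p)"
    using D unfolding canonical_decomposition_def by blast
  from bchoice[OF this] obtain e where e: "\<forall>j\<in>?I. local_subalgebra scale (As j) (e j) \<and>
        Fs j \<subseteq> As j \<and> subspace (Fs j) \<and> field (ring_on (Fs j) (e j)) \<and>
        maximalideal (Ns j) (ring_on (As j) (e j)) \<and>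
        (\<forall>x\<in>As j. \<exists>!p. p \<in> Fs j \<times> Ns j \<and> x = fst p + snd p)"
    by (elim exE) (rule that)
  have loc: "subspace (As j)" "cring (ring_on (As j) (e j))" "\<exists>!N. maximalideal N (ring_on (As j) (e j))"
    if "j \<in> ?I" for j using e that unfolding local_subalgebra_def by blast+
  have FA: "Fs j \<subseteq> As j" and subF: "subspace (Fs j)" and fieldF: "field (ring_on (Fs j) (e j))"
    and maxN: "maximalideal (Ns j) (ring_on (As j) (e j))"
    if "j \<in> ?I" for j using e that by blast+
  have FN: "\<exists>f\<in>Fs j. \<exists>n\<in>Ns j. x = f + n" if jx: "j \<in> ?I" "x \<in> As j" for j x
  proof -
    have "\<exists>!p. p \<in> Fs j \<times> Ns j \<and> x = fst p + snd p" using e jx by blast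
    then obtain p where "p \<in> Fs j \<times> Ns j" "x = fst p + snd p" by (elim ex1E conjE) (rule that)
    then show ?thesis by (intro bexI[of _ "fst p"] bexI[of _ "snd p"]) auto
  qed
  have eA: "e j \<in> As j" and eid: "\<And>x. x \<in> As j \<Longrightarrow> e j * x = x"
    and multA: "\<And>x y. x \<in> As j \<Longrightarrow> y \<in> As j \<Longrightarrow> x * y \<in> As j" if "j \<in> ?I" for j
  proof -
    interpret R: cring "ring_on (As j) (e j)" using loc(2) that .
    show "e j \<in> As j" using R.one_closed by simp
    show "e j * x = x" if "x \<in> As j" for x using R.l_one[of x] that by simp
    show "x * y \<in> As j" if "x \<in> As j" "y \<in> As j" for x y using R.m_closed that by simp
  qed
  have eF: "e j \<in> Fs j" and e0: "e j \<noteq> 0" and multF: "\<And>x y. x \<in> Fs j \<Longrightarrow> y \<in> Fs j \<Longrightarrow> x * y \<in> Fs j"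
    and invF: "\<And>x. x \<in> Fs j \<Longrightarrow> x \<noteq> 0 \<Longrightarrow> \<exists>y\<in>Fs j. x * y = e j" if "j \<in> ?I" for j
  proof -
    interpret R: field "ring_on (Fs j) (e j)" using fieldF that .
    show "e j \<in> Fs j" using R.one_closed by simp
    show "e j \<noteq> 0" using R.one_not_zero by simp
    show "x * y \<in> Fs j" if "x \<in> Fs j" "y \<in> Fs j" for x y using R.m_closed that by simp
    show "\<exists>y\<in>Fs j. x * y = e j" if "x \<in> Fs j" "x \<noteq> 0" for x
    proof -
      have "x \<in> Units (ring_on (Fs j) (e j))" using R.field_Units that by simp
      then show ?thesis unfolding Units_def by auto
    qed
  qed
  have comp: "x * (\<Sum>i\<in>?I. c i) = x * c j"
    if j: "j \<in> ?I" and x: "x \<in> As j" and c: "\<forall>i\<in>?I. c i \<in> As i" for j x c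
  proof -
    have "x * (\<Sum>i\<in>?I. c i) = (\<Sum>i\<in>?I. if i = j then x * c j else 0)"
      unfolding sum_distrib_left using ortho j x c by (intro sum.cong) auto
    then show ?thesis using j by simp
  qed
  have ideal_A: "x * a \<in> As j" if j: "j \<in> ?I" and x: "x \<in> As j" for j x a
  proof -
    obtain c where "\<forall>i\<in>?I. c i \<in> As i" "a = (\<Sum>i\<in>?I. c i)" using dec by blast
    then show ?thesis using comp[OF j x] multA[OF j x] j by auto
  qed
  have one: "1 = (\<Sum>j\<in>?I. e j)"
  proof -
    obtain c where c: "\<forall>i\<in>?I. c i \<in> As i" "1 = (\<Sum>i\<in>?I. c i)" using dec by blast
    have "c j = e j" if j: "j \<in> ?I" for j
    proof -
      have "e j = e j * c j" using comp[OF j eA[OF j] c(1)] c(2) by simp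
      then show ?thesis using eid[OF j] c(1) j by simp
    qed
    then show ?thesis using c(2) by simp
  qed
  have nil: "n \<in> radical" if j: "j \<in> ?I" and n: "n \<in> Ns j" for j n
  proof -
    interpret N: maximalideal "Ns j" "ring_on (As j) (e j)" using maxN[OF j] .
    have NI: "Ns j \<subseteq> As j" "\<And>x y. x \<in> Ns j \<Longrightarrow> y \<in> Ns j \<Longrightarrow> x + y \<in> Ns j"
      "\<And>x a. x \<in> Ns j \<Longrightarrow> a \<in> As j \<Longrightarrow> a * x \<in> Ns j"
      using ideal_ring_on_iff[OF loc(2)[OF j], of "Ns j"] subspace_neg[OF loc(1)[OF j]] N.ideal_axioms
      by blast+
    have eN: "e j \<notin> Ns j"
    proof
      assume "e j \<in> Ns j"
      then have "As j \<subseteq> Ns j" using NI(3) eid[OF j] by (metis mult.commute subsetI)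
      then show False using N.I_notcarr NI(1) by auto
    qed
    have nA: "n \<in> As j" using n NI(1) by blast
    obtain m z where mz: "m \<ge> 1" "n ^ m = n ^ Suc m * z" using power_stabilizes by blast
    have "n * z = (e j * z) * n" using eid[OF j nA] by (metis mult.commute mult.left_commute)
    moreover have "e j * z \<in> As j" using ideal_A[OF j eA[OF j]] .
    ultimately have nz: "n * z \<in> Ns j" using NI(3)[OF n] by simp
    define u where "u = e j - n * z"
    have "u \<in> As j" unfolding u_def using subspace_diff[OF loc(1)[OF j] eA[OF j]] nz NI(1) by blast
    moreover have "u \<notin> Ns j"
      using NI(2)[OF _ nz, of u] eN by (auto simp: u_def)
    ultimately obtain v where v: "v \<in> As j" "u * v = e j"
      using local_summand_unit[OF loc(2)[OF j] loc(1)[OF j] maxN[OF j]] loc(3)[OF j] maxN[OF j] by blast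
    have npow: "e j * n ^ m = n ^ m"
    proof -
      obtain l where "m = Suc l" using mz(1) by (cases m) auto
      then show ?thesis using eid[OF j nA] by (simp add: mult.assoc[symmetric])
    qed
    have "n ^ m * u = n ^ m - n ^ Suc m * z"
      using npow by (simp add: u_def right_diff_distrib mult_ac)
    then have "n ^ m * u = 0" by (simp only: mz(2)[symmetric] diff_self)
    then have "n ^ m * u * v = 0" by simp
    then have "n ^ m * e j = 0" using v(2) by (simp add: mult.assoc)
    then have "n ^ m = 0" using npow by (simp add: mult.commute)
    then show ?thesis unfolding radical_def by blast
  qed
  have mem_F: "(\<Sum>j\<in>?I. c j) \<in> F" if "\<And>j. j \<in> ?I \<Longrightarrow> c j \<in> Fs j" for c
    using that unfolding F by blast
  have F_obt: "\<exists>c. (\<forall>j\<in>?I. c j \<in> Fs j) \<and> x = (\<Sum>j\<in>?I. c j)" if "x \<in> F" for x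
    using that unfolding F by blast
  have Fs_F: "x \<in> F" if j: "j \<in> ?I" and x: "x \<in> Fs j" for j x
  proof -
    have "x = (\<Sum>i\<in>?I. if i = j then x else 0)" using j by simp
    also have "\<dots> \<in> F" using x subspace_0[OF subF] by (intro mem_F) auto
    finally show ?thesis .
  qed
  have proj: "e j * (\<Sum>i\<in>?I. c i) = c j" if j: "j \<in> ?I" and c: "\<forall>i\<in>?I. c i \<in> Fs i" for j c
  proof -
    have "\<forall>i\<in>?I. c i \<in> As i" using c FA by blast
    then show ?thesis using comp[OF j eA[OF j]] eid[OF j] j by simp
  qed
  have inj: "inj_on e ?I"
  proof (rule inj_onI, rule ccontr)
    fix i j assume ij: "i \<in> ?I" "j \<in> ?I" "e i = e j" "i \<noteq> j"
    have "e i * e j = 0" using ortho[OF ij(1,2,4) eA[OF ij(1)] eA[OF ij(2)]] .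
    then show False using eid[OF ij(1) eA[OF ij(1)]] ij(3) e0[OF ij(1)] by simp
  qed
  have "split_algebra scale F (e ` ?I)"
  proof
    show "subspace F"
      unfolding subspace_def
    proof (intro conjI ballI allI)
      show "0 \<in> F" using mem_F[of "\<lambda>_. 0"] subspace_0[OF subF] by simp
      fix x y assume "x \<in> F" "y \<in> F"
      then obtain c d where "\<forall>j\<in>?I. c j \<in> Fs j" "x = (\<Sum>j\<in>?I. c j)" "\<forall>j\<in>?I. d j \<in> Fs j" "y = (\<Sum>j\<in>?I. d j)"
        using F_obt by meson
      then show "x + y \<in> F"
        using mem_F[of "\<lambda>j. c j + d j"] subspace_add[OF subF] by (simp add: sum.distrib)
    next
      fix q x assume "x \<in> F"
      then obtain c where "\<forall>j\<in>?I. c j \<in> Fs j" "x = (\<Sum>j\<in>?I. c j)" using F_obt by meson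
      then show "scale q x \<in> F"
        using mem_F[of "\<lambda>j. scale q (c j)"] subspace_scale[OF subF] by (simp add: scale_sum_right)
    qed
    show "1 \<in> F" unfolding one using eF by (intro mem_F)
    show "x * y \<in> F" if xy: "x \<in> F" "y \<in> F" for x y
    proof -
      obtain c d where cd: "\<forall>j\<in>?I. c j \<in> Fs j" "x = (\<Sum>j\<in>?I. c j)" "\<forall>j\<in>?I. d j \<in> Fs j" "y = (\<Sum>j\<in>?I. d j)"
        using F_obt xy by meson
      have dA: "\<forall>j\<in>?I. d j \<in> As j" using cd(3) FA by blast
      have "x * y = (\<Sum>j\<in>?I. c j * (\<Sum>i\<in>?I. d i))" by (simp add: cd(2,4) sum_distrib_right)
      also have "\<dots> = (\<Sum>j\<in>?I. c j * d j)"
      proof (rule sum.cong)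
        fix j assume j: "j \<in> ?I"
        then have "c j \<in> As j" using cd(1) FA[OF j] by blast
        then show "c j * (\<Sum>i\<in>?I. d i) = c j * d j" using comp[OF j _ dA] by blast
      qed simp
      also have "\<dots> \<in> F" using cd multF by (intro mem_F) auto
      finally show ?thesis .
    qed
    show "x = 0" if x: "x \<in> F" "x \<in> radical" for x
    proof -
      obtain c where c: "\<forall>j\<in>?I. c j \<in> Fs j" "x = (\<Sum>j\<in>?I. c j)" using F_obt x(1) by meson
      have "c j = 0" if j: "j \<in> ?I" for j
      proof (rule ccontr)
        assume "c j \<noteq> 0"
        then obtain y where y: "c j * y = e j" using invF[OF j] c(1) j by blast
        have "c j = x * e j" using proj[OF j c(1)] c(2) by (simp add: mult.commute)
        then have "e j = x * (e j * y)" using y by (simp add: mult.assoc)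
        then have "e j \<in> radical" using radical_mult[OF x(2)] by metis
        then obtain n where n: "e j ^ n = 0" unfolding radical_def by blast
        have "e j ^ Suc i = e j" for i
          by (induction i) (simp_all add: eid[OF j eA[OF j]])
        then have "e j = 0" using n by (metis mult_zero_right power_Suc)
        then show False using e0[OF j] by simp
      qed
      then show ?thesis using c(2) by simp
    qed
    show "\<exists>y\<in>F. x - y \<in> radical" for x
    proof -
      obtain c where c: "\<forall>j\<in>?I. c j \<in> As j" "x = (\<Sum>j\<in>?I. c j)" using dec by blast
      have "\<forall>j\<in>?I. \<exists>f. f \<in> Fs j \<and> c j - f \<in> Ns j"
      proof
        fix j assume j: "j \<in> ?I"
        then obtain f n where "f \<in> Fs j" "n \<in> Ns j" "c j = f + n" using FN c(1) by meson
        then show "\<exists>f. f \<in> Fs j \<and> c j - f \<in> Ns j" by (intro exI[of _ f]) simp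
      qed
      from bchoice[OF this] obtain f where f: "\<forall>j\<in>?I. f j \<in> Fs j \<and> c j - f j \<in> Ns j" by blast
      have "x - (\<Sum>j\<in>?I. f j) = (\<Sum>j\<in>?I. c j - f j)" by (simp add: c(2) sum_subtractf)
      also have "\<dots> \<in> radical" using f nil by (intro subspace_sum[OF subspace_radical]) blast
      finally show ?thesis using mem_F[of f] f by blast
    qed
    show "finite (e ` ?I)" by simp
    show "e ` ?I \<subseteq> F" using eF Fs_F by blast
    show "\<Sum>(e ` ?I) = 1" using one sum.reindex[OF inj, of "\<lambda>x. x"] by (simp add: o_def)
    show "0 \<notin> e ` ?I" using e0 by force
    show "x * y = 0" if xy: "x \<in> e ` ?I" "y \<in> e ` ?I" "x \<noteq> y" for x y
    proof -
      obtain i j where ij: "i \<in> ?I" "x = e i" "j \<in> ?I" "y = e j" using xy(1,2) by blast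
      then have "i \<noteq> j" using xy(3) by blast
      then show ?thesis using ortho[OF ij(1,3) _ eA[OF ij(1)] eA[OF ij(3)]] ij by blast
    qed
    show "\<exists>y\<in>F. e' * x * y = e'" if e': "e' \<in> e ` ?I" "x \<in> F" "e' * x \<noteq> 0" for e' x
    proof -
      obtain j where j: "j \<in> ?I" "e' = e j" using e'(1) by blast
      obtain c where c: "\<forall>j\<in>?I. c j \<in> Fs j" "x = (\<Sum>j\<in>?I. c j)" using F_obt e'(2) by meson
      have ex: "e' * x = c j" using proj[OF j(1) c(1)] c(2) j(2) by simp
      have "c j \<in> Fs j" "c j \<noteq> 0" using c(1) j(1) e'(3) ex by auto
      then obtain y where y: "y \<in> Fs j" "c j * y = e j" using invF[OF j(1)] by blast
      have "e' * x * y = e'" using ex y(2) j(2) by simp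
      then show ?thesis using Fs_F[OF j(1) y(1)] by blast
    qed
  qed
  then show ?thesis by blast
qed

end

section \<open>Projection to the separable part\<close>

context split_algebra
begin

lemma pr_sum: "pr F (sum g I) = (\<Sum>i\<in>I. pr F (g i))"
  by (induction I rule: infinite_finite_induct) (use pr_of_nat[of 0] in \<open>auto simp: pr_add\<close>)

lemma prl_mult: "prl (L * K) = prl L * prl K"
proof (rule antisym)
  have "pr F x \<in> elts (prl L * prl K)" if x: "x \<in> elts (L * K)" for x
  proof -
    have "x \<in> lat_mult (elts L) (elts K)" using x by (simp add: lat_mult_elts)
    then obtain n a b where ab: "x = (\<Sum>i<n. a i * b i)" "\<forall>i<(n::nat). a i \<in> elts L \<and> b i \<in> elts K"
      unfolding lat_mult_def by blast
    have "pr F x = (\<Sum>i<n. pr F (a i) * pr F (b i))" by (simp add: ab(1) pr_sum pr_mult)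
    also have "\<dots> \<in> elts (prl L * prl K)"
      using ab(2) by (intro elts_sum zmod_mult_mem) (auto simp: elts_prl)
    finally show ?thesis .
  qed
  then show "prl (L * K) \<le> prl L * prl K" by (auto simp: less_eq_zmod_def elts_prl)
  show "prl L * prl K \<le> prl (L * K)"
    unfolding zmod_mult_le_iff elts_prl
  proof clarify
    fix x y assume "x \<in> elts L" "y \<in> elts K"
    then have "x * y \<in> elts (L * K)" by (rule zmod_mult_mem)
    then show "pr F x * pr F y \<in> pr F ` elts (L * K)" unfolding pr_mult[symmetric] by (rule imageI)
  qed
qed

lemma prl_F: "elts P \<subseteq> F \<Longrightarrow> prl P = P"
proof -
  assume P: "elts P \<subseteq> F"
  have "pr F ` elts P = (\<lambda>x. x) ` elts P" using P pr_F by (intro image_cong) auto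
  then have "elts (prl P) = elts P" by (simp add: elts_prl)
  then show ?thesis by (simp add: elts_inject)
qed

lemma prl_cyc: "prl (cyc a) = cyc (pr F a)"
proof (rule antisym)
  show "prl (cyc a) \<le> cyc (pr F a)"
    unfolding less_eq_zmod_def elts_prl
    by (auto simp: elts_gen zmodule.span_singleton pr_mult pr_of_int)
  show "cyc (pr F a) \<le> prl (cyc a)"
    unfolding cyc_le_iff elts_prl using gen_base[of a "{a}"] by blast
qed

text \<open>
  A lattice \<open>P\<close> in \<open>F\<close> is completed by the nilpotent parts of the generators of any full lattice.
\<close>

lemma prl_surj:
  assumes P: "full F P"
  shows "\<exists>L. full UNIV L \<and> prl L = P"
proof -
  obtain G :: "'a zmod" where G: "full UNIV G" using A.full_exists by blast
  obtain X where X: "finite X" "G = gen X" using G unfolding full_def fg_def by blast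
  define R0 where "R0 = gen ((\<lambda>x. x - pr F x) ` X)"
  obtain Z :: "'a zmod" where Z: "elts Z = radical" using subspace_imp_zmod[OF subspace_radical] by blast
  have "R0 \<le> Z" unfolding R0_def gen_le_iff Z using pr_diff by blast
  then have R0: "elts R0 \<subseteq> radical" using Z by (simp add: less_eq_zmod_def)
  have rest: "g - pr F g \<in> elts R0" if "g \<in> int_span X" for g
    using that
  proof (induction rule: zmodule.span_induct_alt)
    case base
    then show ?case using pr_of_nat[of 0] by simp
  next
    case (step c x y)
    have eq: "of_int c * x + y - pr F (of_int c * x + y) = of_int c * (x - pr F x) + (y - pr F y)"
      by (simp add: pr_add pr_mult pr_of_int algebra_simps)
    have "of_int c * (x - pr F x) \<in> elts R0"
      unfolding R0_def using step by (intro elts_of_int_mult gen_base) blast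
    then show ?case unfolding eq using step by (intro elts_add)
  qed
  define L where "L = P + R0"
  obtain t where t: "t > 0" "cyc (of_nat t) * prl G \<le> P"
    using F.full_absorb_denominator[OF P full_prl[OF G]] by blast
  have "\<exists>N>0. of_nat N * b \<in> elts L" for b
  proof -
    obtain N where N: "N > 0" "of_nat N * b \<in> elts G" using G unfolding full_def by blast
    define g where "g = of_nat N * b"
    have g: "g \<in> int_span X" using N(2) X(2) by (simp add: g_def elts_gen)
    have "of_nat t * pr F g \<in> elts P"
      using t(2) N(2) unfolding cyc_mult_le_iff elts_prl g_def by blast
    moreover have "of_nat t * (g - pr F g) \<in> elts R0" using rest[OF g] by (rule elts_of_nat_mult)
    moreover have "of_nat (t * N) * b = of_nat t * pr F g + of_nat t * (g - pr F g)"
      by (simp add: g_def algebra_simps)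
    ultimately have "of_nat (t * N) * b \<in> elts L" unfolding L_def elts_plus_iff by blast
    then show ?thesis using t(1) N(1) by (intro exI[of _ "t * N"]) simp
  qed
  moreover have "fg L"
    unfolding L_def R0_def using P X(1) by (intro fg_plus fg_gen) (auto simp: full_def)
  ultimately have "full UNIV L" by (simp add: full_def)
  moreover have "prl L = P"
  proof -
    have PF: "elts P \<subseteq> F" using P by (simp add: full_def)
    have sum: "pr F (p + r) = p" if "p \<in> elts P" "r \<in> elts R0" for p r
      using that PF R0 pr_F[of p] pr_radical[of r] by (simp add: pr_add subset_iff)
    have "pr F ` elts L = elts P"
    proof (rule equalityI; rule subsetI)
      fix x assume "x \<in> pr F ` elts L"
      then obtain l where "l \<in> elts L" "x = pr F l" by blast
      then show "x \<in> elts P" unfolding L_def elts_plus_iff using sum by auto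
    next
      fix x assume x: "x \<in> elts P"
      then have "x + 0 \<in> elts L" unfolding L_def elts_plus_iff using elts_zero by blast
      then show "x \<in> pr F ` elts L" using sum[OF x elts_zero] by (metis imageI)
    qed
    then have "elts (prl L) = elts P" by (simp add: elts_prl)
    then show ?thesis by (simp add: elts_inject)
  qed
  ultimately show ?thesis by blast
qed

lemma semigrp_epi_lattice: "semigrp_epi (lattice_sg scale UNIV) (lattice_sg scale F) (\<lambda>L. pr F ` L)"
  unfolding semigrp_epi_def
proof (intro conjI ballI)
  show "pr F ` sg_mult (lattice_sg scale UNIV) X Y = sg_mult (lattice_sg scale F) (pr F ` X) (pr F ` Y)"
    if XY: "X \<in> sg_carrier (lattice_sg scale UNIV)" "Y \<in> sg_carrier (lattice_sg scale UNIV)" for X Y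
  proof -
    obtain L K where "X = elts L" "Y = elts K" using XY unfolding A.lattice_sg_simps by blast
    then show ?thesis
      by (simp add: A.lattice_sg_simps(2) F.lattice_sg_simps(2) prl_mult flip: elts_prl)
  qed
  show "(\<lambda>L. pr F ` L) ` sg_carrier (lattice_sg scale UNIV) = sg_carrier (lattice_sg scale F)"
  proof (rule equalityI; rule subsetI)
    fix X assume "X \<in> (\<lambda>L. pr F ` L) ` sg_carrier (lattice_sg scale UNIV)"
    then obtain Y where Y: "Y \<in> sg_carrier (lattice_sg scale UNIV)" "X = pr F ` Y" by (rule imageE)
    from Y(1) obtain L where "Y = elts L" "full UNIV L" unfolding A.lattice_sg_simps(1) by blast
    then have "full F (prl L)" "X = elts (prl L)" using Y(2) full_prl elts_prl by simp_all
    then show "X \<in> sg_carrier (lattice_sg scale F)"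
      unfolding F.lattice_sg_simps(1) by blast
  next
    fix X assume "X \<in> sg_carrier (lattice_sg scale F)"
    then obtain P where P: "X = elts P" "full F P" unfolding F.lattice_sg_simps by blast
    then obtain L where L: "full UNIV L" "prl L = P" using prl_surj by blast
    then have "X = pr F ` elts L" using P(1) L(2) elts_prl[of L] by simp
    moreover have "elts L \<in> sg_carrier (lattice_sg scale UNIV)"
      unfolding A.lattice_sg_simps using L(1) by blast
    ultimately show "X \<in> (\<lambda>L. pr F ` L) ` sg_carrier (lattice_sg scale UNIV)" by blast
  qed
qed (rule A.comm_semigrp_lattice_sg F.comm_semigrp_lattice_sg)+

lemma order_prl: "A.is_order \<Lambda> \<Longrightarrow> F.is_order (prl \<Lambda>)"
proof -
  assume o: "A.is_order \<Lambda>"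
  have "prl \<Lambda> * prl \<Lambda> = prl \<Lambda>" using A.order_idem[OF o] by (metis prl_mult)
  moreover have "1 \<in> elts (prl \<Lambda>)"
    using o pr_one unfolding A.is_order_def elts_prl by (metis image_eqI)
  ultimately show ?thesis using o full_prl unfolding A.is_order_def F.is_order_def by auto
qed

lemma invl_prl: "A.invl \<Lambda> L \<Longrightarrow> F.invl (prl \<Lambda>) (prl L)"
  unfolding A.invl_def F.invl_def using full_prl prl_mult by metis

text \<open>
  The product \<open>\<Lambda> P\<close> has projection \<open>P\<close> but is invertible only over the larger order \<open>\<Lambda> pr \<Lambda>\<close>. It
  comes from a lattice that is invertible over \<open>\<Lambda>\<close>, which has the same projection because the two
  orders have the same projection.
\<close>

lemma invl_prl_lift:
  assumes o: "A.is_order \<Lambda>" and P: "F.invl (prl \<Lambda>) P"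
  shows "\<exists>L. A.invl \<Lambda> L \<and> prl L = P"
proof -
  have full: "full UNIV \<Lambda>" "1 \<in> elts \<Lambda>" using o by (auto simp: A.is_order_def)
  have oF: "F.is_order (prl \<Lambda>)" by (rule order_prl[OF o])
  obtain Q where Q: "full F Q" "P * Q = prl \<Lambda>" and fP: "full F P" "P * prl \<Lambda> = P"
    using P unfolding F.invl_def by blast
  define \<Lambda>1 where "\<Lambda>1 = \<Lambda> * prl \<Lambda>"
  have full_mult: "full UNIV (\<Lambda> * K)" if K: "full F K" for K
  proof -
    obtain N where N: "N > 0" "of_nat N * 1 \<in> elts K" using K one_F unfolding full_def by blast
    have "full UNIV (cyc (of_nat N) * \<Lambda>)"
      using A.full_unit_mult[OF A.unit_of_nat[OF N(1)] full(1)] .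
    moreover have "cyc (of_nat N) * \<Lambda> \<le> K * \<Lambda>"
      using N(2) by (intro zmod_mult_mono order_refl) (simp add: cyc_le_iff)
    moreover have "fg (K * \<Lambda>)" using K full(1) by (intro fg_times) (auto simp: full_def)
    ultimately have "full UNIV (K * \<Lambda>)" by (rule A.full_between) simp
    then show ?thesis by (simp add: mult.commute)
  qed
  have one1: "1 \<le> prl \<Lambda>" using oF by (simp add: F.is_order_def one_le_iff)
  have le: "\<Lambda> \<le> \<Lambda>1" using zmod_mult_mono[OF order_refl one1, of \<Lambda>] by (simp add: \<Lambda>1_def)
  have idem: "\<Lambda> * \<Lambda> = \<Lambda>" "prl \<Lambda> * prl \<Lambda> = prl \<Lambda>"
    using A.order_idem[OF o] F.order_idem[OF oF] by auto
  have "\<Lambda>1 * \<Lambda>1 = (\<Lambda> * \<Lambda>) * (prl \<Lambda> * prl \<Lambda>)" unfolding \<Lambda>1_def by (simp only: mult.assoc mult.left_commute)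
  then have o1: "A.is_order \<Lambda>1"
    using full_mult[OF full_prl[OF full(1)]] zmod_leD[OF le full(2)] idem
    by (simp add: A.is_order_def \<Lambda>1_def)
  have "\<Lambda> * P * \<Lambda>1 = \<Lambda> * \<Lambda> * (P * prl \<Lambda>)" unfolding \<Lambda>1_def by (simp only: mult.assoc mult.left_commute)
  then have "\<Lambda> * P * \<Lambda>1 = \<Lambda> * P" using idem fP by simp
  moreover have "\<Lambda> * P * (\<Lambda> * Q) = \<Lambda> * \<Lambda> * (P * Q)" by (simp only: mult.assoc mult.left_commute)
  then have "\<Lambda> * P * (\<Lambda> * Q) = \<Lambda>1" using idem Q by (simp add: \<Lambda>1_def)
  ultimately have "A.invl \<Lambda>1 (\<Lambda> * P)"
    using full_mult[OF fP(1)] full_mult[OF Q(1)] unfolding A.invl_def by blast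
  then obtain L where L: "A.invl \<Lambda> L" "\<Lambda>1 * L = \<Lambda> * P" using A.invl_lift[OF o1 o le] by blast
  have prF: "prl (prl \<Lambda>) = prl \<Lambda>" "prl P = P"
    using fP(1) full_prl[OF full(1)] by (auto intro!: prl_F simp: full_def)
  have "prl (\<Lambda>1 * L) = prl (\<Lambda> * P)" using L(2) by simp
  then have "prl \<Lambda> * prl \<Lambda> * prl L = prl \<Lambda> * P" by (simp add: \<Lambda>1_def prl_mult prF)
  then have "prl (L * \<Lambda>) = P" using idem(2) fP(2) by (simp add: prl_mult mult.commute)
  then have "prl L = P" using L(1) unfolding A.invl_def by simp
  then show ?thesis using L(1) by blast
qed

text \<open>
  A preimage \<open>x\<close> of the generator \<open>a\<close> is a unit; after dividing by it, \<open>1 \<in> M1\<close> and the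
  projections of \<open>M1\<close> and \<open>\<Lambda>\<close> agree. The inverse \<open>K1\<close> of \<open>M1\<close> is then contained in \<open>\<Lambda>\<close> and
  contains an element \<open>1 + r\<close> with nilpotent \<open>r\<close>, a unit of \<open>\<Lambda>\<close>. So \<open>K1 = \<Lambda>\<close> and \<open>M1 = \<Lambda>\<close>.
\<close>

lemma principal_if_prl_principal:
  assumes o: "A.is_order \<Lambda>" and M: "A.invl \<Lambda> M" and a: "F.unit a" "prl M = cyc a * prl \<Lambda>"
  shows "\<exists>u. A.unit u \<and> M = cyc u * \<Lambda>"
proof -
  have idem: "\<Lambda> * \<Lambda> = \<Lambda>" by (rule A.order_idem[OF o])
  have one: "1 \<in> elts \<Lambda>" using o by (simp add: A.is_order_def)
  obtain b where b: "F.unit b" "a * b = 1" using F.unit_inverse[OF a(1)] by blast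
  have "a \<in> F" "b \<in> F" using a b by (auto simp: F.unit_def)
  have "a * 1 \<in> elts (prl M)"
    unfolding a(2) elts_cyc_mult elts_prl using one pr_one by (metis image_eqI)
  then obtain x where x: "x \<in> elts M" "pr F x = a" unfolding elts_prl by auto
  have ux: "A.unit x" using unit_if_pr_unit x(2) a(1) by simp
  obtain y where y: "A.unit y" "x * y = 1" using A.unit_inverse[OF ux] by blast
  define M1 where "M1 = cyc y * M"
  have inv1: "A.invl \<Lambda> M1" unfolding M1_def by (rule A.invl_unit_mult[OF y(1) M])
  have one1: "1 \<in> elts M1" unfolding M1_def elts_cyc_mult using x(1) y(2) by (metis image_eqI mult.commute)
  have "a * pr F y = 1" using y(2) x(2) pr_mult pr_one by metis
  then have ya: "pr F y * a = 1" by (simp add: mult.commute)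
  have "prl M1 = cyc (pr F y * a) * prl \<Lambda>"
    unfolding M1_def prl_mult prl_cyc a(2) by (simp add: mult.assoc[symmetric] cyc_mult)
  then have prM1: "prl M1 = prl \<Lambda>" using ya by simp
  obtain K where K: "M1 * K = \<Lambda>" using inv1 unfolding A.invl_def by blast
  define K1 where "K1 = K * \<Lambda>"
  have K1: "M1 * K1 = \<Lambda>" "K1 * \<Lambda> = K1"
    using K idem by (auto simp: K1_def mult.assoc[symmetric]) (simp add: mult.assoc idem)
  have "prl K1 = prl \<Lambda> * prl K1" using K1(2) by (metis mult.commute prl_mult)
  also have "\<dots> = prl \<Lambda>" using prM1 K1(1) by (metis prl_mult)
  finally have "1 \<in> elts (prl K1)" using imageI[OF one, of "pr F"] by (simp add: elts_prl pr_one)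
  then obtain z where z: "z \<in> elts K1" "pr F z = 1" unfolding elts_prl by auto
  have "1 * K1 \<le> M1 * K1" using one1 by (intro zmod_mult_mono order_refl) (simp add: one_le_iff)
  then have K1_le: "K1 \<le> \<Lambda>" using K1 by simp
  define r where "r = z - 1"
  have r: "r \<in> radical" "r \<in> elts \<Lambda>"
    using pr_diff[of z] z(2) elts_diff[OF zmod_leD[OF K1_le z(1)] one] by (auto simp: r_def)
  obtain w n where w: "(1 + r) * w = 1" "w = (\<Sum>i<n. (- r) ^ i)" using one_plus_radical_unit[OF r(1)] by blast
  have pow: "(- r) ^ i \<in> elts \<Lambda>" for i
  proof (induction i)
    case (Suc i)
    then have "(- r) * (- r) ^ i \<in> elts (\<Lambda> * \<Lambda>)" using r(2) by (intro zmod_mult_mem elts_uminus)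
    then show ?case using idem by simp
  qed (simp add: one)
  have "w \<in> elts \<Lambda>" unfolding w(2) using pow by (intro elts_sum)
  then have "z * w \<in> elts (K1 * \<Lambda>)" using z(1) by (intro zmod_mult_mem)
  moreover have "z * w = 1" using w(1) by (simp add: r_def)
  ultimately have "1 \<in> elts K1" using K1(2) by simp
  then have "1 * \<Lambda> \<le> K1 * \<Lambda>" by (intro zmod_mult_mono order_refl) (simp add: one_le_iff)
  then have "K1 = \<Lambda>" using K1(2) K1_le by simp
  then have "M1 = \<Lambda>" using K1(1) inv1 unfolding A.invl_def by simp
  moreover have "M = cyc x * M1" unfolding M1_def using y(2) by (simp add: mult.assoc[symmetric] cyc_mult)
  ultimately show ?thesis using ux by blast
qed

lemma group_epi_lattice_prl:
  assumes o: "A.is_order \<Lambda>"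
  shows "group_epi (A.lattice_group \<Lambda>) (sg_group (lattice_sg scale F) (pr F ` elts \<Lambda>))
    (\<lambda>L. pr F ` L)"
  unfolding elts_prl[symmetric]
proof (rule group_epi_sg_groupI[OF A.comm_semigrp_lattice_sg A.idempotent_lattice[OF o]
      F.comm_semigrp_lattice_sg F.idempotent_lattice[OF order_prl[OF o]]])
  show "pr F ` sg_mult (lattice_sg scale UNIV) X Y = sg_mult (lattice_sg scale F) (pr F ` X) (pr F ` Y)"
    if XY: "X \<in> carrier (A.lattice_group \<Lambda>)"
      "Y \<in> carrier (A.lattice_group \<Lambda>)" for X Y
  proof -
    obtain L K where "X = elts L" "Y = elts K" using XY unfolding A.carrier_lattice_group[OF o] by blast
    then show ?thesis
      by (simp add: A.lattice_sg_simps(2) F.lattice_sg_simps(2) prl_mult flip: elts_prl)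
  qed
  have "prl ` {L. A.invl \<Lambda> L} = {P. F.invl (prl \<Lambda>) P}"
    using invl_prl invl_prl_lift[OF o] by (force simp: image_iff)
  then have "elts ` prl ` {L. A.invl \<Lambda> L} = elts ` {P. F.invl (prl \<Lambda>) P}" by simp
  then show "(\<lambda>L. pr F ` L) ` carrier (A.lattice_group \<Lambda>) =
      carrier (F.lattice_group (prl \<Lambda>))"
    unfolding A.carrier_lattice_group[OF o] F.carrier_lattice_group[OF order_prl[OF o]]
    by (simp add: image_image elts_prl)
qed

definition eps_pr :: "'a set set \<Rightarrow> 'a set set" where
  "eps_pr X = (\<Union>L\<in>X. eps_class scale F (pr F ` L))"

lemma pr_unit: "A.unit a \<Longrightarrow> F.unit (pr F a)"
  unfolding A.unit_def F.unit_def using pr_mem pr_mult pr_one by metis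

lemma eps_pr_ecl:
  assumes L: "full UNIV L"
  shows "eps_pr (A.ecl L) = F.ecl (prl L)"
proof -
  have "eps_class scale F (pr F ` X) = F.ecl (prl L)" if X: "X \<in> A.ecl L" for X
  proof -
    obtain a where a: "A.unit a" "X = elts (cyc a * L)" using X A.in_ecl_iff[OF L] by blast
    then have "eps_class scale F (pr F ` X) = F.ecl (cyc (pr F a) * prl L)"
      by (simp add: F.ecl_def prl_mult prl_cyc flip: elts_prl)
    then show ?thesis using F.ecl_unit_mult[OF pr_unit[OF a(1)] full_prl[OF L]] by simp
  qed
  then show ?thesis unfolding eps_pr_def using A.elts_in_ecl[OF L] by blast
qed

lemma semigrp_epi_eps: "semigrp_epi (eps_sg scale UNIV) (eps_sg scale F) eps_pr"
  unfolding semigrp_epi_def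
proof (intro conjI ballI)
  show "eps_pr (sg_mult (eps_sg scale UNIV) X Y) = sg_mult (eps_sg scale F) (eps_pr X) (eps_pr Y)"
    if XY: "X \<in> sg_carrier (eps_sg scale UNIV)" "Y \<in> sg_carrier (eps_sg scale UNIV)" for X Y
  proof -
    obtain L K where LK: "X = A.ecl L" "Y = A.ecl K" "full UNIV L" "full UNIV K"
      using XY unfolding A.eps_sg_carrier by blast
    then show ?thesis
      by (simp add: A.eps_sg_mult F.eps_sg_mult eps_pr_ecl A.full_times full_prl prl_mult)
  qed
  show "eps_pr ` sg_carrier (eps_sg scale UNIV) = sg_carrier (eps_sg scale F)"
  proof (rule equalityI; rule subsetI)
    fix X assume "X \<in> eps_pr ` sg_carrier (eps_sg scale UNIV)"
    then obtain L where "full UNIV L" "X = eps_pr (A.ecl L)" unfolding A.eps_sg_carrier by blast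
    then show "X \<in> sg_carrier (eps_sg scale F)"
      unfolding F.eps_sg_carrier using eps_pr_ecl full_prl by blast
  next
    fix X assume "X \<in> sg_carrier (eps_sg scale F)"
    then obtain P where "X = F.ecl P" "full F P" unfolding F.eps_sg_carrier by blast
    then obtain L where "full UNIV L" "X = eps_pr (A.ecl L)" using prl_surj eps_pr_ecl by metis
    then show "X \<in> eps_pr ` sg_carrier (eps_sg scale UNIV)" unfolding A.eps_sg_carrier by blast
  qed
qed (rule A.comm_semigrp_eps_sg F.comm_semigrp_eps_sg)+

text \<open>
  If the classes of \<open>L\<close> and \<open>K\<close> have the same image, then \<open>L K\<^sup>-\<^sup>1\<close> has principal projection and is
  therefore principal.
\<close>

lemma eps_pr_iso:
  assumes o: "A.is_order \<Lambda>"
  shows "eps_pr \<in> iso (A.class_group \<Lambda>) (F.class_group (prl \<Lambda>))"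
proof -
  note oF = order_prl[OF o]
  let ?G = "A.class_group \<Lambda>" and ?H = "F.class_group (prl \<Lambda>)"
  have G: "carrier ?G = A.ecl ` {L. A.invl \<Lambda> L}" and H: "carrier ?H = F.ecl ` {P. F.invl (prl \<Lambda>) P}"
    using A.carrier_eps_group[OF o] F.carrier_eps_group[OF oF] by auto
  have full: "full UNIV L" if "A.invl \<Lambda> L" for L using that by (simp add: A.invl_def)
  have "eps_pr ` A.ecl ` {L. A.invl \<Lambda> L} = F.ecl ` prl ` {L. A.invl \<Lambda> L}"
    unfolding image_image using full by (intro image_cong) (auto simp: eps_pr_ecl)
  also have "prl ` {L. A.invl \<Lambda> L} = {P. F.invl (prl \<Lambda>) P}"
    using invl_prl invl_prl_lift[OF o] by (force simp: image_iff)
  finally have surj: "eps_pr ` carrier ?G = carrier ?H" unfolding G H .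
  have "inj_on eps_pr (A.ecl ` {L. A.invl \<Lambda> L})"
  proof (rule inj_onI; clarify)
    fix L K assume L: "A.invl \<Lambda> L" and K: "A.invl \<Lambda> K" and eq: "eps_pr (A.ecl L) = eps_pr (A.ecl K)"
    have "F.ecl (prl K) = F.ecl (prl L)" using eq eps_pr_ecl full L K by simp
    then obtain a where a: "F.unit a" "prl L = cyc a * prl K"
      using F.ecl_eq_iff[OF full_prl[OF full[OF K]] full_prl[OF full[OF L]]] by blast
    obtain J where J: "K * J = \<Lambda>" "full UNIV J" using K unfolding A.invl_def by blast
    define J1 where "J1 = J * \<Lambda>"
    have \<Lambda>\<Lambda>: "\<Lambda> * \<Lambda> = \<Lambda>" by (rule A.order_idem[OF o])
    have J1: "K * J1 = \<Lambda>" "J1 * \<Lambda> = J1"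
      using J \<Lambda>\<Lambda> by (auto simp: J1_def mult.assoc[symmetric]) (simp add: mult.assoc \<Lambda>\<Lambda>)
    have fJ1: "full UNIV J1" unfolding J1_def using J(2) o A.full_times by (simp add: A.is_order_def)
    have "A.invl \<Lambda> J1" unfolding A.invl_def
      using J1 fJ1 full[OF K] by (auto simp: mult.commute)
    then have "A.invl \<Lambda> (L * J1)" using A.invl_mult L by blast
    moreover have "prl (L * J1) = cyc a * prl \<Lambda>"
      unfolding prl_mult a(2) using J1(1) by (metis mult.assoc prl_mult)
    ultimately obtain u where u: "A.unit u" "L * J1 = cyc u * \<Lambda>"
      using principal_if_prl_principal[OF o] a(1) by blast
    have "L = L * (K * J1)" using L J1(1) unfolding A.invl_def by simp
    also have "\<dots> = (L * J1) * K" by (simp only: mult.assoc mult.left_commute mult.commute)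
    also have "\<dots> = cyc u * (K * \<Lambda>)" unfolding u(2) by (simp only: mult.assoc mult.left_commute mult.commute)
    finally have "L = cyc u * K" using K unfolding A.invl_def by simp
    then show "A.ecl L = A.ecl K" using A.ecl_unit_mult[OF u(1) full[OF K]] by simp
  qed
  then have inj: "inj_on eps_pr (carrier ?G)" unfolding G .
  have "eps_pr (sg_mult (eps_sg scale UNIV) X Y) = sg_mult (eps_sg scale F) (eps_pr X) (eps_pr Y)"
    if XY: "X \<in> carrier ?G" "Y \<in> carrier ?G" for X Y
  proof -
    obtain L K where "X = A.ecl L" "Y = A.ecl K" "full UNIV L" "full UNIV K"
      using XY full unfolding G by blast
    then show ?thesis
      by (simp add: A.eps_sg_mult F.eps_sg_mult eps_pr_ecl A.full_times full_prl prl_mult)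
  qed
  then have "eps_pr \<in> hom ?G ?H" using surj by (auto simp: hom_def)
  then show ?thesis using inj surj by (simp add: iso_def bij_betw_def)
qed

lemma finite_eps_group:
  assumes o: "A.is_order \<Lambda>"
  shows "finite (carrier (A.class_group \<Lambda>))"
proof (rule finite_subset[OF _ finite_classes_with_order[OF o]])
  show "carrier (A.class_group \<Lambda>) \<subseteq> eps_classes_with_order scale UNIV (elts \<Lambda>)"
  proof
    fix C assume "C \<in> carrier (A.class_group \<Lambda>)"
    then obtain L where L: "A.invl \<Lambda> L" "C = A.ecl L" unfolding A.carrier_eps_group[OF o] by blast
    then have "full UNIV L" by (simp add: A.invl_def)
    then show "C \<in> eps_classes_with_order scale UNIV (elts \<Lambda>)"
      unfolding A.classes_with_order_iff using L A.order_of_invl[OF o L(1)] by blast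
  qed
qed

lemma power_invertible:
  assumes n: "dim (UNIV :: 'a set) \<ge> 2" and L: "full UNIV L" and k: "k \<ge> dim (UNIV :: 'a set) - 1"
  shows "sg_invertible (lattice_sg scale UNIV) (sg_power (lattice_sg scale UNIV) (elts L) k)"
proof -
  have "((\<lambda>x. sg_mult (lattice_sg scale UNIV) x (elts L)) ^^ i) (elts L) = elts (L ^ Suc i)" for i
    by (induction i) (simp_all add: A.lattice_sg_simps(2) mult.commute mult.assoc)
  note pow = this[of "k - 1"]
  have "Suc (k - 1) = k" using n k by simp
  then have power: "sg_power (lattice_sg scale UNIV) (elts L) k = elts (L ^ k)"
    unfolding sg_power_def using pow by (simp only:)
  obtain D K where DK: "full UNIV D" "full UNIV K" "D * D = D" "L ^ k * D = L ^ k" "L ^ k * K = D"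
    using lattice_power_invertible[OF L n k] by blast
  have "full UNIV (L ^ k)" using A.full_power[OF L, of "k - 1"] \<open>Suc (k - 1) = k\<close> by (simp only:)
  then have "sg_invertible_wrt (lattice_sg scale UNIV) (elts (L ^ k)) (elts D)"
    unfolding sg_invertible_wrt_def sg_idempotent_def A.lattice_sg_simps(1)
    using DK A.lattice_sg_simps(2) by (auto simp: Bex_def A.lattice_sg_simps(1))
  then show ?thesis unfolding sg_invertible_def power by blast
qed

end

theorem theorem1p3:
  fixes scale :: "rat \<Rightarrow> 'a::comm_ring_1 \<Rightarrow> 'a" and F :: "'a set"
  assumes "fin_dim_rat_algebra scale"
    and "separable_part scale F"
  shows
    "(\<comment> \<open>(a)\<close>
      \<forall>\<Lambda>\<in>orders scale UNIV. finite (eps_classes_with_order scale UNIV \<Lambda>)) \<and>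
     (\<comment> \<open>(b)\<close>
      \<forall>\<Lambda>\<in>orders scale UNIV.
        let X = eps_classes_with_order scale UNIV \<Lambda>;
            W = X // w_rel (eps_sg scale UNIV);
            G = sg_group (eps_sg scale UNIV) (eps_class scale UNIV \<Lambda>)
        in \<Union>W = X \<and> finite W \<and> (\<forall>C\<in>W. finite C) \<and> (\<forall>C\<in>W. \<forall>D\<in>W. card C = card D) \<and>
           carrier G \<in> W \<and> group G) \<and>
     (\<comment> \<open>(c)\<close>
      \<forall>\<Lambda>\<^sub>1\<in>orders scale UNIV. \<forall>\<Lambda>\<^sub>2\<in>orders scale UNIV. \<Lambda>\<^sub>2 \<subseteq> \<Lambda>\<^sub>1 \<longrightarrow>
        group_epi (sg_group (lattice_sg scale UNIV) \<Lambda>\<^sub>2) (sg_group (lattice_sg scale UNIV) \<Lambda>\<^sub>1)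
          (\<lambda>L. lat_mult \<Lambda>\<^sub>1 L) \<and>
        (\<exists>h. group_epi
               (sg_group (eps_sg scale UNIV) (eps_class scale UNIV \<Lambda>\<^sub>2))
               (sg_group (eps_sg scale UNIV) (eps_class scale UNIV \<Lambda>\<^sub>1)) h \<and>
             (\<forall>L\<in>full_lattices scale UNIV.
                eps_class scale UNIV L
                  \<in> carrier (sg_group (eps_sg scale UNIV) (eps_class scale UNIV \<Lambda>\<^sub>2)) \<longrightarrow>
                h (eps_class scale UNIV L) = eps_class scale UNIV (lat_mult \<Lambda>\<^sub>1 L)))) \<and>
     (\<comment> \<open>(d)\<close>
      semigrp_epi (lattice_sg scale UNIV) (lattice_sg scale F) (\<lambda>L. pr F ` L) \<and>
      (\<forall>\<Lambda>\<in>orders scale UNIV.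
         group_epi (sg_group (lattice_sg scale UNIV) \<Lambda>) (sg_group (lattice_sg scale F) (pr F ` \<Lambda>))
           (\<lambda>L. pr F ` L)) \<and>
      (\<exists>h. semigrp_epi (eps_sg scale UNIV) (eps_sg scale F) h \<and>
           (\<forall>L\<in>full_lattices scale UNIV. h (eps_class scale UNIV L) = eps_class scale F (pr F ` L)) \<and>
           (\<forall>\<Lambda>\<in>orders scale UNIV.
              let G = sg_group (eps_sg scale UNIV) (eps_class scale UNIV \<Lambda>);
                  H = sg_group (eps_sg scale F) (eps_class scale F (pr F ` \<Lambda>))
              in group G \<and> group H \<and> finite (carrier G) \<and> finite (carrier H) \<and> h \<in> iso G H))) \<and>
     (\<comment> \<open>(e)\<close>
      vector_space.dim scale UNIV \<ge> 2 \<longrightarrow>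
        (\<forall>L\<in>full_lattices scale UNIV. \<forall>k \<ge> vector_space.dim scale UNIV - 1.
           sg_invertible (lattice_sg scale UNIV) (sg_power (lattice_sg scale UNIV) L k)))"
proof -
  obtain E where "split_algebra scale F E"
    using fin_dim_rat_algebra.separable_part_split[OF assms] by blast
  then interpret split_algebra scale F E .
  have ord: "\<exists>\<Lambda>'. \<Lambda> = elts \<Lambda>' \<and> A.is_order \<Lambda>'" if "\<Lambda> \<in> orders scale UNIV" for \<Lambda>
    using that A.orders_iff by blast
  have a: "finite (eps_classes_with_order scale UNIV \<Lambda>)" if "\<Lambda> \<in> orders scale UNIV" for \<Lambda>
    using ord[OF that] finite_classes_with_order by blast
  have b: "let X = eps_classes_with_order scale UNIV \<Lambda>;
            W = X // w_rel (eps_sg scale UNIV);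
            G = sg_group (eps_sg scale UNIV) (eps_class scale UNIV \<Lambda>)
        in \<Union>W = X \<and> finite W \<and> (\<forall>C\<in>W. finite C) \<and> (\<forall>C\<in>W. \<forall>D\<in>W. card C = card D) \<and>
           carrier G \<in> W \<and> group G" if \<Lambda>: "\<Lambda> \<in> orders scale UNIV" for \<Lambda>
  proof -
    obtain \<Lambda>' where o: "\<Lambda> = elts \<Lambda>'" "A.is_order \<Lambda>'" using ord[OF \<Lambda>] by blast
    note W = A.w_classes[OF o(2) a[OF \<Lambda>, unfolded o(1)], folded o(1), unfolded A.ecl_def, folded o(1)]
    have "group (sg_group (eps_sg scale UNIV) (eps_class scale UNIV \<Lambda>))"
      using group_sg_group[OF A.comm_semigrp_eps_sg A.idempotent_eps[OF o(2)]]
      unfolding A.ecl_def o(1) .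
    then show ?thesis unfolding Let_def using W by (intro conjI)
  qed
  have c: "group_epi (sg_group (lattice_sg scale UNIV) \<Lambda>2) (sg_group (lattice_sg scale UNIV) \<Lambda>1)
          (\<lambda>L. lat_mult \<Lambda>1 L) \<and>
        (\<exists>h. group_epi
               (sg_group (eps_sg scale UNIV) (eps_class scale UNIV \<Lambda>2))
               (sg_group (eps_sg scale UNIV) (eps_class scale UNIV \<Lambda>1)) h \<and>
             (\<forall>L\<in>full_lattices scale UNIV.
                eps_class scale UNIV L
                  \<in> carrier (sg_group (eps_sg scale UNIV) (eps_class scale UNIV \<Lambda>2)) \<longrightarrow>
                h (eps_class scale UNIV L) = eps_class scale UNIV (lat_mult \<Lambda>1 L)))"
    if \<Lambda>: "\<Lambda>1 \<in> orders scale UNIV" "\<Lambda>2 \<in> orders scale UNIV" "\<Lambda>2 \<subseteq> \<Lambda>1" for \<Lambda>1 \<Lambda>2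
  proof -
    obtain M1 where o1: "\<Lambda>1 = elts M1" "A.is_order M1" using ord[OF \<Lambda>(1)] by blast
    obtain M2 where o2: "\<Lambda>2 = elts M2" "A.is_order M2" using ord[OF \<Lambda>(2)] by blast
    have le: "M2 \<le> M1" using \<Lambda>(3) o1(1) o2(1) by (simp add: less_eq_zmod_def)
    have f1: "full UNIV M1" using o1(2) by (simp add: A.is_order_def)
    have "eps_mult scale UNIV (eps_class scale UNIV \<Lambda>1) (eps_class scale UNIV L) =
        eps_class scale UNIV (lat_mult \<Lambda>1 L)" if L: "L \<in> full_lattices scale UNIV" for L
    proof -
      obtain K where K: "L = elts K" "full UNIV K" using L A.lattice_sg_simps(1)[of L] by (auto simp: lattice_sg_def)
      then show ?thesis using A.eps_mult_ecl[OF f1 K(2)] by (simp add: A.ecl_def o1(1) lat_mult_elts)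
    qed
    then show ?thesis
      using A.group_epi_lattice_groups[OF o1(2) o2(2) le] A.group_epi_eps_groups[OF o1(2) o2(2) le]
      unfolding A.ecl_def o1(1) o2(1) by blast
  qed
  have d1: "group_epi (sg_group (lattice_sg scale UNIV) \<Lambda>) (sg_group (lattice_sg scale F) (pr F ` \<Lambda>))
           (\<lambda>L. pr F ` L)" if "\<Lambda> \<in> orders scale UNIV" for \<Lambda>
    using ord[OF that] group_epi_lattice_prl by blast
  have d2: "eps_pr (eps_class scale UNIV L) = eps_class scale F (pr F ` L)"
    if L: "L \<in> full_lattices scale UNIV" for L
  proof -
    obtain K where K: "L = elts K" "full UNIV K" using L A.lattice_sg_simps(1)[of L] by (auto simp: lattice_sg_def)
    then show ?thesis using eps_pr_ecl[OF K(2)] by (simp add: A.ecl_def F.ecl_def elts_prl)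
  qed
  have d3: "let G = sg_group (eps_sg scale UNIV) (eps_class scale UNIV \<Lambda>);
                  H = sg_group (eps_sg scale F) (eps_class scale F (pr F ` \<Lambda>))
              in group G \<and> group H \<and> finite (carrier G) \<and> finite (carrier H) \<and> eps_pr \<in> iso G H"
    if \<Lambda>: "\<Lambda> \<in> orders scale UNIV" for \<Lambda>
  proof -
    obtain M where o: "\<Lambda> = elts M" "A.is_order M" using ord[OF \<Lambda>] by blast
    have G: "sg_group (eps_sg scale UNIV) (eps_class scale UNIV \<Lambda>) = sg_group (eps_sg scale UNIV) (A.ecl M)"
      and H: "sg_group (eps_sg scale F) (eps_class scale F (pr F ` \<Lambda>)) = sg_group (eps_sg scale F) (F.ecl (prl M))"
      by (simp_all add: A.ecl_def F.ecl_def o(1) elts_prl)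
    have "bij_betw eps_pr (carrier (sg_group (eps_sg scale UNIV) (A.ecl M)))
        (carrier (sg_group (eps_sg scale F) (F.ecl (prl M))))"
      using eps_pr_iso[OF o(2)] by (simp add: iso_def)
    then have "finite (carrier (sg_group (eps_sg scale F) (F.ecl (prl M))))"
      using finite_eps_group[OF o(2)] bij_betw_finite by blast
    then show ?thesis
      unfolding G H Let_def
      using group_sg_group[OF A.comm_semigrp_eps_sg A.idempotent_eps[OF o(2)]]
        group_sg_group[OF F.comm_semigrp_eps_sg F.idempotent_eps[OF order_prl[OF o(2)]]]
        finite_eps_group[OF o(2)] eps_pr_iso[OF o(2)] by blast
  qed
  have e: "sg_invertible (lattice_sg scale UNIV) (sg_power (lattice_sg scale UNIV) L k)"
    if L: "dim (UNIV :: 'a set) \<ge> 2" "L \<in> full_lattices scale UNIV" "k \<ge> dim (UNIV :: 'a set) - 1" for L k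
  proof -
    obtain K where K: "L = elts K" "full UNIV K" using L(2) A.lattice_sg_simps(1)[of L] by (auto simp: lattice_sg_def)
    then show ?thesis using power_invertible[OF L(1) K(2) L(3)] by simp
  qed
  show ?thesis
    apply (intro conjI)
    subgoal using a by blast
    subgoal using b by blast
    subgoal using c by blast
    subgoal by (rule semigrp_epi_lattice)
    subgoal using d1 by blast
    subgoal using semigrp_epi_eps d2 d3 by blast
    subgoal using e by blast
    done
qed

end
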